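(* Let $d\ge1$, $m_0,m_1\in\mathbb R^d$, $\Sigma_0,\Sigma_1\in\mathbb S_{++}^d$, $a,b>0$, and let $\mu_0=\mathcal N(m_0,\Sigma_0)$, $\mu_1=\mathcal N(m_1,\Sigma_1)$. Let $\bar\tau_0,\bar\tau_1>0$ be fixed, put $\tau_i=\lambda\bar\tau_i$ for $i=0,1$, and let $\lambda\to\infty$. Set $$\theta_i=\frac{\bar\tau_i}{\bar\tau_0+\bar\tau_1}\ (i=0,1),\qquad G=a^{\theta_0}b^{\theta_1}.$$ With $p_*,q_*,M_*$ (depending on $\lambda$ through $\tau_0,\tau_1$) and $\mathsf U_{\tau_0,\tau_1}$ as defined in the context, one has $p_*\to\mu_0$, $q_*\to\mu_1$, $M_*\to G$, and $$\mathsf U_{\lambda\bar\tau_0,\lambda\bar\tau_1}(a\mu_0,b\mu_1)=\lambda\left[\bar\tau_0a+\bar\tau_1b-(\bar\tau_0+\bar\tau_1)G\right]+G\,W_2^2(\mu_0,\mu_1)+o(1)\qquad(\lambda\to\infty).$$ The coefficient of $\lambda$, namely $\bar\tau_0a+\bar\tau_1b-(\bar\tau_0+\bar\tau_1)G$, is non-negative and vanishes if and only if $a=b$. Consequently, if $a=b=m$, then for arbitrary fixed $\bar\tau_0,\bar\tau_1>0$, $$\mathsf U_{\lambda\bar\tau_0,\lambda\bar\tau_1}(m\mu_0,m\mu_1)\to m\,W_2^2(\mu_0,\mu_1)\qquad(\lambda\to\infty).$$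
   Context: $\mathbb S_{++}^d$ is the cone of real symmetric positive definite $d\times d$ matrices and $I$ is the $d\times d$ identity matrix. $\mathcal N(m,\Sigma)$ is the Gaussian probability measure with mean $m$ and covariance $\Sigma$. $\mathcal M_+(E)$ is the cone of finite non-negative Borel measures on $E$. For $\gamma\in\mathcal M_+(\mathbb R^d\times\mathbb R^d)$, $\gamma_0$ and $\gamma_1$ denote its first and second marginals. $W_2$ is the quadratic Wasserstein distance on Borel probability measures on $\mathbb R^d$ with finite second moment (cost $\|x-y\|^2$). Convergence of the Gaussian measures $p_*,q_*$ is convergence of their means and covariances (equivalently here, weak convergence). For finite non-negative measures $\rho,\eta$ the generalized Kullback--Leibler divergence is $\mathrm{KL}(\rho\mid\eta)=\int(r\log r-r+1)\,\mathrm d\eta$ if $\rho\ll\eta$ with $r=\mathrm d\rho/\mathrm d\eta$, and $\mathrm{KL}(\rho\mid\eta)=+\infty$ if $\rho\not\ll\eta$. For $\tau_0,\tau_1>0$, $\alpha=a\mu_0$, $\beta=b\mu_1$, $$\mathsf U_{\tau_0,\tau_1}(\alpha,\beta)=\inf_{\gamma\in\mathcal M_+(\mathbb R^d\times\mathbb R^d)}\left\{\int\|x-y\|^2\,\mathrm d\gamma(x,y)+\tau_0\,\mathrm{KL}(\gamma_0\mid\alpha)+\tau_1\,\mathrm{KL}(\gamma_1\mid\beta)\right\}.$$ Definitions for given $\tau_0,\tau_1>0$ (all matrix square roots are principal square roots): $r_0=2/\tau_0$, $r_1=2/\tau_1$, $A_0=\Sigma_0^{-1}$, $A_1=\Sigma_1^{-1}$,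 $C_0=A_0+r_0I$, $C_1=A_1+r_1I$, $\kappa=r_1-r_0$; $$S_*=\tfrac12\left[\kappa I+\left(\kappa^2I+4C_1^{1/2}C_0C_1^{1/2}\right)^{1/2}\right],\qquad L_*=C_1^{-1/2}S_*C_1^{-1/2};$$ $$P_*=[A_0+r_0(I-L_* )]^{-1},\qquad Q_*=L_*P_*L_*$$ (the matrices $P_*,Q_*$ are positive definite); $$h_*=(I+r_0\Sigma_0+r_1\Sigma_1)^{-1}(m_0-m_1),\qquad u_*=m_0-r_0\Sigma_0h_*,\qquad v_*=m_1+r_1\Sigma_1h_*;$$ $$p_*=\mathcal N(u_*,P_* ),\qquad q_*=\mathcal N(v_*,Q_* );$$ $$\mathcal A_*=W_2^2(p_*,q_* )+\tau_0\,\mathrm{KL}(p_*\mid\mu_0)+\tau_1\,\mathrm{KL}(q_*\mid\mu_1);$$ $$M_*=a^{\tau_0/(\tau_0+\tau_1)}\,b^{\tau_1/(\tau_0+\tau_1)}\exp\left(-\frac{\mathcal A_*}{\tau_0+\tau_1}\right).$$ *)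

theory Defs
  imports "HOL-Probability.Probability"
begin

definition sym_pos_def :: "real ^ 'n ^ 'n \<Rightarrow> bool" where
  "sym_pos_def A \<longleftrightarrow> transpose A = A \<and> (\<forall>x. x \<noteq> 0 \<longrightarrow> 0 < x \<bullet> (A *v x))"

text \<open>Principal square root of a symmetric positive definite matrix; unspecified elsewhere.\<close>

definition mat_sqrt :: "real ^ 'n ^ 'n \<Rightarrow> real ^ 'n ^ 'n" where
  "mat_sqrt A = (THE B. sym_pos_def B \<and> B ** B = A)"

text \<open>The Gaussian measure; meaningful for a symmetric positive definite covariance \<open>S\<close>.\<close>

definition gaussian :: "real ^ 'n \<Rightarrow> real ^ 'n ^ 'n \<Rightarrow> (real ^ 'n) measure" where
  "gaussian m S = density lborel (\<lambda>x. ennreal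
     (exp (- ((x - m) \<bullet> (matrix_inv S *v (x - m))) / 2) / sqrt ((2 * pi) ^ CARD('n) * det S)))"

definition mean_vec :: "(real ^ 'n) measure \<Rightarrow> real ^ 'n" where
  "mean_vec M = (LINT x|M. x)"

definition cov_mat :: "(real ^ 'n) measure \<Rightarrow> real ^ 'n ^ 'n" where
  "cov_mat M = (\<chi> i j. LINT x|M. (x $ i - mean_vec M $ i) * (x $ j - mean_vec M $ j))"

text \<open>Convergence of Gaussian measures is convergence of their means and covariances.\<close>

definition gaussian_tendsto ::
  "('a \<Rightarrow> (real ^ 'n) measure) \<Rightarrow> (real ^ 'n) measure \<Rightarrow> 'a filter \<Rightarrow> bool" where
  "gaussian_tendsto p M F \<longleftrightarrow>
     ((\<lambda>t. mean_vec (p t)) \<longlongrightarrow> mean_vec M) F \<and> ((\<lambda>t. cov_mat (p t)) \<longlongrightarrow> cov_mat M) F"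

definition marginal0 :: "((real ^ 'n) \<times> (real ^ 'n)) measure \<Rightarrow> (real ^ 'n) measure" where
  "marginal0 g = distr g borel fst"

definition marginal1 :: "((real ^ 'n) \<times> (real ^ 'n)) measure \<Rightarrow> (real ^ 'n) measure" where
  "marginal1 g = distr g borel snd"

definition finite_borel_measures :: "'a::topological_space measure set" where
  "finite_borel_measures = {g. sets g = sets borel \<and> finite_measure g}"

definition transport_cost :: "((real ^ 'n) \<times> (real ^ 'n)) measure \<Rightarrow> ennreal" where
  "transport_cost g = (\<integral>\<^sup>+ z. ennreal ((norm (fst z - snd z))\<^sup>2) \<partial>g)"

definition couplings ::
  "(real ^ 'n) measure \<Rightarrow> (real ^ 'n) measure \<Rightarrow> ((real ^ 'n) \<times> (real ^ 'n)) measure set" where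
  "couplings M N = {g \<in> finite_borel_measures. marginal0 g = M \<and> marginal1 g = N}"

text \<open>For Borel probability measures with finite second moments the infimum is finite, so
  the conversion to a real number loses nothing.\<close>

definition W2 :: "(real ^ 'n) measure \<Rightarrow> (real ^ 'n) measure \<Rightarrow> real" where
  "W2 M N = sqrt (enn2real (INF g \<in> couplings M N. transport_cost g))"

text \<open>Generalized Kullback--Leibler divergence of \<open>R\<close> with respect to \<open>N\<close>. The integrand
  is non-negative, and its value at \<open>r = 0\<close> is \<open>1\<close>. In the library
  \<open>absolutely_continuous N R\<close> means that \<open>R\<close> is absolutely continuous with respect to \<open>N\<close>.\<close>

definition KL :: "'a measure \<Rightarrow> 'a measure \<Rightarrow> ennreal" where
  "KL R N = (if absolutely_continuous N R
     then (\<integral>\<^sup>+ x. (let r = enn2real (RN_deriv N R x) in ennreal (r * ln r - r + 1)) \<partial>N)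
     else \<infinity>)"

definition UOT ::
  "real \<Rightarrow> real \<Rightarrow> (real ^ 'n) measure \<Rightarrow> (real ^ 'n) measure \<Rightarrow> ennreal" where
  "UOT t0 t1 A B = (INF g \<in> finite_borel_measures.
     transport_cost g + ennreal t0 * KL (marginal0 g) A + ennreal t1 * KL (marginal1 g) B)"

definition C_mat :: "real \<Rightarrow> real ^ 'n ^ 'n \<Rightarrow> real ^ 'n ^ 'n" where
  "C_mat t S = matrix_inv S + (2 / t) *\<^sub>R mat 1"

definition S_star :: "real \<Rightarrow> real \<Rightarrow> real ^ 'n ^ 'n \<Rightarrow> real ^ 'n ^ 'n \<Rightarrow> real ^ 'n ^ 'n" where
  "S_star t0 t1 S0 S1 =
     (let k = 2 / t1 - 2 / t0; C0 = C_mat t0 S0; C1 = C_mat t1 S1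
      in (1 / 2) *\<^sub>R (k *\<^sub>R mat 1 +
           mat_sqrt (k\<^sup>2 *\<^sub>R mat 1 + 4 *\<^sub>R (mat_sqrt C1 ** C0 ** mat_sqrt C1))))"

definition L_star :: "real \<Rightarrow> real \<Rightarrow> real ^ 'n ^ 'n \<Rightarrow> real ^ 'n ^ 'n \<Rightarrow> real ^ 'n ^ 'n" where
  "L_star t0 t1 S0 S1 =
     (let C1 = C_mat t1 S1
      in matrix_inv (mat_sqrt C1) ** S_star t0 t1 S0 S1 ** matrix_inv (mat_sqrt C1))"

definition P_star :: "real \<Rightarrow> real \<Rightarrow> real ^ 'n ^ 'n \<Rightarrow> real ^ 'n ^ 'n \<Rightarrow> real ^ 'n ^ 'n" where
  "P_star t0 t1 S0 S1 =
     matrix_inv (matrix_inv S0 + (2 / t0) *\<^sub>R (mat 1 - L_star t0 t1 S0 S1))"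

definition Q_star :: "real \<Rightarrow> real \<Rightarrow> real ^ 'n ^ 'n \<Rightarrow> real ^ 'n ^ 'n \<Rightarrow> real ^ 'n ^ 'n" where
  "Q_star t0 t1 S0 S1 = L_star t0 t1 S0 S1 ** P_star t0 t1 S0 S1 ** L_star t0 t1 S0 S1"

definition h_star :: "real \<Rightarrow> real \<Rightarrow> real ^ 'n \<Rightarrow> real ^ 'n \<Rightarrow>
    real ^ 'n ^ 'n \<Rightarrow> real ^ 'n ^ 'n \<Rightarrow> real ^ 'n" where
  "h_star t0 t1 m0 m1 S0 S1 =
     matrix_inv (mat 1 + (2 / t0) *\<^sub>R S0 + (2 / t1) *\<^sub>R S1) *v (m0 - m1)"

definition u_star :: "real \<Rightarrow> real \<Rightarrow> real ^ 'n \<Rightarrow> real ^ 'n \<Rightarrow>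
    real ^ 'n ^ 'n \<Rightarrow> real ^ 'n ^ 'n \<Rightarrow> real ^ 'n" where
  "u_star t0 t1 m0 m1 S0 S1 = m0 - (2 / t0) *\<^sub>R (S0 *v h_star t0 t1 m0 m1 S0 S1)"

definition v_star :: "real \<Rightarrow> real \<Rightarrow> real ^ 'n \<Rightarrow> real ^ 'n \<Rightarrow>
    real ^ 'n ^ 'n \<Rightarrow> real ^ 'n ^ 'n \<Rightarrow> real ^ 'n" where
  "v_star t0 t1 m0 m1 S0 S1 = m1 + (2 / t1) *\<^sub>R (S1 *v h_star t0 t1 m0 m1 S0 S1)"

definition p_star :: "real \<Rightarrow> real \<Rightarrow> real ^ 'n \<Rightarrow> real ^ 'n \<Rightarrow>
    real ^ 'n ^ 'n \<Rightarrow> real ^ 'n ^ 'n \<Rightarrow> (real ^ 'n) measure" where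
  "p_star t0 t1 m0 m1 S0 S1 = gaussian (u_star t0 t1 m0 m1 S0 S1) (P_star t0 t1 S0 S1)"

definition q_star :: "real \<Rightarrow> real \<Rightarrow> real ^ 'n \<Rightarrow> real ^ 'n \<Rightarrow>
    real ^ 'n ^ 'n \<Rightarrow> real ^ 'n ^ 'n \<Rightarrow> (real ^ 'n) measure" where
  "q_star t0 t1 m0 m1 S0 S1 = gaussian (v_star t0 t1 m0 m1 S0 S1) (Q_star t0 t1 S0 S1)"

text \<open>The divergences below are between non-degenerate Gaussian measures, hence finite.\<close>

definition A_star :: "real \<Rightarrow> real \<Rightarrow> real ^ 'n \<Rightarrow> real ^ 'n \<Rightarrow>
    real ^ 'n ^ 'n \<Rightarrow> real ^ 'n ^ 'n \<Rightarrow> real" where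
  "A_star t0 t1 m0 m1 S0 S1 =
     (let p = p_star t0 t1 m0 m1 S0 S1; q = q_star t0 t1 m0 m1 S0 S1
      in (W2 p q)\<^sup>2 + t0 * enn2real (KL p (gaussian m0 S0)) + t1 * enn2real (KL q (gaussian m1 S1)))"

definition M_star :: "real \<Rightarrow> real \<Rightarrow> real \<Rightarrow> real \<Rightarrow> real ^ 'n \<Rightarrow> real ^ 'n \<Rightarrow>
    real ^ 'n ^ 'n \<Rightarrow> real ^ 'n ^ 'n \<Rightarrow> real" where
  "M_star t0 t1 a b m0 m1 S0 S1 =
     a powr (t0 / (t0 + t1)) * b powr (t1 / (t0 + t1)) *
     exp (- A_star t0 t1 m0 m1 S0 S1 / (t0 + t1))"

end

theory Submission
  imports Defs
begin

text \<open>The upper bound on the transport functional holds without error term: test with \<open>G\<close> times a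
  nearly optimal coupling. For the lower bound, optimal quadratic Kantorovich potentials, shifted by
  \<open>\<tau>\<^sub>i ln (G / a\<^sub>i)\<close> (with \<open>a\<^sub>0 = a\<close>, \<open>a\<^sub>1 = b\<close>; these shifts cancel), are inserted into the dual
  problem; by Fenchel's inequality its value is \<open>\<lambda> c + G \<Sum>\<^sub>i \<tau>\<^sub>i \<integral>(1 - exp (- \<phi>\<^sub>i / \<tau>\<^sub>i))\<close>, and
  the integral terms tend to \<open>\<Sum>\<^sub>i \<integral>\<phi>\<^sub>i \<ge> W\<^sub>2\<^sup>2\<close>. The Gaussian parameters converge because the
  principal square root is continuous, and \<open>A\<^sub>*\<close> is \<open>o(\<lambda>)\<close> because both divergences vanish in the
  limit while the Wasserstein term stays bounded.\<close>

section \<open>Symmetric positive definite matrices\<close>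

text \<open>The mass \<open>G\<close> is dictated by duality. Subtracting
  \<open>t * ln (g / a)\<close> from a potential multiplies \<open>exp (- \<phi> / t)\<close> by
  \<open>g / a\<close>, hence turns the mass \<open>a\<close> into \<open>g\<close>; the two shifts
  cancel, so that the shifted pair still obeys the cost constraint tightly, exactly when
  \<open>g\<close> is the weighted geometric mean. The potentials grow quadratically, so their
  exponentials compete with Gaussian tails and are controlled only for large \<open>t\<close>: the
  lower bound is an eventual one, whereas the upper bound holds at every \<lambda> > 0 and supplies
  the finiteness on which the remainder rests. One matrix serves both halves of the proof: the limit
  of \<open>L_star\<close> is also the Hessian from which the potentials are built. Since
  \<open>mat_sqrt\<close> is a definite description, existence and uniqueness of the root come
  before any limit; a single Frobenius estimate then gives uniqueness and continuity at
  once.\<close>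

lemma matrix_inv_left:
  fixes A :: "real^'n^'n"
  assumes "invertible A"
  shows "matrix_inv A ** A = mat 1"
  using someI_ex[OF assms[unfolded invertible_def]] unfolding matrix_inv_def by blast

lemma matrix_inv_right:
  fixes A :: "real^'n^'n"
  assumes "invertible A"
  shows "A ** matrix_inv A = mat 1"
  using someI_ex[OF assms[unfolded invertible_def]] unfolding matrix_inv_def by blast

lemma matrix_inv_eqI:
  fixes A B :: "real^'n^'n"
  assumes "A ** B = mat 1"
  shows "matrix_inv A = B"
proof -
  have inv: "invertible A"
    using assms invertible_right_inverse by blast
  have "matrix_inv A = matrix_inv A ** (A ** B)"
    by (simp add: assms)
  also have "\<dots> = B"
    by (simp add: matrix_mul_assoc matrix_inv_left[OF inv])
  finally show ?thesis .
qed

lemma transpose_matrix_inv: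
  fixes A :: "real^'n^'n"
  assumes "invertible A"
  shows "transpose (matrix_inv A) = matrix_inv (transpose A)"
  using matrix_inv_left[OF assms]
  by (metis matrix_inv_eqI matrix_transpose_mul transpose_mat)

section \<open>Transposes, Frobenius inner product and norm bounds\<close>

lemma transpose_add: "transpose (A + B) = transpose A + transpose (B :: real^'n^'m)"
  by (simp add: transpose_def vec_eq_iff)

lemma transpose_diff: "transpose (A - B) = transpose A - transpose (B :: real^'n^'m)"
  by (simp add: transpose_def vec_eq_iff)

lemma matrix_mul_diff_distrib_left: "A ** (B - C) = A ** B - A ** (C :: real^'n^'n)"
  by (simp add: matrix_matrix_mult_def vec_eq_iff sum_subtractf right_diff_distrib)

lemma matrix_mul_diff_distrib_right: "(A - B) ** C = A ** C - B ** (C :: real^'n^'n)"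
  by (simp add: matrix_matrix_mult_def vec_eq_iff sum_subtractf left_diff_distrib)

lemma inner_matrix_vector_right:
  fixes A :: "real^'n^'m"
  shows "x \<bullet> (A *v y) = (transpose A *v x) \<bullet> y"
  by (simp add: dot_lmul_matrix[symmetric])

lemma inner_matrix_vector_sym:
  fixes A :: "real^'n^'n"
  assumes "transpose A = A"
  shows "x \<bullet> (A *v y) = (A *v x) \<bullet> y"
  using inner_matrix_vector_right[of x A y] assms by metis

lemma inner_transpose_transpose:
  fixes A B :: "real^'n^'m"
  shows "transpose A \<bullet> transpose B = A \<bullet> B"
  unfolding inner_vec_def transpose_def by simp (rule sum.swap)

lemma norm_transpose:
  fixes A :: "real^'n^'m"
  shows "norm (transpose A) = norm A"
  by (simp add: norm_eq_sqrt_inner inner_transpose_transpose)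

text \<open>The inner product and norm of this matrix type are the Frobenius ones, assembled from
  rows. Reading a product row by row reduces Frobenius estimates to pointwise estimates for one
  factor.\<close>

lemma matrix_mult_row:
  fixes A B :: "real^'n^'n"
  shows "(A ** B) $ i = transpose B *v (A $ i)"
  by (simp add: matrix_matrix_mult_def matrix_vector_mult_def transpose_def vec_eq_iff mult.commute
      del: transpose_matrix_vector)

lemma norm_matrix_sq: "(norm A)\<^sup>2 = (\<Sum>i\<in>UNIV. (norm (A $ i))\<^sup>2)" for A :: "real^'n^'m"
  by (simp add: power2_norm_eq_inner inner_vec_def)

text \<open>Mixed estimate: an operator bound on one factor against the Frobenius norm of the other.
  It gives the square root iteration the operator constant \<open>q\<close> as contraction factor,
  which the Frobenius norm of the factor could exceed.\<close>

lemma norm_matrix_mult_right_le: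
  fixes A B :: "real^'n^'n"
  assumes "\<And>x. norm (transpose B *v x) \<le> r * norm x" "0 \<le> r"
  shows "norm (A ** B) \<le> r * norm A"
proof -
  have "(norm (transpose B *v x))\<^sup>2 \<le> r\<^sup>2 * (norm x)\<^sup>2" for x
    unfolding power_mult_distrib[symmetric] using assms(1) by (rule power_mono) simp
  then have "(norm (A ** B))\<^sup>2 \<le> (r * norm A)\<^sup>2"
    unfolding norm_matrix_sq power_mult_distrib sum_distrib_left matrix_mult_row
    by (rule sum_mono)
  then show ?thesis
    by (rule power2_le_imp_le) (simp add: assms(2))
qed

lemma norm_matrix_mult_left_le:
  fixes A B :: "real^'n^'n"
  assumes "\<And>x. norm (A *v x) \<le> r * norm x" "0 \<le> r"
  shows "norm (A ** B) \<le> r * norm B"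
  using norm_matrix_mult_right_le[of "transpose A" r "transpose B"] assms
  by (simp add: matrix_transpose_mul[symmetric] norm_transpose del: transpose_matrix_vector)

section \<open>Continuity of the matrix operations\<close>

lemma tendsto_matrix_vector_mult [tendsto_intros]:
  fixes A :: "'a \<Rightarrow> real^'n^'m"
  assumes "(A \<longlongrightarrow> A') F" "(x \<longlongrightarrow> x') F"
  shows "((\<lambda>t. A t *v x t) \<longlongrightarrow> A' *v x') F"
  unfolding matrix_vector_mult_def
  by (intro tendsto_vec_lambda tendsto_sum tendsto_mult tendsto_vec_nth assms)

lemma tendsto_matrix_matrix_mult [tendsto_intros]:
  fixes A :: "'a \<Rightarrow> real^'n^'m" and B :: "'a \<Rightarrow> real^'k^'n"
  assumes "(A \<longlongrightarrow> A') F" "(B \<longlongrightarrow> B') F"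
  shows "((\<lambda>t. A t ** B t) \<longlongrightarrow> A' ** B') F"
  unfolding matrix_matrix_mult_def
  by (intro tendsto_vec_lambda tendsto_sum tendsto_mult tendsto_vec_nth assms)

lemma tendsto_transpose [tendsto_intros]:
  fixes A :: "'a \<Rightarrow> real^'n^'m"
  assumes "(A \<longlongrightarrow> A') F"
  shows "((\<lambda>t. transpose (A t)) \<longlongrightarrow> transpose A') F"
  unfolding transpose_def
  by (intro tendsto_vec_lambda tendsto_vec_nth assms)

lemma tendsto_det [tendsto_intros]:
  fixes A :: "'a \<Rightarrow> real^'n^'n"
  assumes "(A \<longlongrightarrow> A') F"
  shows "((\<lambda>t. det (A t)) \<longlongrightarrow> det A') F"
  unfolding det_def
  by (intro tendsto_sum tendsto_mult tendsto_prod tendsto_const tendsto_vec_nth assms)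

lemma matrix_inv_cramer:
  fixes A :: "real^'n^'n"
  assumes "det A \<noteq> 0"
  shows "matrix_inv A *v b = (\<chi> k. det (\<chi> i j. if j = k then b $ i else A $ i $ j) / det A)"
proof -
  have "A *v (matrix_inv A *v b) = b"
    using matrix_inv_right[of A] assms
    by (simp add: matrix_vector_mul_assoc invertible_det_nz)
  then show ?thesis
    using cramer[OF assms, of "matrix_inv A *v b" b] by simp
qed

text \<open>By Cramer's rule each entry of the inverse is a quotient of determinants, and
  determinants are polynomials in the entries.\<close>

lemma tendsto_matrix_inv [tendsto_intros]:
  fixes A :: "'a \<Rightarrow> real^'n^'n"
  assumes A: "(A \<longlongrightarrow> A') F" and inv: "invertible A'"
  shows "((\<lambda>t. matrix_inv (A t)) \<longlongrightarrow> matrix_inv A') F"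
proof -
  have d: "det A' \<noteq> 0"
    using inv by (simp add: invertible_det_nz)
  have *: "matrix_inv B = (\<chi> k l. det (\<chi> i j. if j = k then axis l 1 $ i else B $ i $ j) / det B)"
    if "det B \<noteq> 0" for B :: "real^'n^'n"
  proof -
    have "matrix_inv B $ k $ l = (matrix_inv B *v axis l 1) $ k" for k l
      by (simp add: matrix_vector_mult_basis column_def)
    then show ?thesis
      by (simp add: vec_eq_iff matrix_inv_cramer[OF that])
  qed
  have "\<forall>\<^sub>F t in F. det (A t) \<noteq> 0"
    using tendsto_det[OF A] d by (rule tendsto_imp_eventually_ne)
  then have "\<forall>\<^sub>F t in F. (\<chi> k l. det (\<chi> i j. if j = k then axis l 1 $ i else A t $ i $ j) / det (A t))
      = matrix_inv (A t)"
    by eventually_elim (simp add: *)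
  moreover have "((\<lambda>t. if j = k then axis l 1 $ i else A t $ i $ j)
      \<longlongrightarrow> (if j = k then axis l 1 $ i else A' $ i $ j)) F" for i j k l
    by (auto intro!: tendsto_intros A)
  then have "((\<lambda>t. \<chi> k l. det (\<chi> i j. if j = k then axis l 1 $ i else A t $ i $ j) / det (A t))
      \<longlongrightarrow> (\<chi> k l. det (\<chi> i j. if j = k then axis l 1 $ i else A' $ i $ j) / det A')) F"
    by (intro tendsto_vec_lambda tendsto_divide tendsto_det A d)
  ultimately show ?thesis
    unfolding *[OF d] by (rule Lim_transform_eventually[rotated])
qed

section \<open>Coercivity, congruence and stability of positive definiteness\<close>

lemma sym_pos_def_sym: "sym_pos_def A \<Longrightarrow> transpose A = A"
  by (simp add: sym_pos_def_def)

text \<open>The constant is the minimum of the quadratic form on the unit sphere, attained by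
  compactness; homogeneity does the rest.\<close>

lemma sym_pos_def_coercive:
  fixes A :: "real^'n^'n"
  assumes "sym_pos_def A"
  obtains c where "0 < c" "\<And>x. c * (norm x)\<^sup>2 \<le> x \<bullet> (A *v x)"
proof -
  let ?S = "sphere 0 1 :: (real^'n) set"
  have "continuous_on ?S (\<lambda>x. x \<bullet> (A *v x))"
    by (intro continuous_intros matrix_vector_mult_linear_continuous_on)
  moreover have "compact ?S" "?S \<noteq> {}"
    by auto
  ultimately obtain x0 where x0: "x0 \<in> ?S" "\<And>x. x \<in> ?S \<Longrightarrow> x0 \<bullet> (A *v x0) \<le> x \<bullet> (A *v x)"
    using continuous_attains_inf by metis
  show ?thesis
  proof
    show "0 < x0 \<bullet> (A *v x0)"
      using assms x0(1) unfolding sym_pos_def_def by (metis dist_0_norm mem_sphere norm_zero zero_neq_one)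
    fix x :: "real^'n"
    show "x0 \<bullet> (A *v x0) * (norm x)\<^sup>2 \<le> x \<bullet> (A *v x)"
    proof (cases "x = 0")
      case False
      have "x0 \<bullet> (A *v x0) \<le> (x /\<^sub>R norm x) \<bullet> (A *v (x /\<^sub>R norm x))"
        using False by (intro x0(2)) auto
      also have "\<dots> = x \<bullet> (A *v x) / (norm x)\<^sup>2"
        by (simp add: matrix_vector_mult_scaleR power2_eq_square divide_inverse)
      finally show ?thesis
        using False by (simp add: field_simps)
    qed auto
  qed
qed

lemma coercive_invertible:
  fixes A :: "real^'n^'n"
  assumes "\<And>x. x \<noteq> 0 \<Longrightarrow> 0 < x \<bullet> (A *v x)"
  shows "invertible A"
proof -
  have "x = 0" if "A *v x = 0" for x
    using assms[of x] that by fastforce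
  then show ?thesis
    by (metis matrix_left_invertible_ker invertible_left_inverse)
qed

lemma sym_pos_def_invertible: "sym_pos_def A \<Longrightarrow> invertible A"
  by (simp add: coercive_invertible sym_pos_def_def)

lemma sym_pos_def_matrix_inv:
  assumes "sym_pos_def A"
  shows "sym_pos_def (matrix_inv A)"
  unfolding sym_pos_def_def
proof (intro conjI allI impI)
  note inv = sym_pos_def_invertible[OF assms]
  show "transpose (matrix_inv A) = matrix_inv A"
    using transpose_matrix_inv[OF inv] sym_pos_def_sym[OF assms] by simp
  fix x :: "real^'a" assume "x \<noteq> 0"
  define y where "y = matrix_inv A *v x"
  have x: "x = A *v y"
    by (simp add: y_def matrix_vector_mul_assoc matrix_inv_right[OF inv])
  with \<open>x \<noteq> 0\<close> have "y \<noteq> 0" by auto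
  then have "0 < y \<bullet> (A *v y)"
    using assms by (simp add: sym_pos_def_def)
  then show "0 < x \<bullet> (matrix_inv A *v x)"
    using x by (metis inner_commute y_def)
qed

lemma sym_pos_def_mat_1: "sym_pos_def (mat 1)"
  by (simp add: sym_pos_def_def)

lemma sym_pos_def_scaleR: "0 < r \<Longrightarrow> sym_pos_def A \<Longrightarrow> sym_pos_def (r *\<^sub>R A)"
  by (simp add: sym_pos_def_def transpose_scalar scaleR_matrix_vector_assoc[symmetric])

lemma sym_pos_def_add: "sym_pos_def A \<Longrightarrow> sym_pos_def B \<Longrightarrow> sym_pos_def (A + B)"
  by (simp add: sym_pos_def_def transpose_add matrix_vector_mult_add_rdistrib inner_add_right add_pos_pos)

lemma sym_pos_def_add_nonneg:
  assumes "sym_pos_def A" "0 \<le> r"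
  shows "sym_pos_def (r *\<^sub>R mat 1 + A)"
proof (cases "r = 0")
  case False
  then show ?thesis
    using assms by (intro sym_pos_def_add sym_pos_def_scaleR sym_pos_def_mat_1) simp_all
qed (use assms in simp)

lemma sym_pos_def_congruence:
  fixes A B :: "real^'n^'n"
  assumes "sym_pos_def A" "invertible B"
  shows "sym_pos_def (B ** A ** transpose B)"
  unfolding sym_pos_def_def
proof (intro conjI allI impI)
  show "transpose (B ** A ** transpose B) = B ** A ** transpose B"
    by (simp add: matrix_transpose_mul sym_pos_def_sym[OF assms(1)] matrix_mul_assoc)
  fix x :: "real^'n" assume "x \<noteq> 0"
  have "invertible (transpose B)"
    using transpose_invertible[OF assms(2)] .
  then have "transpose B *v x \<noteq> 0"
    using \<open>x \<noteq> 0\<close> inj_matrix_vector_mult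
    by (metis injD matrix_vector_mult_0_right)
  then have "0 < (transpose B *v x) \<bullet> (A *v (transpose B *v x))"
    using assms(1) by (simp add: sym_pos_def_def)
  then show "0 < x \<bullet> (B ** A ** transpose B *v x)"
    by (simp add: matrix_vector_mul_assoc[symmetric] inner_matrix_vector_right[of x B])
qed

lemma sym_pos_def_congruence_sym:
  assumes "sym_pos_def A" "sym_pos_def B"
  shows "sym_pos_def (B ** A ** B)"
  using sym_pos_def_congruence[OF assms(1) sym_pos_def_invertible[OF assms(2)]]
  by (simp add: sym_pos_def_sym[OF assms(2)])

lemma norm_matrix_vector_le:
  fixes A :: "real^'n^'n"
  shows "norm (A *v x) \<le> norm A * norm x"
proof -
  have "(norm (A *v x))\<^sup>2 = (\<Sum>i\<in>UNIV. (A $ i \<bullet> x)\<^sup>2)"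
    unfolding power2_norm_eq_inner inner_vec_def[of "A *v x"]
    by (simp add: matrix_vector_mul_component power2_eq_square)
  also have "\<dots> \<le> (\<Sum>i\<in>UNIV. (norm (A $ i))\<^sup>2 * (norm x)\<^sup>2)"
    by (intro sum_mono) (metis Cauchy_Schwarz_ineq power2_norm_eq_inner)
  also have "\<dots> = (norm A * norm x)\<^sup>2"
    by (simp add: norm_matrix_sq power_mult_distrib sum_distrib_right)
  finally show ?thesis
    by (rule power2_le_imp_le) simp
qed

lemma norm_add_sq_le: "(norm (x + y))\<^sup>2 \<le> 2 * (norm x)\<^sup>2 + 2 * (norm (y :: 'a::real_inner))\<^sup>2"
proof -
  have "(norm (x + y))\<^sup>2 + (norm (x - y))\<^sup>2 = 2 * (norm x)\<^sup>2 + 2 * (norm y)\<^sup>2"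
    by (simp add: power2_norm_eq_inner inner_simps inner_commute)
  then show ?thesis
    using zero_le_power2[of "norm (x - y)"] by linarith
qed

lemma abs_quadratic_form_le:
  fixes A :: "real^'n^'n"
  shows "\<bar>x \<bullet> (A *v x)\<bar> \<le> norm A * (norm x)\<^sup>2"
proof -
  have "norm x * norm (A *v x) \<le> norm x * (norm A * norm x)"
    by (intro mult_left_mono norm_matrix_vector_le) simp
  then show ?thesis
    using Cauchy_Schwarz_ineq2[of x "A *v x"] by (simp add: power2_eq_square mult_ac)
qed

text \<open>Positivity is an open condition: a perturbation smaller than the coercivity constant of
  \<open>A'\<close> cannot destroy it. Symmetry is not open, so it enters as a separate
  assumption.\<close>

lemma eventually_sym_pos_def:
  fixes A :: "'a \<Rightarrow> real^'n^'n"
  assumes A: "(A \<longlongrightarrow> A') F" and sym: "\<forall>\<^sub>F t in F. transpose (A t) = A t" and A': "sym_pos_def A'"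
  shows "\<forall>\<^sub>F t in F. sym_pos_def (A t)"
proof -
  obtain c where c: "0 < c" "\<And>x. c * (norm x)\<^sup>2 \<le> x \<bullet> (A' *v x)"
    using sym_pos_def_coercive[OF A'] by blast
  have "\<forall>\<^sub>F t in F. dist (A t) A' < c"
    using A c(1) by (rule tendstoD)
  with sym show ?thesis
  proof eventually_elim
    case (elim t)
    have "0 < x \<bullet> (A t *v x)" if "x \<noteq> 0" for x
    proof -
      have "\<bar>x \<bullet> ((A t - A') *v x)\<bar> \<le> norm (A t - A') * (norm x)\<^sup>2"
        by (rule abs_quadratic_form_le)
      also have "\<dots> < c * (norm x)\<^sup>2"
        using that elim by (intro mult_strict_right_mono) (auto simp: dist_norm)
      finally have "\<bar>x \<bullet> (A t *v x) - x \<bullet> (A' *v x)\<bar> < c * (norm x)\<^sup>2"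
        by (simp add: matrix_vector_mult_diff_rdistrib inner_diff_right)
      then show ?thesis
        using c(2)[of x] by linarith
    qed
    then show ?case
      using elim by (simp add: sym_pos_def_def)
  qed
qed

section \<open>Uniqueness, existence and continuity of the principal square root\<close>

lemma inner_matrix_mult_right_ge:
  fixes D C :: "real^'n^'n"
  assumes "transpose C = C" "\<And>x. c * (norm x)\<^sup>2 \<le> x \<bullet> (C *v x)"
  shows "c * (norm D)\<^sup>2 \<le> D \<bullet> (D ** C)"
  unfolding norm_matrix_sq sum_distrib_left inner_vec_def[of D] matrix_mult_row assms(1)
  by (intro sum_mono assms(2))

lemma inner_matrix_mult_left_ge:
  fixes D C :: "real^'n^'n"
  assumes "transpose C = C" "\<And>x. c * (norm x)\<^sup>2 \<le> x \<bullet> (C *v x)"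
  shows "c * (norm D)\<^sup>2 \<le> D \<bullet> (C ** D)"
  using inner_matrix_mult_right_ge[OF assms, of "transpose D"]
  by (metis assms(1) inner_transpose_transpose matrix_transpose_mul norm_transpose)

text \<open>With \<open>D = B - C\<close> one has \<open>B ** B - C ** C = B ** D + D ** C\<close>.
  Tested against \<open>D\<close>, the first term is nonnegative and the second is coercive with
  constant \<open>c\<close>; Cauchy-Schwarz finishes. Only \<open>C\<close> needs a quantitative
  bound, so the estimate applies with \<open>C\<close> a fixed limit.\<close>

lemma norm_diff_le_norm_squares_diff:
  fixes B C :: "real^'n^'n"
  assumes B: "sym_pos_def B" and C: "transpose C = C" "\<And>x. c * (norm x)\<^sup>2 \<le> x \<bullet> (C *v x)"
  shows "c * norm (B - C) \<le> norm (B ** B - C ** C)"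
proof -
  let ?D = "B - C" and ?E = "B ** B - C ** C"
  have E: "?E = B ** ?D + ?D ** C"
    by (simp add: matrix_mul_diff_distrib_left matrix_mul_diff_distrib_right)
  have "0 \<le> ?D \<bullet> (B ** ?D)"
    using inner_matrix_mult_left_ge[of B 0 ?D] B unfolding sym_pos_def_def
    by (metis inner_zero_left less_eq_real_def mult_zero_left)
  moreover have "c * (norm ?D)\<^sup>2 \<le> ?D \<bullet> (?D ** C)"
    by (rule inner_matrix_mult_right_ge[OF C])
  ultimately have "c * (norm ?D)\<^sup>2 \<le> ?D \<bullet> ?E"
    unfolding E inner_add_right by linarith
  also have "\<dots> \<le> norm ?D * norm ?E"
    by (rule norm_cauchy_schwarz)
  finally have *: "norm ?D * (c * norm ?D) \<le> norm ?D * norm ?E"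
    by (simp add: power2_eq_square mult_ac)
  show ?thesis
  proof (cases "norm ?D = 0")
    case False
    with * show ?thesis
      by (metis mult_le_cancel_left_pos norm_ge_zero order_le_less)
  qed simp
qed

lemma sym_pos_def_sqrt_unique:
  assumes "sym_pos_def B" "sym_pos_def C" "B ** B = C ** C"
  shows "B = C"
proof -
  obtain c where c: "0 < c" "\<And>x. c * (norm x)\<^sup>2 \<le> x \<bullet> (C *v x)"
    using sym_pos_def_coercive[OF assms(2)] by blast
  have "c * norm (B - C) \<le> 0"
    using norm_diff_le_norm_squares_diff[OF assms(1) sym_pos_def_sym[OF assms(2)] c(2)] assms(3)
    by simp
  then show ?thesis
    using c(1) by (simp add: mult_le_0_iff)
qed

text \<open>For a symmetric matrix the numerical radius bounds the operator norm. Polarisation is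
  applied to \<open>x\<close> and the multiple \<open>y\<close> of \<open>X *v x\<close> rescaled to
  the length of \<open>x\<close>, so that the parallelogram law returns exactly
  \<open>4 * q * (norm x)\<^sup>2\<close>.\<close>

lemma norm_sym_matrix_vector_le:
  fixes X :: "real^'n^'n"
  assumes X: "transpose X = X" "\<And>x. \<bar>x \<bullet> (X *v x)\<bar> \<le> q * (norm x)\<^sup>2"
  shows "norm (X *v x) \<le> q * norm x"
proof (cases "X *v x = 0")
  case True
  have "0 \<le> q * (norm x)\<^sup>2"
    using X(2)[of x] by linarith
  then have "0 \<le> q * norm x"
    by (auto simp: zero_le_mult_iff)
  then show ?thesis using True by simp
next
  case False
  then have x0: "x \<noteq> 0" by auto
  define y where "y = (norm x / norm (X *v x)) *\<^sub>R (X *v x)"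
  have ny: "norm y = norm x"
    using False by (simp add: y_def)
  have yX: "y \<bullet> (X *v x) = norm x * norm (X *v x)"
    by (simp add: y_def power2_norm_eq_inner[symmetric] power2_eq_square)
  have xy: "x \<bullet> (X *v y) = y \<bullet> (X *v x)"
    by (simp add: inner_matrix_vector_sym[OF X(1), of x] inner_commute)
  have "4 * (y \<bullet> (X *v x)) = (x + y) \<bullet> (X *v (x + y)) - (x - y) \<bullet> (X *v (x - y))"
    using xy by (simp add: matrix_vector_right_distrib matrix_vector_mult_diff_distrib inner_simps)
  also have "\<dots> \<le> q * (norm (x + y))\<^sup>2 + q * (norm (x - y))\<^sup>2"
    using X(2)[of "x + y"] X(2)[of "x - y"] by linarith
  also have "\<dots> = q * (2 * (norm x)\<^sup>2 + 2 * (norm y)\<^sup>2)"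
    by (simp add: power2_norm_eq_inner inner_simps inner_commute algebra_simps)
  also have "\<dots> = 4 * (norm x * (q * norm x))"
    by (simp add: ny power2_eq_square)
  finally have "norm x * norm (X *v x) \<le> norm x * (q * norm x)"
    by (simp add: yX)
  then show ?thesis
    using x0 by simp
qed

text \<open>The square root of \<open>I - X\<close> with \<open>0 \<le> X \<le> q I\<close>, \<open>q < 1\<close>, is \<open>I - Y\<close> where \<open>Y\<close> is the fixed
  point of the contraction \<open>Y \<mapsto> (X + Y\<^sup>2) / 2\<close>.\<close>

lemma sqrt_fixed_point_exists:
  fixes X :: "real^'n^'n"
  assumes X: "transpose X = X" "\<And>x. norm (X *v x) \<le> q * norm x" and q: "0 \<le> q" "q < 1"
  obtains Y where "transpose Y = Y" "\<And>x. norm (Y *v x) \<le> q * norm x" "2 *\<^sub>R Y = X + Y ** Y"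
proof -
  define K where "K = {Y :: real^'n^'n. transpose Y = Y \<and> (\<forall>x. norm (Y *v x) \<le> q * norm x)}"
  define f where "f = (\<lambda>Y. (1/2) *\<^sub>R (X + Y ** Y))"
  have "closed K"
  proof (rule closed_sequential_limits[THEN iffD2], clarify)
    fix Y :: "nat \<Rightarrow> real^'n^'n" and l
    assume Y: "\<forall>n. Y n \<in> K" "Y \<longlonglongrightarrow> l"
    have "(\<lambda>n. transpose (Y n)) \<longlonglongrightarrow> transpose l"
      by (intro tendsto_intros Y)
    moreover have "(\<lambda>n. transpose (Y n)) = Y"
      using Y(1) by (auto simp: K_def)
    ultimately have "transpose l = l"
      using Y(2) LIMSEQ_unique by metis
    moreover have "norm (l *v x) \<le> q * norm x" for x
    proof (rule LIMSEQ_le_const2)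
      show "(\<lambda>n. norm (Y n *v x)) \<longlonglongrightarrow> norm (l *v x)"
        by (intro tendsto_intros Y)
      show "\<exists>N. \<forall>n\<ge>N. norm (Y n *v x) \<le> q * norm x"
        using Y(1) by (auto simp: K_def)
    qed
    ultimately show "l \<in> K"
      by (simp add: K_def)
  qed
  then have "Topological_Spaces.complete K"
    by (simp add: complete_eq_closed)
  moreover have "X \<in> K"
    using X by (simp add: K_def)
  then have "K \<noteq> {}" by blast
  moreover have "f ` K \<subseteq> K"
  proof clarify
    fix Y assume Y: "Y \<in> K"
    have "norm (f Y *v x) \<le> q * norm x" for x
    proof -
      have "norm (Y *v (Y *v x)) \<le> q * norm (Y *v x)"
        using Y by (simp add: K_def)
      also have "\<dots> \<le> 1 * norm (Y *v x)"
        using q by (intro mult_right_mono) auto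
      also have "\<dots> \<le> q * norm x"
        using Y by (simp add: K_def)
      finally have "norm (X *v x + Y *v (Y *v x)) \<le> q * norm x + q * norm x"
        using X(2)[of x] by (intro norm_triangle_mono)
      then show ?thesis
        by (simp add: f_def scaleR_matrix_vector_assoc[symmetric] matrix_vector_mult_add_rdistrib
            matrix_vector_mul_assoc)
    qed
    moreover have "transpose (f Y) = f Y"
      using Y X(1) by (simp add: f_def K_def transpose_scalar transpose_add matrix_transpose_mul)
    ultimately show "f Y \<in> K"
      by (simp add: K_def)
  qed
  moreover have "dist (f Y) (f Z) \<le> q * dist Y Z" if "Y \<in> K" "Z \<in> K" for Y Z
  proof -
    \<comment> \<open>Splitting \<open>Y ** Y - Z ** Z\<close> this way, although the factors do not
      commute, gives two terms of size at most \<open>q * norm (Y - Z)\<close>; the factor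
      \<open>1/2\<close> in \<open>f\<close> makes the Lipschitz constant \<open>q\<close>.\<close>
    have "f Y - f Z = (1/2) *\<^sub>R (Y ** (Y - Z) + (Y - Z) ** Z)"
      by (simp add: f_def matrix_mul_diff_distrib_left matrix_mul_diff_distrib_right scaleR_right_diff_distrib algebra_simps)
    moreover have "norm (Y ** (Y - Z)) \<le> q * norm (Y - Z)"
      using that q by (intro norm_matrix_mult_left_le) (auto simp: K_def)
    moreover have "norm ((Y - Z) ** Z) \<le> q * norm (Y - Z)"
      using that q by (intro norm_matrix_mult_right_le) (auto simp: K_def simp del: transpose_matrix_vector)
    ultimately show ?thesis
      using norm_triangle_ineq[of "Y ** (Y - Z)" "(Y - Z) ** Z"]
      by (simp add: dist_norm)
  qed
  ultimately have "\<exists>!Y\<in>K. f Y = Y"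
    using q by (intro Banach_fix)
  then obtain Y where Y: "Y \<in> K" "f Y = Y" by blast
  have "2 *\<^sub>R f Y = X + Y ** Y"
    by (simp add: f_def)
  with Y show ?thesis
    using that[of Y] by (simp add: K_def)
qed

lemma sym_pos_def_sqrt_exists:
  fixes A :: "real^'n^'n"
  assumes A: "sym_pos_def A"
  shows "\<exists>B. sym_pos_def B \<and> B ** B = A"
proof -
  obtain c where c: "0 < c" "\<And>x. c * (norm x)\<^sup>2 \<le> x \<bullet> (A *v x)"
    using sym_pos_def_coercive[OF A] by blast
  \<comment> \<open>After division by \<open>k\<close> the form of \<open>A\<close> lies between
    \<open>c / k\<close> and \<open>1\<close>, so that of \<open>X\<close> lies between
    \<open>0\<close> and \<open>q < 1\<close>. The summand \<open>c\<close> makes \<open>k\<close>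
    positive and \<open>q\<close> nonnegative without a comparison of \<open>c\<close> with
    \<open>norm A\<close>.\<close>
  define k where "k = norm A + c"
  have k: "0 < k" "c \<le> k"
    using c(1) by (simp_all add: k_def add_nonneg_pos)
  define X where "X = mat 1 - (1/k) *\<^sub>R A"
  define q where "q = 1 - c / k"
  have q: "0 \<le> q" "q < 1"
    using k c(1) by (simp_all add: q_def field_simps)
  have X: "transpose X = X"
    by (simp add: X_def transpose_diff transpose_scalar sym_pos_def_sym[OF A])
  have "\<bar>x \<bullet> (X *v x)\<bar> \<le> q * (norm x)\<^sup>2" for x
  proof -
    have "x \<bullet> (A *v x) \<le> norm A * (norm x)\<^sup>2"
      using abs_quadratic_form_le[of x A] by linarith
    also have "\<dots> \<le> k * (norm x)\<^sup>2"
      using c(1) by (intro mult_right_mono) (auto simp: k_def)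
    finally have "x \<bullet> (A *v x) \<le> k * (norm x)\<^sup>2" .
    then show ?thesis
      using c(2)[of x] k
      by (simp add: X_def q_def matrix_vector_mult_diff_rdistrib inner_diff_right
          scaleR_matrix_vector_assoc[symmetric] power2_norm_eq_inner[symmetric] field_simps abs_le_iff)
  qed
  then have "norm (X *v x) \<le> q * norm x" for x
    by (rule norm_sym_matrix_vector_le[OF X])
  then obtain Y where Y: "transpose Y = Y" "\<And>x. norm (Y *v x) \<le> q * norm x" "2 *\<^sub>R Y = X + Y ** Y"
    using sqrt_fixed_point_exists[OF X _ q] by metis
  define B where "B = sqrt k *\<^sub>R (mat 1 - Y)"
  have "(mat 1 - Y) ** (mat 1 - Y) = mat 1 - 2 *\<^sub>R Y + Y ** Y"
    by (simp add: matrix_mul_diff_distrib_left matrix_mul_diff_distrib_right scaleR_2)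
  also have "\<dots> = (1/k) *\<^sub>R A"
    by (simp add: Y(3) X_def)
  finally have "B ** B = A"
    using k by (simp add: B_def matrix_scalar_ac scalar_matrix_assoc[symmetric])
  moreover have "sym_pos_def (mat 1 - Y)"
    unfolding sym_pos_def_def
  proof (intro conjI allI impI)
    fix x :: "real^'n" assume "x \<noteq> 0"
    have "x \<bullet> (Y *v x) \<le> norm x * norm (Y *v x)"
      by (rule norm_cauchy_schwarz)
    also have "\<dots> \<le> norm x * (q * norm x)"
      by (intro mult_left_mono Y) auto
    also have "\<dots> < (norm x)\<^sup>2"
      using q \<open>x \<noteq> 0\<close> by (simp add: power2_eq_square)
    finally show "0 < x \<bullet> ((mat 1 - Y) *v x)"
      by (simp add: matrix_vector_mult_diff_rdistrib inner_diff_right power2_norm_eq_inner)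
  qed (simp add: transpose_diff Y)
  then have "sym_pos_def B"
    using k by (simp add: B_def sym_pos_def_scaleR)
  ultimately show ?thesis by blast
qed

lemma
  assumes "sym_pos_def A"
  shows sym_pos_def_mat_sqrt: "sym_pos_def (mat_sqrt A)"
    and mat_sqrt_square: "mat_sqrt A ** mat_sqrt A = A"
proof -
  have "\<exists>!B. sym_pos_def B \<and> B ** B = A"
    using sym_pos_def_sqrt_exists[OF assms] sym_pos_def_sqrt_unique by metis
  from theI'[OF this] show "sym_pos_def (mat_sqrt A)" "mat_sqrt A ** mat_sqrt A = A"
    unfolding mat_sqrt_def by blast+
qed

lemma mat_sqrt_eqI: "sym_pos_def B \<Longrightarrow> B ** B = A \<Longrightarrow> mat_sqrt A = B"
  unfolding mat_sqrt_def by (rule the_equality) (auto intro: sym_pos_def_sqrt_unique)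

text \<open>The root is Lipschitz at \<open>A'\<close>, with a constant that depends only on the
  coercivity of \<open>mat_sqrt A'\<close>; no lower bound uniform along the filter enters.\<close>

lemma tendsto_mat_sqrt:
  fixes A :: "'a \<Rightarrow> real^'n^'n"
  assumes A: "(A \<longlongrightarrow> A') F" and pos: "\<forall>\<^sub>F t in F. sym_pos_def (A t)" and A': "sym_pos_def A'"
  shows "((\<lambda>t. mat_sqrt (A t)) \<longlongrightarrow> mat_sqrt A') F"
proof -
  obtain c where c: "0 < c" "\<And>x. c * (norm x)\<^sup>2 \<le> x \<bullet> (mat_sqrt A' *v x)"
    using sym_pos_def_coercive[OF sym_pos_def_mat_sqrt[OF A']] by blast
  have "((\<lambda>t. norm (A t - A') / c) \<longlongrightarrow> norm (A' - A') / c) F"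
    using c(1) by (intro tendsto_intros A) auto
  then have lim: "((\<lambda>t. norm (A t - A') / c) \<longlongrightarrow> 0) F"
    by simp
  have "\<forall>\<^sub>F t in F. norm (mat_sqrt (A t) - mat_sqrt A') \<le> norm (A t - A') / c"
    using pos
  proof eventually_elim
    case (elim t)
    have "c * norm (mat_sqrt (A t) - mat_sqrt A')
        \<le> norm (mat_sqrt (A t) ** mat_sqrt (A t) - mat_sqrt A' ** mat_sqrt A')"
      by (rule norm_diff_le_norm_squares_diff)
        (use sym_pos_def_mat_sqrt[OF elim] sym_pos_def_mat_sqrt[OF A'] c(2) in \<open>simp_all add: sym_pos_def_sym\<close>)
    then show ?case
      using c(1) by (simp add: mat_sqrt_square[OF elim] mat_sqrt_square[OF A'] field_simps)
  qed
  then have "((\<lambda>t. mat_sqrt (A t) - mat_sqrt A') \<longlongrightarrow> 0) F"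
    using lim by (rule Lim_null_comparison)
  then show ?thesis
    by (rule Lim_null[THEN iffD2])
qed

lemma sym_pos_def_det_pos:
  assumes "sym_pos_def A"
  shows "0 < det A"
proof -
  let ?B = "mat_sqrt A"
  have "det A = det ?B * det ?B"
    using mat_sqrt_square[OF assms] det_mul by metis
  moreover have "det ?B \<noteq> 0"
    using sym_pos_def_invertible[OF sym_pos_def_mat_sqrt[OF assms]] by (simp add: invertible_det_nz)
  ultimately show ?thesis
    by (metis not_real_square_gt_zero)
qed

section \<open>Linear change of variables for Lebesgue measure\<close>

lemma borel_measurable_matrix_vector_mult [measurable]:
  fixes A :: "real^'n^'m"
  shows "(\<lambda>x. A *v x) \<in> borel_measurable borel"
  by (intro borel_measurable_continuous_onI matrix_vector_mult_linear_continuous_on)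

lemma prod_Basis_vec: "(\<Prod>b\<in>Basis. f b) = (\<Prod>i\<in>UNIV. f (axis i 1 :: real^'n))"
proof -
  have "Basis = range (\<lambda>i. axis i 1 :: real^'n)"
    by (auto simp: Basis_vec_def)
  moreover have "inj (\<lambda>i. axis i 1 :: real^'n)"
    by (simp add: inj_on_def axis_eq_axis)
  then have "prod f (range (\<lambda>i. axis i 1 :: real^'n)) = prod (f \<circ> (\<lambda>i. axis i 1)) UNIV"
    by (rule prod.reindex)
  ultimately show ?thesis
    by (simp add: comp_def)
qed

text \<open>The function \<open>c\<close> collects the diagonal entries, which identifies the matrix
  with a coordinatewise scaling of Lebesgue measure.\<close>

lemma nn_integral_lborel_diagonal:
  fixes A :: "real^'n^'n" and f :: "real^'n \<Rightarrow> ennreal"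
  assumes diag: "\<And>i j. i \<noteq> j \<Longrightarrow> A $ i $ j = 0" and det: "det A \<noteq> 0"
    and f [measurable]: "f \<in> borel_measurable borel"
  shows "ennreal \<bar>det A\<bar> * (\<integral>\<^sup>+x. f (A *v x) \<partial>lborel) = (\<integral>\<^sup>+x. f x \<partial>lborel)"
proof -
  define c where "c = (\<lambda>b::real^'n. (A *v b) \<bullet> b)"
  have c: "c (axis i 1) = A $ i $ i" for i
    by (simp add: c_def inner_axis matrix_vector_mult_basis column_def)
  have dA: "det A = (\<Prod>i\<in>UNIV. A $ i $ i)"
    by (rule det_diagonal[OF diag])
  have c0: "c j \<noteq> 0" if "j \<in> Basis" for j
    using that det dA c by (auto simp: Basis_vec_def)
  have T: "0 + (\<Sum>j\<in>Basis. (c j * (x \<bullet> j)) *\<^sub>R j) = A *v x" for x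
  proof (rule euclidean_eqI)
    fix b :: "real^'n" assume b: "b \<in> Basis"
    then obtain i where i: "b = axis i 1" by (auto simp: Basis_vec_def)
    have "(A *v x) \<bullet> b = (\<Sum>j\<in>UNIV. A $ i $ j * x $ j)"
      by (simp add: i inner_axis matrix_vector_mult_def)
    also have "\<dots> = (\<Sum>j\<in>UNIV. if j = i then A $ i $ i * x $ i else 0)"
      by (intro sum.cong) (auto simp: diag)
    also have "\<dots> = c b * (x \<bullet> b)"
      by (simp add: i c inner_axis)
    finally show "(0 + (\<Sum>j\<in>Basis. (c j * (x \<bullet> j)) *\<^sub>R j)) \<bullet> b = (A *v x) \<bullet> b"
      using b by simp
  qed
  have "(\<Prod>j\<in>Basis. ennreal \<bar>c j\<bar>) = ennreal \<bar>det A\<bar>"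
    by (simp add: prod_Basis_vec c prod_ennreal dA abs_prod)
  then have "(lborel :: (real^'n) measure) = density (distr lborel borel (\<lambda>x. A *v x)) (\<lambda>_. ennreal \<bar>det A\<bar>)"
    using lborel_affine_euclidean[of c 0, OF c0] unfolding T by (simp add: prod_ennreal)
  then have "(\<integral>\<^sup>+x. f x \<partial>lborel) = (\<integral>\<^sup>+x. f x \<partial>density (distr lborel borel (\<lambda>x. A *v x)) (\<lambda>_. ennreal \<bar>det A\<bar>))"
    by simp
  also have "\<dots> = ennreal \<bar>det A\<bar> * (\<integral>\<^sup>+x. f (A *v x) \<partial>lborel)"
    by (simp add: nn_integral_density nn_integral_distr nn_integral_cmult)
  finally show ?thesis by simp
qed

text \<open>Lebesgue measure is determined by its values on boxes, and a permutation of coordinates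
  only reorders the side lengths. Involutions are enough for transpositions and let the preimage of
  a box be written with the same map.\<close>

lemma nn_integral_lborel_permute:
  fixes f :: "real^'n \<Rightarrow> ennreal" and p :: "'n \<Rightarrow> 'n"
  assumes p: "\<And>i. p (p i) = i" and f [measurable]: "f \<in> borel_measurable borel"
  shows "(\<integral>\<^sup>+x. f (\<chi> i. x $ p i) \<partial>lborel) = (\<integral>\<^sup>+x. f x \<partial>lborel)"
proof -
  define T where "T = (\<lambda>x::real^'n. \<chi> i. x $ p i)"
  have [measurable]: "T \<in> borel_measurable borel"
    unfolding T_def by (intro borel_measurable_continuous_onI continuous_intros)
  have "lborel = distr lborel borel T"
  proof (rule lborel_eqI)
    fix l u :: "real^'n"
    assume lu: "\<And>b. b \<in> Basis \<Longrightarrow> l \<bullet> b \<le> u \<bullet> b"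
    then have lu': "l $ i \<le> u $ i" for i
      using lu[of "axis i 1"] by (simp add: inner_axis)
    have vimage: "T -` box l u = box (T l) (T u)"
      by (auto simp: T_def mem_box_cart) (metis p)+
    have bij: "bij p"
      using p by (intro o_bij[of p]) auto
    have "emeasure (distr lborel borel T) (box l u) = emeasure lborel (box (T l) (T u))"
      by (simp add: emeasure_distr vimage)
    also have "\<dots> = (\<Prod>b\<in>Basis. (T u - T l) \<bullet> b)"
      by (rule emeasure_lborel_box) (auto simp: Basis_vec_def T_def inner_axis lu')
    also have "(\<Prod>b\<in>Basis. (T u - T l) \<bullet> b) = (\<Prod>i\<in>UNIV. (u - l) $ p i)"
      by (simp add: prod_Basis_vec inner_axis T_def)
    also have "\<dots> = (\<Prod>i\<in>UNIV. (u - l) $ i)"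
      by (rule prod.reindex_bij_betw[OF bij])
    also have "\<dots> = (\<Prod>b\<in>Basis. (u - l) \<bullet> b)"
      by (simp add: prod_Basis_vec inner_axis)
    finally show "emeasure (distr lborel borel T) (box l u) = (\<Prod>b\<in>Basis. (u - l) \<bullet> b)" .
  qed simp
  then have "(\<integral>\<^sup>+x. f x \<partial>lborel) = (\<integral>\<^sup>+x. f x \<partial>distr lborel borel T)"
    by simp
  also have "\<dots> = (\<integral>\<^sup>+x. f (T x) \<partial>lborel)"
    by (simp add: nn_integral_distr)
  finally show ?thesis by (simp add: T_def)
qed

lemma nn_integral_lborel_split_coordinate:
  fixes g :: "'a::euclidean_space \<Rightarrow> ennreal"
  assumes b: "b \<in> Basis" and g [measurable]: "g \<in> borel_measurable borel"
  shows "(\<integral>\<^sup>+x. g x \<partial>lborel)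
    = (\<integral>\<^sup>+s. (\<integral>\<^sup>+y. g (\<Sum>j\<in>Basis. (s(b := y)) j *\<^sub>R j) \<partial>lborel) \<partial>(\<Pi>\<^sub>M j\<in>Basis - {b}. lborel))"
proof -
  interpret product_sigma_finite "\<lambda>_::'a. lborel :: real measure" ..
  have "(\<integral>\<^sup>+x. g x \<partial>lborel)
      = (\<integral>\<^sup>+x. g x \<partial>distr (\<Pi>\<^sub>M b\<in>Basis. lborel) borel (\<lambda>f. \<Sum>b\<in>Basis. f b *\<^sub>R b))"
    by (subst lborel_eq) simp
  also have "\<dots> = (\<integral>\<^sup>+s. g (\<Sum>j\<in>Basis. s j *\<^sub>R j) \<partial>(\<Pi>\<^sub>M b\<in>Basis. lborel))"
    by (rule nn_integral_distr) simp_all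
  also have "(Basis :: 'a set) = insert b (Basis - {b})"
    using b by auto
  also have "(\<integral>\<^sup>+s. g (\<Sum>j\<in>insert b (Basis - {b}). s j *\<^sub>R j) \<partial>(\<Pi>\<^sub>M b\<in>insert b (Basis - {b}). lborel))
      = (\<integral>\<^sup>+s. (\<integral>\<^sup>+y. g (\<Sum>j\<in>insert b (Basis - {b}). (s(b := y)) j *\<^sub>R j) \<partial>lborel)
          \<partial>(\<Pi>\<^sub>M j\<in>Basis - {b}. lborel))"
    by (rule product_nn_integral_insert) simp_all
  also have "insert b (Basis - {b}) = Basis"
    using b by auto
  finally show ?thesis by simp
qed

text \<open>Integrate over the coordinate \<open>b\<close> first. With the others fixed the shear is
  a translation by the coordinate along \<open>c\<close>, which does not change with
  \<open>b\<close> because \<open>b \<noteq> c\<close>; one-dimensional translation invariance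
  applies.\<close>

lemma nn_integral_lborel_shear:
  fixes f :: "'a::euclidean_space \<Rightarrow> ennreal"
  assumes b: "b \<in> Basis" "c \<in> Basis" "b \<noteq> c" and f [measurable]: "f \<in> borel_measurable borel"
  shows "(\<integral>\<^sup>+x. f (x + (x \<bullet> c) *\<^sub>R b) \<partial>lborel) = (\<integral>\<^sup>+x. f x \<partial>lborel)"
proof -
  let ?v = "\<lambda>s::'a \<Rightarrow> real. \<Sum>j\<in>Basis. s j *\<^sub>R j"
  have shift: "?v (s(b := y)) + (?v (s(b := y)) \<bullet> c) *\<^sub>R b = ?v (s(b := s c + 1 * y))" for s y
  proof (rule euclidean_eqI)
    fix d :: 'a assume d: "d \<in> Basis"
    have v: "?v t \<bullet> d' = t d'" if "d' \<in> Basis" for t d'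
      using that by (rule inner_sum_left_Basis)
    have "b \<bullet> d = (if b = d then 1 else 0)"
      using b(1) d by (rule inner_Basis)
    then show "(?v (s(b := y)) + (?v (s(b := y)) \<bullet> c) *\<^sub>R b) \<bullet> d = ?v (s(b := s c + 1 * y)) \<bullet> d"
      unfolding inner_add_left inner_scaleR_left v[OF d] v[OF b(2)] using b(3) by auto
  qed
  have "(\<integral>\<^sup>+x. f (x + (x \<bullet> c) *\<^sub>R b) \<partial>lborel)
      = (\<integral>\<^sup>+s. (\<integral>\<^sup>+y. f (?v (s(b := s c + 1 * y))) \<partial>lborel) \<partial>(\<Pi>\<^sub>M j\<in>Basis - {b}. lborel))"
    unfolding shift[symmetric] by (rule nn_integral_lborel_split_coordinate[OF b(1)]) simp
  also have "\<dots> = (\<integral>\<^sup>+s. (\<integral>\<^sup>+y. f (?v (s(b := y))) \<partial>lborel) \<partial>(\<Pi>\<^sub>M j\<in>Basis - {b}. lborel))"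
  proof (rule nn_integral_cong)
    fix s :: "'a \<Rightarrow> real"
    have [measurable]: "(\<lambda>y. ?v (s(b := y))) \<in> borel_measurable borel"
      by (intro borel_measurable_sum borel_measurable_scaleR) (auto simp: fun_upd_def)
    have "(\<lambda>y. f (?v (s(b := y)))) \<in> borel_measurable borel"
      by measurable
    from nn_integral_real_affine[OF this, of 1 "s c"]
    show "(\<integral>\<^sup>+y. f (?v (s(b := s c + 1 * y))) \<partial>lborel) = (\<integral>\<^sup>+y. f (?v (s(b := y))) \<partial>lborel)"
      by simp
  qed
  also have "\<dots> = (\<integral>\<^sup>+x. f x \<partial>lborel)"
    by (rule nn_integral_lborel_split_coordinate[OF b(1) f, symmetric])
  finally show ?thesis .
qed

text \<open>The formula is stable under products, since determinants multiply, so it suffices to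
  check diagonal matrices, transpositions and elementary shears. The condition on the determinant
  sits inside the induction so that a zero row makes the claim vacuous.\<close>

lemma nn_integral_lborel_matrix:
  fixes A :: "real^'n^'n" and f :: "real^'n \<Rightarrow> ennreal"
  assumes "det A \<noteq> 0" and "f \<in> borel_measurable borel"
  shows "ennreal \<bar>det A\<bar> * (\<integral>\<^sup>+x. f (A *v x) \<partial>lborel) = (\<integral>\<^sup>+x. f x \<partial>lborel)"
proof -
  have "det A \<noteq> 0 \<longrightarrow> (\<forall>f::real^'n \<Rightarrow> ennreal. f \<in> borel_measurable borel \<longrightarrow>
      ennreal \<bar>det A\<bar> * (\<integral>\<^sup>+x. f (A *v x) \<partial>lborel) = (\<integral>\<^sup>+x. f x \<partial>lborel))"
  proof (induction rule: induct_matrix_elementary_alt)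
    fix A B :: "real^'n^'n"
    assume A: "det A \<noteq> 0 \<longrightarrow> (\<forall>f::real^'n \<Rightarrow> ennreal. f \<in> borel_measurable borel \<longrightarrow>
          ennreal \<bar>det A\<bar> * (\<integral>\<^sup>+x. f (A *v x) \<partial>lborel) = (\<integral>\<^sup>+x. f x \<partial>lborel))"
      and B: "det B \<noteq> 0 \<longrightarrow> (\<forall>f::real^'n \<Rightarrow> ennreal. f \<in> borel_measurable borel \<longrightarrow>
          ennreal \<bar>det B\<bar> * (\<integral>\<^sup>+x. f (B *v x) \<partial>lborel) = (\<integral>\<^sup>+x. f x \<partial>lborel))"
    show "det (A ** B) \<noteq> 0 \<longrightarrow> (\<forall>f::real^'n \<Rightarrow> ennreal. f \<in> borel_measurable borel \<longrightarrow>
      ennreal \<bar>det (A ** B)\<bar> * (\<integral>\<^sup>+x. f ((A ** B) *v x) \<partial>lborel) = (\<integral>\<^sup>+x. f x \<partial>lborel))"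
    proof (intro impI allI)
      fix f :: "real^'n \<Rightarrow> ennreal"
      assume d: "det (A ** B) \<noteq> 0" and f [measurable]: "f \<in> borel_measurable borel"
      have dA: "det A \<noteq> 0" and dB: "det B \<noteq> 0"
        using d by (auto simp: det_mul)
      have "(\<lambda>x. f (A *v x)) \<in> borel_measurable borel" by measurable
      then have "ennreal \<bar>det B\<bar> * (\<integral>\<^sup>+x. f (A *v (B *v x)) \<partial>lborel) = (\<integral>\<^sup>+x. f (A *v x) \<partial>lborel)"
        using B dB by blast
      moreover have "ennreal \<bar>det A\<bar> * (\<integral>\<^sup>+x. f (A *v x) \<partial>lborel) = (\<integral>\<^sup>+x. f x \<partial>lborel)"
        using A dA f by blast
      ultimately show "ennreal \<bar>det (A ** B)\<bar> * (\<integral>\<^sup>+x. f ((A ** B) *v x) \<partial>lborel) = (\<integral>\<^sup>+x. f x \<partial>lborel)"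
        by (simp add: det_mul abs_mult ennreal_mult' matrix_vector_mul_assoc[symmetric] mult.assoc)
    qed
  next
    fix A :: "real^'n^'n" and i assume "row i A = 0"
    then show "det A \<noteq> 0 \<longrightarrow> (\<forall>f::real^'n \<Rightarrow> ennreal. f \<in> borel_measurable borel \<longrightarrow>
      ennreal \<bar>det A\<bar> * (\<integral>\<^sup>+x. f (A *v x) \<partial>lborel) = (\<integral>\<^sup>+x. f x \<partial>lborel))"
      using det_zero_row by blast
  next
    fix A :: "real^'n^'n" assume "\<And>i j. i \<noteq> j \<Longrightarrow> A $ i $ j = 0"
    then show "det A \<noteq> 0 \<longrightarrow> (\<forall>f::real^'n \<Rightarrow> ennreal. f \<in> borel_measurable borel \<longrightarrow>
      ennreal \<bar>det A\<bar> * (\<integral>\<^sup>+x. f (A *v x) \<partial>lborel) = (\<integral>\<^sup>+x. f x \<partial>lborel))"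
      using nn_integral_lborel_diagonal by blast
  next
    fix m n :: 'n assume "m \<noteq> n"
    let ?p = "Transposition.transpose m n"
    let ?A = "(\<chi> i j. mat 1 $ i $ ?p j) :: real^'n^'n"
    have "det ?A = of_int (sign ?p) * det (mat 1 :: real^'n^'n)"
      by (rule det_permute_columns) (simp add: permutes_swap_id)
    then have d: "\<bar>det ?A\<bar> = 1"
      by (simp add: sign_def)
    have "?A *v x = (\<chi> i. x $ ?p i)" for x
    proof -
      have "(\<Sum>j\<in>UNIV. mat 1 $ i $ ?p j * x $ j) = (\<Sum>j\<in>UNIV. if j = ?p i then x $ ?p i else 0)" for i
        by (intro sum.cong) (auto simp: mat_def)
      then show ?thesis
        by (simp add: matrix_vector_mult_def vec_eq_iff)
    qed
    then show "det ?A \<noteq> 0 \<longrightarrow> (\<forall>f::real^'n \<Rightarrow> ennreal. f \<in> borel_measurable borel \<longrightarrow>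
      ennreal \<bar>det ?A\<bar> * (\<integral>\<^sup>+x. f (?A *v x) \<partial>lborel) = (\<integral>\<^sup>+x. f x \<partial>lborel))"
      using nn_integral_lborel_permute[of ?p] by (simp add: d)
  next
    fix m n :: 'n assume mn: "m \<noteq> n"
    let ?A = "(\<chi> i j. of_bool (i = m \<and> j = n \<or> i = j)) :: real^'n^'n"
    have "?A = (\<chi> k. if k = m then row m (mat 1) + 1 *s row n (mat 1) else row k (mat 1))"
      using mn by (auto simp: vec_eq_iff row_def mat_def)
    then have d: "det ?A = 1"
      using det_row_operation[OF mn, of "mat 1 :: real^'n^'n" 1] by simp
    have A: "?A *v x = x + (x \<bullet> axis n 1) *\<^sub>R axis m 1" for x
    proof -
      have "(\<Sum>j\<in>UNIV. of_bool (i = m \<and> j = n \<or> i = j) * x $ j)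
        = (\<Sum>j\<in>UNIV. (if j = i then x $ i else 0) + (if j = n then (if i = m then x $ n else 0) else 0))" for i
        using mn by (intro sum.cong) auto
      moreover have "x \<bullet> axis n 1 = x $ n"
        by (simp add: inner_axis)
      ultimately show ?thesis
        by (auto simp add: matrix_vector_mult_def vec_eq_iff sum.distrib axis_def)
    qed
    have "axis m 1 \<in> (Basis :: (real^'n) set)" "axis n 1 \<in> (Basis :: (real^'n) set)"
      "axis m 1 \<noteq> (axis n 1 :: real^'n)"
      using mn by (auto simp: Basis_vec_def axis_eq_axis)
    note shear = nn_integral_lborel_shear[OF this]
    show "det ?A \<noteq> 0 \<longrightarrow> (\<forall>f::real^'n \<Rightarrow> ennreal. f \<in> borel_measurable borel \<longrightarrow>
      ennreal \<bar>det ?A\<bar> * (\<integral>\<^sup>+x. f (?A *v x) \<partial>lborel) = (\<integral>\<^sup>+x. f x \<partial>lborel))"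
      unfolding A d by (simp add: shear)
  qed
  with assms show ?thesis by blast
qed

lemma nn_integral_lborel_affine:
  fixes A :: "real^'n^'n" and f :: "real^'n \<Rightarrow> ennreal"
  assumes A: "det A \<noteq> 0" and f [measurable]: "f \<in> borel_measurable borel"
  shows "ennreal \<bar>det A\<bar> * (\<integral>\<^sup>+x. f (m + A *v x) \<partial>lborel) = (\<integral>\<^sup>+x. f x \<partial>lborel)"
proof -
  have "(\<lambda>x. f (m + x)) \<in> borel_measurable borel" by measurable
  from nn_integral_lborel_matrix[OF A this]
  have "ennreal \<bar>det A\<bar> * (\<integral>\<^sup>+x. f (m + A *v x) \<partial>lborel) = (\<integral>\<^sup>+x. f (m + x) \<partial>lborel)" .
  also have "\<dots> = (\<integral>\<^sup>+x. f x \<partial>distr lborel borel ((+) m))"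
    by (simp add: nn_integral_distr)
  finally show ?thesis
    by (simp add: lborel_distr_plus)
qed

section \<open>Gaussian measures\<close>

abbreviation std_gaussian :: "(real^'n) measure" where
  "std_gaussian \<equiv> gaussian 0 (mat 1)"

lemma sets_gaussian [simp, measurable_cong]: "sets (gaussian m S) = sets borel"
  by (simp add: gaussian_def)

lemma space_gaussian [simp]: "space (gaussian m S) = UNIV"
  by (simp add: gaussian_def)

lemma matrix_inv_mat_1: "matrix_inv (mat 1 :: real^'n^'n) = mat 1"
  by (rule matrix_inv_eqI) simp

lemma std_gaussian_density:
  fixes x :: "real^'n"
  shows "exp (- (x \<bullet> x) / 2) / sqrt ((2 * pi) ^ CARD('n)) = (\<Prod>b\<in>Basis. std_normal_density (x \<bullet> b))"
proof -
  have "(\<Prod>b\<in>Basis. std_normal_density (x \<bullet> b))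
      = (\<Prod>b\<in>(Basis :: (real^'n) set). 1 / sqrt (2 * pi)) * (\<Prod>b\<in>Basis. exp (- (x \<bullet> b)\<^sup>2 / 2))"
    unfolding std_normal_density_def by (rule prod.distrib)
  also have "(\<Prod>b\<in>(Basis :: (real^'n) set). 1 / sqrt (2 * pi)) = 1 / sqrt ((2 * pi) ^ CARD('n))"
    by (simp add: power_one_over real_sqrt_power[symmetric] del: power_mult_distrib)
  also have "(\<Prod>b\<in>Basis. exp (- (x \<bullet> b)\<^sup>2 / 2)) = exp (- (x \<bullet> x) / 2)"
    by (subst (2) euclidean_inner)
      (simp add: exp_sum[symmetric] sum_negf sum_divide_distrib power2_eq_square)
  finally show ?thesis by simp
qed

text \<open>The density is itself a product over coordinates, so Tonelli reduces total mass, second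
  moments and exponential integrals to one dimension.\<close>

lemma nn_integral_std_gaussian_prod:
  fixes f :: "real^'n \<Rightarrow> real \<Rightarrow> real"
  assumes f [measurable]: "\<And>b. b \<in> Basis \<Longrightarrow> f b \<in> borel_measurable borel"
    and nonneg: "\<And>b t. b \<in> Basis \<Longrightarrow> 0 \<le> f b t"
  shows "(\<integral>\<^sup>+x. ennreal (\<Prod>b\<in>Basis. f b (x \<bullet> b)) \<partial>std_gaussian)
    = (\<Prod>b\<in>Basis. \<integral>\<^sup>+t. ennreal (std_normal_density t * f b t) \<partial>lborel)"
proof -
  have "(\<integral>\<^sup>+x. ennreal (\<Prod>b\<in>Basis. f b (x \<bullet> b)) \<partial>std_gaussian)
      = (\<integral>\<^sup>+x. ennreal (\<Prod>b\<in>Basis. std_normal_density (x \<bullet> b)) * ennreal (\<Prod>b\<in>Basis. f b (x \<bullet> b)) \<partial>lborel)"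
    unfolding gaussian_def
    by (subst nn_integral_density) (simp_all add: matrix_inv_mat_1 std_gaussian_density[symmetric])
  also have "\<dots> = (\<integral>\<^sup>+x. (\<Prod>b\<in>Basis. ennreal (std_normal_density (x \<bullet> b) * f b (x \<bullet> b))) \<partial>lborel)"
    by (intro nn_integral_cong)
      (simp add: prod_ennreal nonneg prod.distrib ennreal_mult' prod_nonneg)
  also have "\<dots> = (\<Prod>b\<in>Basis. \<integral>\<^sup>+t. ennreal (std_normal_density t * f b t) \<partial>lborel)"
    by (rule nn_integral_lborel_prod) auto
  finally show ?thesis .
qed

lemma nn_integral_std_normal_density: "(\<integral>\<^sup>+t. ennreal (std_normal_density t) \<partial>lborel) = 1"
  by (simp add: nn_integral_eq_integral)

lemma prob_space_std_gaussian: "prob_space (std_gaussian :: (real^'n) measure)"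
proof
  have "emeasure (std_gaussian :: (real^'n) measure) UNIV = (\<integral>\<^sup>+x. 1 \<partial>(std_gaussian :: (real^'n) measure))"
    by simp
  also have "\<dots> = 1"
    using nn_integral_std_gaussian_prod[of "\<lambda>(_::real^'n) _. 1"]
    by (simp add: nn_integral_std_normal_density)
  finally show "emeasure (std_gaussian :: (real^'n) measure) (space std_gaussian) = 1"
    by simp
qed

text \<open>In the change of variables the Jacobian of \<open>B\<close> cancels against the root of
  \<open>det (B ** transpose B)\<close>. A general factor is allowed because three kinds occur: the
  principal root, orthogonal matrices, and the non-symmetric product of the optimal matrix with a
  root.\<close>

lemma gaussian_eq_distr_std_gaussian:
  fixes B :: "real^'n^'n"
  assumes B: "invertible B"
  shows "gaussian m (B ** transpose B) = distr std_gaussian borel (\<lambda>x. m + B *v x)"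
proof (rule measure_eqI)
  fix X :: "(real^'n) set" assume "X \<in> sets (gaussian m (B ** transpose B))"
  then have [measurable]: "X \<in> sets borel" by simp
  let ?S = "B ** transpose B"
  let ?g = "\<lambda>x. ennreal (exp (- ((x - m) \<bullet> (matrix_inv ?S *v (x - m))) / 2) / sqrt ((2 * pi) ^ CARD('n) * det ?S))"
  have dB: "det B \<noteq> 0"
    using B by (simp add: invertible_det_nz)
  have inv: "matrix_inv ?S = transpose (matrix_inv B) ** matrix_inv B"
  proof (rule matrix_inv_eqI)
    have "transpose B ** transpose (matrix_inv B) = mat 1"
      by (metis B matrix_inv_left matrix_transpose_mul transpose_mat)
    then have "?S ** (transpose (matrix_inv B) ** matrix_inv B) = B ** (mat 1 ** matrix_inv B)"
      by (metis matrix_mul_assoc)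
    then show "?S ** (transpose (matrix_inv B) ** matrix_inv B) = mat 1"
      by (simp add: matrix_inv_right[OF B])
  qed
  have q: "(B *v x) \<bullet> (matrix_inv ?S *v (B *v x)) = x \<bullet> x" for x
  proof -
    have "(B *v x) \<bullet> (matrix_inv ?S *v (B *v x))
        = (matrix_inv B *v (B *v x)) \<bullet> (matrix_inv B *v (B *v x))"
      unfolding inv matrix_vector_mul_assoc[symmetric]
      by (simp add: inner_matrix_vector_right[of _ "transpose (matrix_inv B)"] del: transpose_matrix_vector)
    also have "\<dots> = x \<bullet> x"
      by (simp add: matrix_vector_mul_assoc matrix_inv_left[OF B])
    finally show ?thesis .
  qed
  have "sqrt ((2 * pi) ^ CARD('n) * det ?S) = \<bar>det B\<bar> * sqrt ((2 * pi) ^ CARD('n))"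
    by (simp add: det_mul real_sqrt_mult power2_eq_square[symmetric])
  then have g: "ennreal \<bar>det B\<bar> * ?g (m + B *v x)
      = ennreal (exp (- (x \<bullet> x) / 2) / sqrt ((2 * pi) ^ CARD('n)))" for x
    using dB by (simp add: q ennreal_mult'[symmetric])
  have "emeasure (gaussian m ?S) X = (\<integral>\<^sup>+x. ?g x * indicator X x \<partial>lborel)"
    unfolding gaussian_def by (rule emeasure_density) simp_all
  also have "\<dots> = ennreal \<bar>det B\<bar> * (\<integral>\<^sup>+x. ?g (m + B *v x) * indicator X (m + B *v x) \<partial>lborel)"
    by (rule nn_integral_lborel_affine[OF dB, symmetric]) simp
  also have "\<dots> = (\<integral>\<^sup>+x. ennreal \<bar>det B\<bar> * ?g (m + B *v x) * indicator X (m + B *v x) \<partial>lborel)"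
    by (subst nn_integral_cmult[symmetric]) (simp_all add: mult.assoc)
  also have "\<dots> = (\<integral>\<^sup>+x. ennreal (exp (- (x \<bullet> x) / 2) / sqrt ((2 * pi) ^ CARD('n)))
      * indicator ((\<lambda>x. m + B *v x) -` X) x \<partial>lborel)"
    unfolding g by (simp add: indicator_vimage[symmetric] indicator_def)
  also have "\<dots> = emeasure std_gaussian ((\<lambda>x. m + B *v x) -` X)"
  proof -
    have "(\<lambda>x. m + B *v x) -` X \<inter> space borel \<in> sets borel"
      by (rule measurable_sets[where A = borel]) measurable
    then show ?thesis
      unfolding gaussian_def by (subst emeasure_density) (simp_all add: matrix_inv_mat_1)
  qed
  also have "\<dots> = emeasure (distr std_gaussian borel (\<lambda>x. m + B *v x)) X"
    by (subst emeasure_distr) simp_all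
  finally show "emeasure (gaussian m ?S) X = emeasure (distr std_gaussian borel (\<lambda>x. m + B *v x)) X" .
qed simp

lemma gaussian_eq_distr_mat_sqrt:
  fixes S :: "real^'n^'n"
  assumes "sym_pos_def S"
  shows "gaussian m S = distr std_gaussian borel (\<lambda>x. m + mat_sqrt S *v x)"
  using gaussian_eq_distr_std_gaussian[OF sym_pos_def_invertible[OF sym_pos_def_mat_sqrt[OF assms]], of m]
  by (simp add: sym_pos_def_sym[OF sym_pos_def_mat_sqrt[OF assms]] mat_sqrt_square[OF assms])

lemma prob_space_gaussian:
  assumes "sym_pos_def S"
  shows "prob_space (gaussian m S)"
  unfolding gaussian_eq_distr_mat_sqrt[OF assms]
  by (rule prob_space.prob_space_distr[OF prob_space_std_gaussian]) simp

section \<open>Exponential integrability and moments\<close>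

lemma integral_gaussian:
  fixes S :: "real^'n^'n" and f :: "real^'n \<Rightarrow> 'b::{banach, second_countable_topology}"
  assumes S: "sym_pos_def S" and [measurable]: "f \<in> borel_measurable borel"
  shows "(LINT x|gaussian m S. f x) = (LINT x|std_gaussian. f (m + mat_sqrt S *v x))"
  unfolding gaussian_eq_distr_mat_sqrt[OF S] by (rule integral_distr) simp_all

lemma integrable_gaussian_iff:
  fixes S :: "real^'n^'n" and f :: "real^'n \<Rightarrow> 'b::{banach, second_countable_topology}"
  assumes S: "sym_pos_def S" and [measurable]: "f \<in> borel_measurable borel"
  shows "integrable (gaussian m S) f \<longleftrightarrow> integrable std_gaussian (\<lambda>x. f (m + mat_sqrt S *v x))"
  unfolding gaussian_eq_distr_mat_sqrt[OF S] by (rule integrable_distr_eq) simp_all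

text \<open>The exponent \<open>1/4\<close> uses up half of the Gaussian decay \<open>1/2\<close>:
  each one-dimensional factor becomes \<open>sqrt 2\<close> times the normal density of variance 2.
  The same function later dominates everything of quadratic growth.\<close>

lemma integrable_std_gaussian_exp:
  "integrable (std_gaussian :: (real^'n) measure) (\<lambda>x. exp ((norm x)\<^sup>2 / 4))"
proof (rule integrableI_bounded)
  have "ennreal (norm (exp ((norm x)\<^sup>2 / 4))) = ennreal (\<Prod>b\<in>Basis. exp ((x \<bullet> b)\<^sup>2 / 4))" for x :: "real^'n"
  proof -
    have "(norm x)\<^sup>2 / 4 = (\<Sum>b\<in>Basis. (x \<bullet> b)\<^sup>2 / 4)"
      unfolding power2_norm_eq_inner
      by (subst euclidean_inner) (simp add: sum_divide_distrib power2_eq_square)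
    then show ?thesis
      by (simp add: exp_sum abs_prod)
  qed
  moreover have "std_normal_density t * exp (t\<^sup>2 / 4) = sqrt 2 * normal_density 0 (sqrt 2) t" for t
    by (simp add: normal_density_def real_sqrt_mult exp_add[symmetric] field_simps)
  then have "(\<integral>\<^sup>+t. ennreal (std_normal_density t * exp (t\<^sup>2 / 4)) \<partial>lborel) = ennreal (sqrt 2)"
    by (simp add: ennreal_mult' nn_integral_cmult nn_integral_eq_integral)
  ultimately have "(\<integral>\<^sup>+x. ennreal (norm (exp ((norm x)\<^sup>2 / 4))) \<partial>(std_gaussian :: (real^'n) measure))
      = (\<Prod>b\<in>(Basis :: (real^'n) set). ennreal (sqrt 2))"
    using nn_integral_std_gaussian_prod[of "\<lambda>(_::real^'n) t. exp (t\<^sup>2 / 4)"] by simp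
  also have "\<dots> < \<infinity>"
    by (simp add: ennreal_power power_less_top_ennreal)
  finally show "(\<integral>\<^sup>+x. ennreal (norm (exp ((norm x)\<^sup>2 / 4))) \<partial>(std_gaussian :: (real^'n) measure)) < \<infinity>" .
qed simp

lemma integrable_std_gaussian_le_norm_sq:
  fixes f :: "real^'n \<Rightarrow> 'b::{banach, second_countable_topology}"
  assumes [measurable]: "f \<in> borel_measurable borel" and f: "\<And>x. norm (f x) \<le> c * (1 + (norm x)\<^sup>2)"
  shows "integrable std_gaussian f"
proof (rule Bochner_Integration.integrable_bound)
  show "integrable (std_gaussian :: (real^'n) measure) (\<lambda>x. (\<bar>c\<bar> * 4) * exp ((norm x)\<^sup>2 / 4))"
    by (intro integrable_mult_right integrable_std_gaussian_exp)
  show "AE x in std_gaussian. norm (f x) \<le> norm (\<bar>c\<bar> * 4 * exp ((norm x)\<^sup>2 / 4))"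
  proof (rule AE_I2)
    fix x :: "real^'n"
    have "1 + (norm x)\<^sup>2 \<le> 4 * exp ((norm x)\<^sup>2 / 4)"
      using exp_ge_add_one_self[of "(norm x)\<^sup>2 / 4"] by linarith
    have "norm (f x) \<le> c * (1 + (norm x)\<^sup>2)"
      by (rule f)
    also have "\<dots> \<le> \<bar>c\<bar> * (4 * exp ((norm x)\<^sup>2 / 4))"
      using \<open>1 + (norm x)\<^sup>2 \<le> 4 * exp ((norm x)\<^sup>2 / 4)\<close> by (intro mult_mono) auto
    finally show "norm (f x) \<le> norm (\<bar>c\<bar> * 4 * exp ((norm x)\<^sup>2 / 4))"
      by simp
  qed
qed simp

lemma integrable_std_gaussian_nth: "integrable std_gaussian (\<lambda>x::real^'n. x $ i)"
proof (rule integrable_std_gaussian_le_norm_sq)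
  fix x :: "real^'n"
  have "norm (x $ i) \<le> norm x"
    using component_le_norm_cart[of x i] by simp
  also have "\<dots> \<le> 1 * (1 + (norm x)\<^sup>2)"
    using self_le_power[of "norm x" 2] by (cases "norm x \<le> 1") (auto intro: order_trans)
  finally show "norm (x $ i) \<le> 1 * (1 + (norm x)\<^sup>2)" .
qed simp

lemma integrable_std_gaussian_nth_mult: "integrable std_gaussian (\<lambda>x::real^'n. x $ i * x $ j)"
proof (rule integrable_std_gaussian_le_norm_sq)
  fix x :: "real^'n"
  have "norm (x $ i * x $ j) \<le> norm x * norm x"
    unfolding norm_mult using component_le_norm_cart[of x] by (intro mult_mono) auto
  then show "norm (x $ i * x $ j) \<le> 1 * (1 + (norm x)\<^sup>2)"
    by (simp add: power2_eq_square)
qed simp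

text \<open>Rotation invariance. Reflections are the case that matters: they force odd moments to
  equal their own negatives.\<close>

lemma integral_std_gaussian_orthogonal:
  fixes B :: "real^'n^'n" and f :: "real^'n \<Rightarrow> real"
  assumes B: "B ** transpose B = mat 1" and [measurable]: "f \<in> borel_measurable borel"
  shows "(LINT x|std_gaussian. f x) = (LINT x|std_gaussian. f (B *v x))"
proof -
  have "invertible B"
    using B invertible_right_inverse by blast
  then have "std_gaussian = distr std_gaussian borel (\<lambda>x. B *v x)"
    using gaussian_eq_distr_std_gaussian[of B 0] B by simp
  then have "(LINT x|std_gaussian. f x) = (LINT x|distr std_gaussian borel (\<lambda>x. B *v x). f x)"
    by simp
  also have "\<dots> = (LINT x|std_gaussian. f (B *v x))"
    by (rule integral_distr) simp_all
  finally show ?thesis .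
qed

lemma integral_std_gaussian_nth: "(LINT x|std_gaussian. (x::real^'n) $ i) = 0"
proof -
  define c :: real where "c = - 1"
  have "c * c = 1"
    by (simp add: c_def)
  then have "(c *\<^sub>R mat 1) ** transpose (c *\<^sub>R mat 1) = (mat 1 :: real^'n^'n)"
    by (simp add: transpose_scalar matrix_scalar_ac scalar_matrix_assoc[symmetric])
  from integral_std_gaussian_orthogonal[OF this, of "\<lambda>x. x $ i"]
  have "(LINT x|std_gaussian. (x::real^'n) $ i) = (LINT x|std_gaussian. ((c *\<^sub>R mat 1) *v x::real^'n) $ i)"
    by simp
  also have "\<dots> = c * (LINT x|std_gaussian. (x::real^'n) $ i)"
    by (simp add: scaleR_matrix_vector_assoc[symmetric])
  finally have "(LINT x|std_gaussian. (x::real^'n) $ i) = - (LINT x|std_gaussian. (x::real^'n) $ i)"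
    by (simp add: c_def)
  then show ?thesis by simp
qed

text \<open>Off the diagonal, flipping the sign of coordinate \<open>i\<close> alone negates the
  integrand. On the diagonal the product formula leaves one factor equal to the normal variance 1
  and all others equal to the total mass.\<close>

lemma integral_std_gaussian_nth_mult:
  "(LINT x|std_gaussian. (x::real^'n) $ i * x $ j) = (if i = j then 1 else 0)"
proof (cases "i = j")
  case False
  define d :: "'n \<Rightarrow> real" where "d = (\<lambda>k. if k = i then - 1 else 1)"
  define B :: "real^'n^'n" where "B = (\<chi> k l. if k = l then d k else 0)"
  have "(B ** transpose B) $ k $ l = (\<Sum>m\<in>UNIV. if m = k then (if l = k then d k * d k else 0) else 0)" for k l
    unfolding B_def matrix_matrix_mult_def transpose_def vec_lambda_beta by (rule sum.cong) auto
  then have "B ** transpose B = mat 1"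
    by (simp add: vec_eq_iff mat_def d_def)
  from integral_std_gaussian_orthogonal[OF this, of "\<lambda>x. x $ i * x $ j"]
  have "(LINT x|std_gaussian. (x::real^'n) $ i * x $ j) = (LINT x|std_gaussian. (B *v x) $ i * (B *v x) $ j)"
    by simp
  also have "(B *v x) $ k = (if k = i then - (x $ k) else x $ k)" for x k
  proof -
    have "(B *v x) $ k = (\<Sum>l\<in>UNIV. if l = k then if k = i then - (x $ k) else x $ k else 0)"
      unfolding B_def d_def matrix_vector_mult_def vec_lambda_beta by (rule sum.cong) auto
    then show ?thesis by simp
  qed
  then have "(LINT x|std_gaussian. (B *v x) $ i * (B *v x) $ j) = (LINT x|std_gaussian. - ((x::real^'n) $ i * x $ j))"
    using False by (intro Bochner_Integration.integral_cong) auto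
  finally show ?thesis using False by simp
next
  case True
  let ?e = "axis i 1 :: real^'n"
  have e: "?e \<in> Basis"
    by (auto simp: Basis_vec_def)
  have "ennreal ((x $ i)\<^sup>2) = ennreal (\<Prod>b\<in>Basis. (if b = ?e then (x \<bullet> b)\<^sup>2 else 1))" for x :: "real^'n"
    using e by (simp add: inner_axis)
  then have "(\<integral>\<^sup>+x. ennreal (((x::real^'n) $ i)\<^sup>2) \<partial>std_gaussian)
      = (\<Prod>b\<in>Basis. \<integral>\<^sup>+t. ennreal (std_normal_density t * (if b = ?e then t\<^sup>2 else 1)) \<partial>lborel)"
    using nn_integral_std_gaussian_prod[of "\<lambda>b t. if b = ?e then t\<^sup>2 else 1"] by simp
  also have "\<dots> = (\<Prod>b\<in>(Basis :: (real^'n) set). 1)"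
  proof (intro prod.cong refl)
    fix b :: "real^'n" assume "b \<in> Basis"
    have "(\<integral>\<^sup>+t. ennreal (std_normal_density t * t\<^sup>2) \<partial>lborel) = 1"
      using integral_std_normal_moment_even[of 1] integrable_std_normal_moment[of 2]
      by (simp add: nn_integral_eq_integral fact_2)
    then show "(\<integral>\<^sup>+t. ennreal (std_normal_density t * (if b = ?e then t\<^sup>2 else 1)) \<partial>lborel) = 1"
      by (cases "b = ?e") (simp_all add: nn_integral_std_normal_density)
  qed
  finally have "(\<integral>\<^sup>+x. ennreal (((x::real^'n) $ i)\<^sup>2) \<partial>std_gaussian) = 1"
    by simp
  then have "(LINT x|std_gaussian. ((x::real^'n) $ i)\<^sup>2) = 1"
    by (simp add: integral_eq_nn_integral)
  then show ?thesis
    using True by (simp add: power2_eq_square)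
qed

lemma gaussian_nth:
  fixes S :: "real^'n^'n"
  assumes S: "sym_pos_def S"
  shows integrable_gaussian_nth: "integrable (gaussian m S) (\<lambda>x. x $ i)"
    and integral_gaussian_nth: "(LINT x|gaussian m S. x $ i) = m $ i"
proof -
  interpret prob_space "std_gaussian :: (real^'n) measure"
    by (rule prob_space_std_gaussian)
  show "integrable (gaussian m S) (\<lambda>x. x $ i)"
    by (subst integrable_gaussian_iff[OF S])
      (auto simp: matrix_vector_mult_def
        intro!: Bochner_Integration.integrable_add Bochner_Integration.integrable_sum integrable_std_gaussian_nth)
  show "(LINT x|gaussian m S. x $ i) = m $ i"
    by (subst integral_gaussian[OF S])
      (simp_all add: matrix_vector_mult_def integrable_std_gaussian_nth integral_std_gaussian_nth prob_space[simplified])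
qed

lemma gaussian_centered_nth_mult:
  fixes S :: "real^'n^'n"
  assumes S: "sym_pos_def S"
  shows integrable_gaussian_centered: "integrable (gaussian m S) (\<lambda>x. (x $ i - m $ i) * (x $ j - m $ j))"
    and integral_gaussian_centered: "(LINT x|gaussian m S. (x $ i - m $ i) * (x $ j - m $ j)) = S $ i $ j"
proof -
  let ?B = "mat_sqrt S"
  have B: "transpose ?B = ?B" "?B ** ?B = S"
    using sym_pos_def_sym[OF sym_pos_def_mat_sqrt[OF S]] mat_sqrt_square[OF S] by auto
  have eq: "((m + ?B *v x) $ i - m $ i) * ((m + ?B *v x) $ j - m $ j)
      = (\<Sum>k\<in>UNIV. \<Sum>l\<in>UNIV. ?B $ i $ k * ?B $ j $ l * (x $ k * x $ l))" for x
    by (simp add: matrix_vector_mult_def sum_product mult_ac)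
  show "integrable (gaussian m S) (\<lambda>x. (x $ i - m $ i) * (x $ j - m $ j))"
    by (subst integrable_gaussian_iff[OF S], simp)
      (unfold eq, intro Bochner_Integration.integrable_sum integrable_mult_right integrable_std_gaussian_nth_mult)
  have "(LINT x|gaussian m S. (x $ i - m $ i) * (x $ j - m $ j))
      = (LINT x|std_gaussian. (\<Sum>k\<in>UNIV. \<Sum>l\<in>UNIV. ?B $ i $ k * ?B $ j $ l * (x $ k * x $ l)))"
    by (subst integral_gaussian[OF S], simp) (unfold eq, rule refl)
  also have "\<dots> = (\<Sum>k\<in>UNIV. \<Sum>l\<in>UNIV. ?B $ i $ k * ?B $ j $ l * (if k = l then 1 else 0))"
    by (subst Bochner_Integration.integral_sum,
        intro Bochner_Integration.integrable_sum integrable_mult_right integrable_std_gaussian_nth_mult)+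
      (simp add: integral_std_gaussian_nth_mult)
  also have "\<dots> = (\<Sum>k\<in>UNIV. ?B $ i $ k * transpose ?B $ k $ j)"
    by (simp add: transpose_def if_distrib cong: if_cong)
  also have "\<dots> = S $ i $ j"
    unfolding B(1) by (subst (3) B(2)[symmetric]) (simp add: matrix_matrix_mult_def)
  finally show "(LINT x|gaussian m S. (x $ i - m $ i) * (x $ j - m $ j)) = S $ i $ j" .
qed

lemma integrable_vec_lambda:
  fixes f :: "'a \<Rightarrow> real^'n"
  assumes "\<And>i. integrable M (\<lambda>x. f x $ i)"
  shows "integrable M f"
proof -
  have "integrable M (\<lambda>x. \<Sum>i\<in>UNIV. (f x $ i) *\<^sub>R axis i (1::real))"
    by (intro Bochner_Integration.integrable_sum integrable_scaleR_left assms)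
  moreover have "(\<lambda>x. \<Sum>i\<in>UNIV. (f x $ i) *\<^sub>R axis i (1::real)) = f"
    by (simp add: fun_eq_iff vec_eq_iff axis_def if_distrib cong: if_cong)
  ultimately show ?thesis by simp
qed

lemma mean_vec_gaussian:
  fixes S :: "real^'n^'n"
  assumes S: "sym_pos_def S"
  shows "mean_vec (gaussian m S) = m"
proof (rule vec_eq_iff[THEN iffD2], rule allI)
  fix i
  have "integrable (gaussian m S) (\<lambda>x. x)"
    by (rule integrable_vec_lambda) (rule integrable_gaussian_nth[OF S])
  then have "(LINT x|gaussian m S. x) $ i = (LINT x|gaussian m S. x $ i)"
    by (rule integral_bounded_linear[OF bounded_linear_vec_nth, symmetric])
  then show "mean_vec (gaussian m S) $ i = m $ i"
    by (simp add: mean_vec_def integral_gaussian_nth[OF S])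
qed

lemma cov_mat_gaussian:
  assumes S: "sym_pos_def S"
  shows "cov_mat (gaussian m S) = S"
  by (simp add: cov_mat_def mean_vec_gaussian[OF S] integral_gaussian_centered[OF S] vec_eq_iff)

lemma gaussian_tendstoI:
  fixes P :: "'a \<Rightarrow> real^'n^'n"
  assumes "(u \<longlongrightarrow> m) F" "(P \<longlongrightarrow> S) F" "\<forall>\<^sub>F t in F. sym_pos_def (P t)" "sym_pos_def S"
  shows "gaussian_tendsto (\<lambda>t. gaussian (u t) (P t)) (gaussian m S) F"
proof -
  have "\<forall>\<^sub>F t in F. u t = mean_vec (gaussian (u t) (P t))" "\<forall>\<^sub>F t in F. P t = cov_mat (gaussian (u t) (P t))"
    using assms(3) by (eventually_elim, simp add: mean_vec_gaussian cov_mat_gaussian)+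
  then show ?thesis
    unfolding gaussian_tendsto_def mean_vec_gaussian[OF assms(4)] cov_mat_gaussian[OF assms(4)]
    using assms(1,2) by (auto elim: Lim_transform_eventually)
qed

lemma quadratic_form_sum:
  fixes M :: "real^'n^'n"
  shows "x \<bullet> (M *v x) = (\<Sum>i\<in>UNIV. \<Sum>j\<in>UNIV. M $ i $ j * (x $ i * x $ j))"
  by (simp add: inner_vec_def matrix_vector_mult_def sum_distrib_left mult_ac)

text \<open>Bias-variance decomposition; \<open>M \<bullet> S\<close> is the Frobenius pairing, i.e.
  the trace of \<open>M ** S\<close> for symmetric \<open>S\<close>. The centre \<open>v\<close> is
  free because a divergence between two Gaussians involves forms centred at both means.\<close>

lemma gaussian_quadratic_form:
  fixes S M :: "real^'n^'n"
  assumes S: "sym_pos_def S"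
  shows integrable_gaussian_quadratic_form: "integrable (gaussian m S) (\<lambda>x. (x - v) \<bullet> (M *v (x - v)))"
    and integral_gaussian_quadratic_form:
      "(LINT x|gaussian m S. (x - v) \<bullet> (M *v (x - v))) = M \<bullet> S + (m - v) \<bullet> (M *v (m - v))"
proof -
  interpret prob_space "gaussian m S"
    by (rule prob_space_gaussian[OF S])
  define g where "g = (\<lambda>i j (x::real^'n). (x $ i - m $ i) * (x $ j - m $ j))"
  have g: "integrable (gaussian m S) (g i j)" "(LINT x|gaussian m S. g i j x) = S $ i $ j" for i j
    by (simp_all add: g_def integrable_gaussian_centered[OF S] integral_gaussian_centered[OF S])
  \<comment> \<open>Rewritten around the mean, the integrand is a sum of a centred product, two
    first moments and a constant, all of known integral.\<close>
  have eq: "(x $ i - v $ i) * (x $ j - v $ j) = g i j x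
      + (m $ j - v $ j) * (x $ i) + (m $ i - v $ i) * (x $ j)
      + (v $ i * v $ j - m $ i * m $ j)" for x i j
    by (simp add: g_def algebra_simps)
  have int: "integrable (gaussian m S) (\<lambda>x. (x $ i - v $ i) * (x $ j - v $ j))" for i j
    unfolding eq
    by (intro Bochner_Integration.integrable_add integrable_mult_right g(1)
        integrable_gaussian_nth[OF S] integrable_const)
  have integral: "(LINT x|gaussian m S. (x $ i - v $ i) * (x $ j - v $ j))
      = S $ i $ j + (m $ i - v $ i) * (m $ j - v $ j)" for i j
  proof -
    have "(LINT x|gaussian m S. (x $ i - v $ i) * (x $ j - v $ j))
        = (LINT x|gaussian m S. g i j x + (m $ j - v $ j) * (x $ i) + (m $ i - v $ i) * (x $ j)
          + (v $ i * v $ j - m $ i * m $ j))"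
      unfolding eq ..
    also have "\<dots> = S $ i $ j + (m $ j - v $ j) * m $ i + (m $ i - v $ i) * m $ j
        + (v $ i * v $ j - m $ i * m $ j)"
      by (simp add: g integrable_gaussian_nth[OF S] integral_gaussian_nth[OF S] prob_space[simplified])
    also have "\<dots> = S $ i $ j + (m $ i - v $ i) * (m $ j - v $ j)"
      by (simp add: algebra_simps)
    finally show ?thesis .
  qed
  show "integrable (gaussian m S) (\<lambda>x. (x - v) \<bullet> (M *v (x - v)))"
    unfolding quadratic_form_sum vector_minus_component
    by (intro Bochner_Integration.integrable_sum integrable_mult_right int)
  have "(LINT x|gaussian m S. (x - v) \<bullet> (M *v (x - v)))
      = (\<Sum>i\<in>UNIV. \<Sum>j\<in>UNIV. M $ i $ j * (S $ i $ j + (m $ i - v $ i) * (m $ j - v $ j)))"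
    unfolding quadratic_form_sum vector_minus_component
    by (subst Bochner_Integration.integral_sum,
        intro Bochner_Integration.integrable_sum integrable_mult_right int)+
      (simp add: integral)
  also have "\<dots> = M \<bullet> S + (m - v) \<bullet> (M *v (m - v))"
    unfolding quadratic_form_sum by (simp add: inner_vec_def distrib_left sum.distrib)
  finally show "(LINT x|gaussian m S. (x - v) \<bullet> (M *v (x - v))) = M \<bullet> S + (m - v) \<bullet> (M *v (m - v))" .
qed

lemma integrable_gaussian_norm_sq:
  assumes "sym_pos_def S"
  shows "integrable (gaussian m S) (\<lambda>x. (norm x)\<^sup>2)"
  using integrable_gaussian_quadratic_form[OF assms, of m 0 "mat 1"] by (simp add: power2_norm_eq_inner)

lemma integrable_gaussian_exp_norm_sq:
  fixes S :: "real^'n^'n"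
  assumes S: "sym_pos_def S"
  obtains e where "0 < e" "integrable (gaussian m S) (\<lambda>x. exp (e * (norm x)\<^sup>2))"
proof -
  define k where "k = norm S + 1"
  have k: "0 < k"
    unfolding k_def using norm_ge_zero[of S] by linarith
  \<comment> \<open>The square of a sum costs a factor 2 and the root of \<open>S\<close> a factor
    \<open>k\<close>, so \<open>1 / (8 * k)\<close> lands exactly on the exponent \<open>1/4\<close>
    available for the standard Gaussian.\<close>
  define e where "e = 1 / (8 * k)"
  have le: "e * (norm (m + mat_sqrt S *v x))\<^sup>2 \<le> 2 * e * (norm m)\<^sup>2 + (norm x)\<^sup>2 / 4" for x
  proof -
    let ?y = "mat_sqrt S *v x"
    have "(norm ?y)\<^sup>2 = x \<bullet> (S *v x)"
      using inner_matrix_vector_sym[OF sym_pos_def_sym[OF sym_pos_def_mat_sqrt[OF S]], of x ?y]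
      by (simp add: power2_norm_eq_inner matrix_vector_mul_assoc mat_sqrt_square[OF S])
    also have "\<dots> \<le> norm S * (norm x)\<^sup>2"
      using abs_quadratic_form_le[of x S] by linarith
    also have "\<dots> \<le> k * (norm x)\<^sup>2"
      by (intro mult_right_mono) (auto simp: k_def)
    finally have y: "(norm ?y)\<^sup>2 \<le> k * (norm x)\<^sup>2" .
    have "(norm (m + ?y))\<^sup>2 \<le> 2 * (norm m)\<^sup>2 + 2 * (k * (norm x)\<^sup>2)"
      using norm_add_sq_le[of m ?y] y by linarith
    then have "e * (norm (m + ?y))\<^sup>2 \<le> e * (2 * (norm m)\<^sup>2 + 2 * (k * (norm x)\<^sup>2))"
      using k by (intro mult_left_mono) (auto simp: e_def)
    also have "\<dots> = 2 * e * (norm m)\<^sup>2 + (norm x)\<^sup>2 / 4"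
      using k by (simp add: e_def field_simps)
    finally show ?thesis .
  qed
  have "integrable std_gaussian (\<lambda>x. exp (e * (norm (m + mat_sqrt S *v x))\<^sup>2))"
  proof (rule Bochner_Integration.integrable_bound)
    show "integrable (std_gaussian :: (real^'n) measure) (\<lambda>x. exp (2 * e * (norm m)\<^sup>2) * exp ((norm x)\<^sup>2 / 4))"
      by (intro integrable_mult_right integrable_std_gaussian_exp)
    show "AE x in std_gaussian. norm (exp (e * (norm (m + mat_sqrt S *v x))\<^sup>2))
        \<le> norm (exp (2 * e * (norm m)\<^sup>2) * exp ((norm x)\<^sup>2 / 4))"
      using le by (intro AE_I2) (simp add: exp_add[symmetric])
  qed simp
  then have "integrable (gaussian m S) (\<lambda>x. exp (e * (norm x)\<^sup>2))"
    by (subst integrable_gaussian_iff[OF S]) simp_all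
  moreover have "0 < e"
    using k by (simp add: e_def)
  ultimately show ?thesis
    using that by blast
qed

section \<open>Divergences, couplings and duality\<close>

text \<open>Fenchel-Young for the entropy, whose convex conjugate at \<open>- s\<close> is
  \<open>exp (- s) - 1\<close>. It is the bound \<open>ln y \<le> y - 1\<close> at
  \<open>y = exp (- s) / r\<close>, multiplied by \<open>r\<close>. At \<open>r = 0\<close> the
  product \<open>r * ln r\<close> is 0 and the claim is positivity of \<open>exp\<close>.\<close>

lemma entropy_fenchel:
  fixes r s :: real
  assumes "0 \<le> r"
  shows "1 - exp (- s) \<le> (r * ln r - r + 1) + r * s"
proof (cases "r = 0")
  case False
  with assms have r: "0 < r" by simp
  have "ln (exp (- s) / r) \<le> exp (- s) / r - 1"
    using r by (intro ln_le_minus_one) simp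
  then have "r * (- s - ln r) \<le> r * (exp (- s) / r - 1)"
    using r by (intro mult_left_mono) (simp_all add: ln_div)
  then show ?thesis
    using r by (simp add: algebra_simps)
qed simp

lemma entropy_nonneg:
  fixes r :: real
  assumes "0 \<le> r"
  shows "0 \<le> r * ln r - r + 1"
  using entropy_fenchel[OF assms, of 0] by simp

lemma KL_density:
  assumes N: "sigma_finite_measure N" and f [measurable]: "f \<in> borel_measurable N" and nonneg: "\<And>x. 0 \<le> f x"
  shows "KL (density N (\<lambda>x. ennreal (f x))) N = (\<integral>\<^sup>+x. ennreal (f x * ln (f x) - f x + 1) \<partial>N)"
proof -
  interpret sigma_finite_measure N by fact
  have "AE x in N. ennreal (f x) = RN_deriv N (density N (\<lambda>x. ennreal (f x))) x"
    by (rule RN_deriv_unique) simp_all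
  then have "AE x in N. enn2real (RN_deriv N (density N (\<lambda>x. ennreal (f x))) x) = f x"
    by eventually_elim (metis enn2real_ennreal nonneg)
  then have "(\<integral>\<^sup>+ x. (let r = enn2real (RN_deriv N (density N (\<lambda>x. ennreal (f x))) x) in ennreal (r * ln r - r + 1)) \<partial>N)
      = (\<integral>\<^sup>+x. ennreal (f x * ln (f x) - f x + 1) \<partial>N)"
    by (intro nn_integral_cong_AE) (auto simp: Let_def)
  moreover have "absolutely_continuous N (density N (\<lambda>x. ennreal (f x)))"
    by (rule absolutely_continuousI_density) simp
  ultimately show ?thesis
    by (simp add: KL_def)
qed

lemma scale_measure_eq_density: "scale_measure c M = density M (\<lambda>_. c)"
  by (rule measure_eqI) (simp_all add: emeasure_density_const)

lemma integral_scale_measure: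
  fixes f :: "'a \<Rightarrow> real"
  assumes "0 \<le> c" "f \<in> borel_measurable M"
  shows "(LINT x|scale_measure (ennreal c) M. f x) = c * (LINT x|M. f x)"
  unfolding scale_measure_eq_density using assms by (subst integral_density) simp_all

lemma integrable_scale_measure:
  fixes f :: "'a \<Rightarrow> real"
  assumes "0 \<le> c" "integrable M f"
  shows "integrable (scale_measure (ennreal c) M) f"
  unfolding scale_measure_eq_density using assms by (subst integrable_density) simp_all

lemma finite_measure_scale_measure:
  assumes "prob_space M"
  shows "finite_measure (scale_measure (ennreal c) M)"
proof
  interpret prob_space M by fact
  show "emeasure (scale_measure (ennreal c) M) (space (scale_measure (ennreal c) M)) \<noteq> \<infinity>"
    by (simp add: space_scale_measure emeasure_space_1)
qed

lemma KL_scale_measure: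
  assumes M: "prob_space M" and a: "0 < a" and c: "0 \<le> c"
  shows "KL (scale_measure (ennreal c) M) (scale_measure (ennreal a) M) = ennreal (c * ln (c / a) - c + a)"
proof -
  interpret M: prob_space M by fact
  interpret N: finite_measure "scale_measure (ennreal a) M"
    by (rule finite_measure_scale_measure[OF M])
  have "scale_measure (ennreal c) M = density (scale_measure (ennreal a) M) (\<lambda>_. ennreal (c / a))"
    unfolding scale_measure_eq_density using a c
    by (subst density_density_eq) (simp_all add: ennreal_mult'[symmetric])
  then have "KL (scale_measure (ennreal c) M) (scale_measure (ennreal a) M)
      = (\<integral>\<^sup>+x. ennreal (c / a * ln (c / a) - c / a + 1) \<partial>scale_measure (ennreal a) M)"
    using KL_density[of "scale_measure (ennreal a) M" "\<lambda>_. c / a"] a c N.sigma_finite_measure_axioms by simp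
  also have "\<dots> = ennreal a * ennreal (c / a * ln (c / a) - c / a + 1)"
    by (simp add: space_scale_measure M.emeasure_space_1 mult.commute)
  also have "\<dots> = ennreal (a * (c / a * ln (c / a) - c / a + 1))"
    using a by (simp add: ennreal_mult')
  also have "a * (c / a * ln (c / a) - c / a + 1) = c * ln (c / a) - c + a"
    using a by (simp add: field_simps)
  finally show ?thesis .
qed

text \<open>Writing the density as the exponential of a quadratic \<open>t\<close> turns the leading
  entropy term into \<open>exp (t x) * t x\<close>, that is, into the mean of \<open>t\<close> under
  \<open>gaussian u P\<close>.\<close>

lemma gaussian_eq_density_gaussian:
  fixes P S :: "real^'n^'n" and u m :: "real^'n"
  assumes P: "sym_pos_def P" and S: "sym_pos_def S"
  defines "t \<equiv> \<lambda>x. (ln (det S) - ln (det P)) / 2 - ((x - u) \<bullet> (matrix_inv P *v (x - u))) / 2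
      + ((x - m) \<bullet> (matrix_inv S *v (x - m))) / 2"
  shows "gaussian u P = density (gaussian m S) (\<lambda>x. ennreal (exp (t x)))"
proof -
  have [measurable]: "t \<in> borel_measurable borel"
    unfolding t_def by measurable
  have dP: "0 < det P" and dS: "0 < det S"
    using P S by (simp_all add: sym_pos_def_det_pos)
  have "ln (sqrt (det S / det P)) = (ln (det S) - ln (det P)) / 2"
    using dP dS by (simp add: ln_sqrt ln_div)
  moreover have "0 < sqrt (det S / det P)"
    using dP dS by simp
  ultimately have L: "exp ((ln (det S) - ln (det P)) / 2) = sqrt (det S / det P)"
    by (metis exp_ln)
  have "exp (- s / 2) / sqrt (k * det S) * exp ((ln (det S) - ln (det P)) / 2 - p / 2 + s / 2)
      = exp (- p / 2) / sqrt (k * det P)" for s p k :: real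
  proof -
    have "exp ((ln (det S) - ln (det P)) / 2 - p / 2 + s / 2) = sqrt (det S / det P) * exp (- p / 2) * exp (s / 2)"
      unfolding L[symmetric] by (simp add: exp_add[symmetric])
    then have "exp (- s / 2) / sqrt (k * det S) * exp ((ln (det S) - ln (det P)) / 2 - p / 2 + s / 2)
        = (exp (- s / 2) * exp (s / 2)) * (exp (- p / 2) * (sqrt (det S / det P) / sqrt (k * det S)))"
      by (simp only: times_divide_eq_left times_divide_eq_right mult_ac)
    also have "exp (- s / 2) * exp (s / 2) = 1"
      by (simp add: exp_add[symmetric])
    also have "sqrt (det S / det P) / sqrt (k * det S) = 1 / sqrt (k * det P)"
      using dP dS by (simp add: real_sqrt_mult real_sqrt_divide)
    finally show ?thesis by simp
  qed
  then have "exp (- ((x - m) \<bullet> (matrix_inv S *v (x - m))) / 2) / sqrt ((2 * pi) ^ CARD('n) * det S) * exp (t x)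
      = exp (- ((x - u) \<bullet> (matrix_inv P *v (x - u))) / 2) / sqrt ((2 * pi) ^ CARD('n) * det P)" for x
    unfolding t_def by blast
  then have "ennreal (exp (- ((x - m) \<bullet> (matrix_inv S *v (x - m))) / 2) / sqrt ((2 * pi) ^ CARD('n) * det S)) * ennreal (exp (t x))
      = ennreal (exp (- ((x - u) \<bullet> (matrix_inv P *v (x - u))) / 2) / sqrt ((2 * pi) ^ CARD('n) * det P))" for x
    by (metis ennreal_mult'' exp_ge_zero)
  note eq = this
  show ?thesis
    unfolding gaussian_def by (subst density_density_eq, measurable) (unfold eq, rule refl)
qed

text \<open>The pairing \<open>matrix_inv P \<bullet> P\<close> is the dimension. Left unevaluated
  it cancels in the limit against \<open>matrix_inv S \<bullet> P\<close>. The remaining entropy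
  terms \<open>- exp (t x) + 1\<close> integrate to zero because both measures have mass 1.\<close>

lemma KL_gaussian:
  fixes P S :: "real^'n^'n"
  assumes P: "sym_pos_def P" and S: "sym_pos_def S"
  shows "KL (gaussian u P) (gaussian m S) = ennreal ((ln (det S) - ln (det P)) / 2 - (matrix_inv P \<bullet> P) / 2
      + (matrix_inv S \<bullet> P + (u - m) \<bullet> (matrix_inv S *v (u - m))) / 2)"
proof -
  define t where "t = (\<lambda>x. (ln (det S) - ln (det P)) / 2 - ((x - u) \<bullet> (matrix_inv P *v (x - u))) / 2
      + ((x - m) \<bullet> (matrix_inv S *v (x - m))) / 2)"
  interpret P: prob_space "gaussian u P" by (rule prob_space_gaussian[OF P])
  interpret S: prob_space "gaussian m S" by (rule prob_space_gaussian[OF S])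
  have [measurable]: "t \<in> borel_measurable borel"
    unfolding t_def by measurable
  have dens: "gaussian u P = density (gaussian m S) (\<lambda>x. ennreal (exp (t x)))"
    unfolding t_def by (rule gaussian_eq_density_gaussian[OF P S])
  have it: "integrable (gaussian u P) t"
    unfolding t_def
    by (intro Bochner_Integration.integrable_add Bochner_Integration.integrable_diff integrable_divide
        P.integrable_const integrable_gaussian_quadratic_form[OF P])
  have It: "(LINT x|gaussian u P. t x) = (ln (det S) - ln (det P)) / 2 - (matrix_inv P \<bullet> P) / 2
      + (matrix_inv S \<bullet> P + (u - m) \<bullet> (matrix_inv S *v (u - m))) / 2"
    unfolding t_def
    by (simp add: integrable_gaussian_quadratic_form[OF P] integral_gaussian_quadratic_form[OF P]
        P.prob_space[simplified])
  have i1: "integrable (gaussian m S) (\<lambda>x. exp (t x) * t x)" "(LINT x|gaussian m S. exp (t x) * t x) = (LINT x|gaussian u P. t x)"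
    using it by (simp_all add: dens integrable_density integral_density)
  have "integrable (density (gaussian m S) (\<lambda>x. ennreal (exp (t x)))) (\<lambda>x. 1::real)
      = integrable (gaussian m S) (\<lambda>x. exp (t x) *\<^sub>R (1::real))"
    by (rule integrable_density) simp_all
  moreover have "(LINT x|density (gaussian m S) (\<lambda>x. ennreal (exp (t x))). 1::real)
      = (LINT x|gaussian m S. exp (t x) *\<^sub>R (1::real))"
    by (rule integral_density) simp_all
  ultimately have i2: "integrable (gaussian m S) (\<lambda>x. exp (t x))" "(LINT x|gaussian m S. exp (t x)) = 1"
    unfolding dens[symmetric] using P.prob_space by simp_all
  have "KL (gaussian u P) (gaussian m S) = (\<integral>\<^sup>+x. ennreal (exp (t x) * t x - exp (t x) + 1) \<partial>gaussian m S)"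
    unfolding dens using KL_density[OF S.sigma_finite_measure_axioms, of "\<lambda>x. exp (t x)"] by simp
  also have "\<dots> = ennreal (LINT x|gaussian m S. exp (t x) * t x - exp (t x) + 1)"
    using entropy_nonneg[of "exp (t _)"] i1 i2 by (intro nn_integral_eq_integral) auto
  also have "(LINT x|gaussian m S. exp (t x) * t x - exp (t x) + 1) = (LINT x|gaussian u P. t x)"
    using i1 i2 S.prob_space by simp
  finally show ?thesis
    unfolding It .
qed

lemma tendsto_KL_gaussian:
  fixes P :: "'a \<Rightarrow> real^'n^'n"
  assumes u: "(u \<longlongrightarrow> m) F" and P: "(P \<longlongrightarrow> S) F" and pos: "\<forall>\<^sub>F t in F. sym_pos_def (P t)" and S: "sym_pos_def S"
  shows "((\<lambda>t. enn2real (KL (gaussian (u t) (P t)) (gaussian m S))) \<longlongrightarrow> 0) F"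
proof -
  let ?f = "\<lambda>u P. (ln (det S) - ln (det P)) / 2 - (matrix_inv P \<bullet> P) / 2
      + (matrix_inv S \<bullet> P + (u - m) \<bullet> (matrix_inv S *v (u - m))) / 2"
  \<comment> \<open>The \<open>max 0\<close> reproduces the truncation in
    \<open>enn2real (ennreal _)\<close>, so the formula can be used whatever the sign of the real
    expression.\<close>
  have "((\<lambda>t. max 0 (?f (u t) (P t))) \<longlongrightarrow> max 0 (?f m S)) F"
    using sym_pos_def_det_pos[OF S] sym_pos_def_invertible[OF S]
    by (intro tendsto_intros u P) auto
  then have "((\<lambda>t. max 0 (?f (u t) (P t))) \<longlongrightarrow> 0) F"
    by simp
  moreover have "\<forall>\<^sub>F t in F. max 0 (?f (u t) (P t)) = enn2real (KL (gaussian (u t) (P t)) (gaussian m S))"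
    using pos by eventually_elim (auto simp: KL_gaussian[OF _ S] max_def enn2real_ennreal ennreal_neg)
  ultimately show ?thesis
    by (rule Lim_transform_eventually)
qed

section \<open>Couplings, the Wasserstein distance and the primal upper bound\<close>

lemma distr_pair_in_couplings:
  fixes f g :: "'a \<Rightarrow> real^'n"
  assumes M: "finite_measure M" and [measurable]: "f \<in> borel_measurable M" "g \<in> borel_measurable M"
  shows "distr M borel (\<lambda>x. (f x, g x)) \<in> couplings (distr M borel f) (distr M borel g)"
proof -
  have [measurable]: "(\<lambda>x. (f x, g x)) \<in> borel_measurable M"
    by (intro borel_measurable_Pair) simp_all
  have [measurable]: "fst \<in> borel_measurable (borel :: ((real^'n) \<times> (real^'n)) measure)"
      "snd \<in> borel_measurable (borel :: ((real^'n) \<times> (real^'n)) measure)"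
    by (intro borel_measurable_continuous_onI continuous_intros)+
  show ?thesis
    using finite_measure.finite_measure_distr[OF M, of "\<lambda>x. (f x, g x)" borel]
    by (simp add: couplings_def finite_borel_measures_def marginal0_def marginal1_def distr_distr comp_def)
qed

lemma transport_cost_distr_pair:
  fixes f g :: "'a \<Rightarrow> real^'n"
  assumes [measurable]: "f \<in> borel_measurable M" "g \<in> borel_measurable M"
  shows "transport_cost (distr M borel (\<lambda>x. (f x, g x))) = (\<integral>\<^sup>+x. ennreal ((norm (f x - g x))\<^sup>2) \<partial>M)"
proof -
  have [measurable]: "(\<lambda>x. (f x, g x)) \<in> borel_measurable M"
    by (intro borel_measurable_Pair) simp_all
  have [measurable]: "fst \<in> borel_measurable (borel :: ((real^'n) \<times> (real^'n)) measure)"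
      "snd \<in> borel_measurable (borel :: ((real^'n) \<times> (real^'n)) measure)"
    by (intro borel_measurable_continuous_onI continuous_intros)+
  show ?thesis
    unfolding transport_cost_def by (subst nn_integral_distr) simp_all
qed

lemma W2_sq: "(W2 M N)\<^sup>2 = enn2real (INF g \<in> couplings M N. transport_cost g)"
  by (simp add: W2_def)

text \<open>The joint law of \<open>f\<close> and \<open>g\<close> is one admissible coupling.
  Finiteness is recorded as well, since \<open>enn2real\<close> sends an infinite infimum to 0: it
  is what allows the infimum to be recovered from \<open>W2\<close>.\<close>

lemma W2_distr_le:
  fixes f g :: "'a \<Rightarrow> real^'n"
  assumes M: "finite_measure M" and [measurable]: "f \<in> borel_measurable M" "g \<in> borel_measurable M"
    and int: "integrable M (\<lambda>x. (norm (f x - g x))\<^sup>2)"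
  shows "(W2 (distr M borel f) (distr M borel g))\<^sup>2 \<le> (LINT x|M. (norm (f x - g x))\<^sup>2)"
    and "(INF h \<in> couplings (distr M borel f) (distr M borel g). transport_cost h) < \<infinity>"
proof -
  let ?I = "INF h \<in> couplings (distr M borel f) (distr M borel g). transport_cost h"
  have "?I \<le> transport_cost (distr M borel (\<lambda>x. (f x, g x)))"
    by (intro INF_lower distr_pair_in_couplings M) simp_all
  also have "\<dots> = ennreal (LINT x|M. (norm (f x - g x))\<^sup>2)"
    by (simp add: transport_cost_distr_pair nn_integral_eq_integral int)
  finally have le: "?I \<le> ennreal (LINT x|M. (norm (f x - g x))\<^sup>2)" .
  then show "?I < \<infinity>"
    by (simp add: le_less_trans)
  show "(W2 (distr M borel f) (distr M borel g))\<^sup>2 \<le> (LINT x|M. (norm (f x - g x))\<^sup>2)"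
    unfolding W2_sq using enn2real_mono[OF le] by simp
qed

lemma UOT_le:
  fixes M N :: "(real^'n) measure"
  assumes M: "prob_space M" "sets M = sets borel" and N: "prob_space N" "sets N = sets borel"
    and fin: "(INF h \<in> couplings M N. transport_cost h) < \<infinity>"
    and pos: "0 < a" "0 < b" "0 < t0" "0 < t1" "0 < c"
  shows "UOT t0 t1 (scale_measure (ennreal a) M) (scale_measure (ennreal b) N)
    \<le> ennreal (c * (W2 M N)\<^sup>2 + t0 * (c * ln (c / a) - c + a) + t1 * (c * ln (c / b) - c + b))"
    (is "?U \<le> _")
proof -
  let ?w = "(W2 M N)\<^sup>2"
  let ?k = "t0 * (c * ln (c / a) - c + a) + t1 * (c * ln (c / b) - c + b)"
  have e: "0 \<le> c * ln (c / a) - c + a" if "0 < a" for a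
  proof -
    have "0 \<le> a * (c / a * ln (c / a) - c / a + 1)"
      using that pos by (intro mult_nonneg_nonneg entropy_nonneg) auto
    also have "a * (c / a * ln (c / a) - c / a + 1) = c * ln (c / a) - c + a"
      using that by (simp add: field_simps)
    finally show ?thesis .
  qed
  have k: "0 \<le> ?k"
    using pos e[of a] e[of b] by simp
  have w: "(INF h \<in> couplings M N. transport_cost h) = ennreal ?w"
    unfolding W2_sq using fin by simp
  have "?U \<le> ennreal (c * ?w + ?k) + ennreal \<epsilon>" if "0 < \<epsilon>" for \<epsilon> :: real
  proof -
    \<comment> \<open>The infimum need not be known to be attained. The slack is
      \<open>\<epsilon> / c\<close> because scaling the coupling by \<open>c\<close> scales its
      cost, leaving an error of exactly \<open>\<epsilon>\<close>.\<close>
    have "(INF h \<in> couplings M N. transport_cost h) < ennreal (?w + \<epsilon> / c)"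
      unfolding w using that pos by (intro ennreal_lessI) (auto simp: add_nonneg_pos)
    then obtain g where g: "g \<in> couplings M N" "transport_cost g < ennreal (?w + \<epsilon> / c)"
      by (auto simp: INF_less_iff)
    have sg [measurable_cong]: "sets g = sets borel" and fg: "finite_measure g"
      and marg: "distr g borel fst = M" "distr g borel snd = N"
      using g(1) by (auto simp: couplings_def finite_borel_measures_def marginal0_def marginal1_def)
    have [measurable]: "fst \<in> borel_measurable (borel :: ((real^'n) \<times> (real^'n)) measure)"
        "snd \<in> borel_measurable (borel :: ((real^'n) \<times> (real^'n)) measure)"
      by (intro borel_measurable_continuous_onI continuous_intros)+
    interpret g: finite_measure g by fact
    let ?h = "scale_measure (ennreal c) g"
    have fh: "?h \<in> finite_borel_measures"
      unfolding finite_borel_measures_def using sg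
      by (auto intro!: finite_measureI simp: space_scale_measure ennreal_mult_eq_top_iff g.emeasure_finite)
    have "marginal0 ?h = scale_measure (ennreal c) M" "marginal1 ?h = scale_measure (ennreal c) N"
      unfolding marginal0_def marginal1_def marg[symmetric]
      by (auto intro!: measure_eqI simp: emeasure_distr space_scale_measure)
    moreover have "transport_cost ?h = ennreal c * transport_cost g"
      unfolding transport_cost_def by (rule nn_integral_scale_measure) measurable
    ultimately have "?U \<le> ennreal c * transport_cost g + ennreal t0 * ennreal (c * ln (c / a) - c + a)
        + ennreal t1 * ennreal (c * ln (c / b) - c + b)"
      unfolding UOT_def using pos
      by (intro INF_lower2[OF fh]) (simp add: KL_scale_measure[OF M(1)] KL_scale_measure[OF N(1)])
    also have "\<dots> \<le> ennreal c * ennreal (?w + \<epsilon> / c) + ennreal t0 * ennreal (c * ln (c / a) - c + a)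
        + ennreal t1 * ennreal (c * ln (c / b) - c + b)"
      using g(2) by (intro add_right_mono mult_left_mono) auto
    also have "\<dots> = ennreal (c * (?w + \<epsilon> / c)) + ennreal (t0 * (c * ln (c / a) - c + a))
        + ennreal (t1 * (c * ln (c / b) - c + b))"
      using pos that e[of a] e[of b] by (simp add: ennreal_mult)
    also have "\<dots> = ennreal (c * (?w + \<epsilon> / c) + t0 * (c * ln (c / a) - c + a) + t1 * (c * ln (c / b) - c + b))"
      using pos that e[of a] e[of b] by simp
    also have "c * (?w + \<epsilon> / c) + t0 * (c * ln (c / a) - c + a) + t1 * (c * ln (c / b) - c + b) = c * ?w + ?k + \<epsilon>"
      using pos by (simp add: distrib_left)
    also have "ennreal (c * ?w + ?k + \<epsilon>) = ennreal (c * ?w + ?k) + ennreal \<epsilon>"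
      using pos k that by (intro ennreal_plus) auto
    finally show ?thesis .
  qed
  then have "?U \<le> ennreal (c * ?w + ?k)"
    by (rule ennreal_le_epsilon)
  then show ?thesis
    by (simp only: add.assoc)
qed

section \<open>Weak duality\<close>

lemma KL_dual:
  fixes s :: "'a \<Rightarrow> real"
  assumes N: "finite_measure N" and R: "finite_measure R" "sets R = sets N"
    and k: "KL R N = ennreal k" "0 \<le> k"
    and s [measurable]: "s \<in> borel_measurable N" and int: "integrable N (\<lambda>x. exp \<bar>s x\<bar>)"
  shows "integrable R s" and "(LINT x|N. 1 - exp (- s x)) \<le> k + (LINT x|R. s x)"
proof -
  interpret N: finite_measure N by fact
  interpret R: finite_measure R by fact
  have ac: "absolutely_continuous N R"
    using k by (auto simp: KL_def split: if_splits)
  define r where "r = (\<lambda>x. enn2real (RN_deriv N R x))"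
  have r [measurable]: "r \<in> borel_measurable N"
    unfolding r_def by measurable
  have r0: "0 \<le> r x" for x by (simp add: r_def)
  have "AE x in N. RN_deriv N R x \<noteq> \<infinity>"
    by (rule N.RN_deriv_finite[OF R.sigma_finite_measure_axioms ac R(2)])
  then have "AE x in N. RN_deriv N R x = ennreal (r x)"
    by eventually_elim (simp add: r_def top.not_eq_extremum)
  then have "density N (RN_deriv N R) = density N (\<lambda>x. ennreal (r x))"
    by (intro density_cong) simp_all
  then have R_eq: "R = density N (\<lambda>x. ennreal (r x))"
    using N.density_RN_deriv[OF ac R(2)] by simp
  define h where "h = (\<lambda>x. r x * ln (r x) - r x + 1)"
  have [measurable]: "h \<in> borel_measurable N"
    unfolding h_def by measurable
  have h0: "0 \<le> h x" for x
    unfolding h_def by (rule entropy_nonneg[OF r0])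
  have hk: "(\<integral>\<^sup>+x. ennreal (h x) \<partial>N) = ennreal k"
    using k ac by (simp add: KL_def Let_def r_def h_def)
  have ih: "integrable N h"
    by (rule integrableI_nonneg) (simp_all add: h0 hk)
  have Ih: "(LINT x|N. h x) = k"
    using hk k(2) h0 by (simp add: integral_eq_nn_integral)
  have irs: "integrable N (\<lambda>x. r x * s x)"
  proof (rule Bochner_Integration.integrable_bound)
    show "integrable N (\<lambda>x. h x + exp \<bar>s x\<bar>)"
      by (intro Bochner_Integration.integrable_add ih int)
    \<comment> \<open>Integrability against \<open>R\<close> has to be earned before anything is
      integrated: Fenchel's inequality at \<open>- \<bar>s x\<bar>\<close> bounds
      \<open>r x * \<bar>s x\<bar>\<close> by the entropy plus an exponential. This is why the
      assumption concerns \<open>exp \<bar>s x\<bar>\<close>.\<close>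
    have "\<bar>r x * s x\<bar> \<le> h x + exp \<bar>s x\<bar>" for x
      using entropy_fenchel[OF r0, of "- \<bar>s x\<bar>" x] r0[of x] by (simp add: h_def abs_mult)
    then show "AE x in N. norm (r x * s x) \<le> norm (h x + exp \<bar>s x\<bar>)"
      by (intro AE_I2) (smt (verit) real_norm_def)
  qed simp
  show "integrable R s"
    unfolding R_eq using irs by (subst integrable_density) (simp_all add: r0)
  have Is: "(LINT x|R. s x) = (LINT x|N. r x * s x)"
    unfolding R_eq by (subst integral_density) (simp_all add: r0)
  have ie: "integrable N (\<lambda>x. exp (- s x))"
    by (rule Bochner_Integration.integrable_bound[OF int]) (auto intro!: AE_I2)
  have "(LINT x|N. 1 - exp (- s x)) \<le> (LINT x|N. h x + r x * s x)"
  proof (rule integral_mono)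
    show "integrable N (\<lambda>x. 1 - exp (- s x))"
      by (intro Bochner_Integration.integrable_diff N.integrable_const ie)
    show "integrable N (\<lambda>x. h x + r x * s x)"
      by (intro Bochner_Integration.integrable_add ih irs)
    show "1 - exp (- s x) \<le> h x + r x * s x" for x
      unfolding h_def by (rule entropy_fenchel[OF r0])
  qed
  also have "\<dots> = k + (LINT x|R. s x)"
    by (simp add: ih irs Ih Is)
  finally show "(LINT x|N. 1 - exp (- s x)) \<le> k + (LINT x|R. s x)" .
qed

text \<open>Apply \<open>KL_dual\<close> to \<open>\<phi> / t0\<close> and
  \<open>\<psi> / t1\<close>, multiply by \<open>t0\<close> and \<open>t1\<close>, and absorb the
  resulting marginal integrals into the cost through the pointwise constraint integrated against the
  plan. Plans of infinite value are split off first, so that all remaining quantities are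
  real.\<close>

lemma UOT_ge:
  fixes A B :: "(real^'n) measure" and \<phi> \<psi> :: "real^'n \<Rightarrow> real"
  assumes A: "finite_measure A" "sets A = sets borel" and B: "finite_measure B" "sets B = sets borel"
    and meas [measurable]: "\<phi> \<in> borel_measurable borel" "\<psi> \<in> borel_measurable borel"
    and le: "\<And>x y. \<phi> x + \<psi> y \<le> (norm (x - y))\<^sup>2"
    and pos: "0 < t0" "0 < t1"
    and int: "integrable A (\<lambda>x. exp \<bar>\<phi> x / t0\<bar>)" "integrable B (\<lambda>x. exp \<bar>\<psi> x / t1\<bar>)"
  shows "ennreal (t0 * (LINT x|A. 1 - exp (- (\<phi> x / t0))) + t1 * (LINT x|B. 1 - exp (- (\<psi> x / t1))))
    \<le> UOT t0 t1 A B"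
  unfolding UOT_def
proof (rule INF_greatest)
  let ?D = "t0 * (LINT x|A. 1 - exp (- (\<phi> x / t0))) + t1 * (LINT x|B. 1 - exp (- (\<psi> x / t1)))"
  fix g :: "((real^'n) \<times> (real^'n)) measure" assume "g \<in> finite_borel_measures"
  then have sg [measurable_cong]: "sets g = sets borel" and "finite_measure g"
    by (auto simp: finite_borel_measures_def)
  interpret g: finite_measure g by fact
  let ?V = "transport_cost g + ennreal t0 * KL (marginal0 g) A + ennreal t1 * KL (marginal1 g) B"
  have [measurable]: "fst \<in> borel_measurable (borel :: ((real^'n) \<times> (real^'n)) measure)"
      "snd \<in> borel_measurable (borel :: ((real^'n) \<times> (real^'n)) measure)"
    by (intro borel_measurable_continuous_onI continuous_intros)+
  show "ennreal ?D \<le> ?V"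
  proof (cases "?V = \<infinity>")
    case True
    show ?thesis
      unfolding True by simp
  next
    case False
    have finite: "transport_cost g \<noteq> \<infinity>" "KL (marginal0 g) A \<noteq> \<infinity>" "KL (marginal1 g) B \<noteq> \<infinity>"
      using False pos by (auto simp: ennreal_mult_eq_top_iff)
    define k0 where "k0 = enn2real (KL (marginal0 g) A)"
    define k1 where "k1 = enn2real (KL (marginal1 g) B)"
    define T where "T = enn2real (transport_cost g)"
    have k: "KL (marginal0 g) A = ennreal k0" "0 \<le> k0" "KL (marginal1 g) B = ennreal k1" "0 \<le> k1"
      and T: "transport_cost g = ennreal T" "0 \<le> T"
      using finite by (simp_all add: k0_def k1_def T_def top.not_eq_extremum)
    have m0: "finite_measure (marginal0 g)" "sets (marginal0 g) = sets A"
      and m1: "finite_measure (marginal1 g)" "sets (marginal1 g) = sets B"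
      using A(2) B(2) by (simp_all add: marginal0_def marginal1_def g.finite_measure_distr)
    have mA: "(\<lambda>x. \<phi> x / t0) \<in> borel_measurable A" and mB: "(\<lambda>x. \<psi> x / t1) \<in> borel_measurable B"
      using A(2) B(2) by (auto cong: measurable_cong_sets)
    note d0 = KL_dual[OF A(1) m0 k(1,2) mA int(1)]
    note d1 = KL_dual[OF B(1) m1 k(3,4) mB int(2)]
    have i0: "integrable (marginal0 g) \<phi>" and i1: "integrable (marginal1 g) \<psi>"
      using integrable_mult_right[OF d0(1), of t0] integrable_mult_right[OF d1(1), of t1] pos by simp_all
    have j0: "integrable g (\<lambda>z. \<phi> (fst z))" and j1: "integrable g (\<lambda>z. \<psi> (snd z))"
      using i0 i1 unfolding marginal0_def marginal1_def by (simp_all add: integrable_distr_eq)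
    have J0: "(LINT x|marginal0 g. \<phi> x) = (LINT z|g. \<phi> (fst z))"
      and J1: "(LINT x|marginal1 g. \<psi> x) = (LINT z|g. \<psi> (snd z))"
      unfolding marginal0_def marginal1_def by (simp_all add: integral_distr)
    have jc: "integrable g (\<lambda>z. (norm (fst z - snd z))\<^sup>2)"
      using T by (intro integrableI_nonneg) (auto simp: transport_cost_def)
    have Jc: "(LINT z|g. (norm (fst z - snd z))\<^sup>2) = T"
      using T by (subst integral_eq_nn_integral) (auto simp: transport_cost_def)
    have "(LINT z|g. \<phi> (fst z)) + (LINT z|g. \<psi> (snd z)) = (LINT z|g. \<phi> (fst z) + \<psi> (snd z))"
      using j0 j1 by simp
    also have "\<dots> \<le> T"
      unfolding Jc[symmetric] by (intro integral_mono Bochner_Integration.integrable_add j0 j1 jc le)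
    finally have cost: "(LINT x|marginal0 g. \<phi> x) + (LINT x|marginal1 g. \<psi> x) \<le> T"
      unfolding J0 J1 .
    have "t0 * (LINT x|A. 1 - exp (- (\<phi> x / t0))) \<le> t0 * (k0 + (LINT x|marginal0 g. \<phi> x / t0))"
      using d0(2) pos by (intro mult_left_mono) auto
    moreover have "t1 * (LINT x|B. 1 - exp (- (\<psi> x / t1))) \<le> t1 * (k1 + (LINT x|marginal1 g. \<psi> x / t1))"
      using d1(2) pos by (intro mult_left_mono) auto
    ultimately have "?D \<le> T + t0 * k0 + t1 * k1"
      using cost pos by (simp add: distrib_left)
    then have "ennreal ?D \<le> ennreal (T + t0 * k0 + t1 * k1)"
      by (rule ennreal_leI)
    also have "\<dots> = ?V"
      using k T pos by (simp add: ennreal_mult)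
    finally show ?thesis .
  qed
qed

text \<open>With \<open>h = 1 / t\<close> this is the difference quotient at 0 of
  \<open>1 - exp (- (y * h))\<close>.\<close>

lemma tendsto_scaled_exp:
  fixes y :: real
  shows "((\<lambda>t. t * (1 - exp (- (y / t)))) \<longlongrightarrow> y) at_top"
proof -
  have "((\<lambda>h. 1 - exp (- (y * h))) has_field_derivative y) (at 0)"
    by (auto intro!: derivative_eq_intros)
  then have "((\<lambda>h. (1 - exp (- (y * h))) / h) \<longlongrightarrow> y) (at 0)"
    by (simp add: DERIV_def)
  moreover have "filterlim (\<lambda>t::real. inverse t) (at 0) at_top"
    by (rule filterlim_mono[OF filterlim_inverse_at_right_top at_le order_refl]) simp
  ultimately have "((\<lambda>t. (1 - exp (- (y * inverse t))) / inverse t) \<longlongrightarrow> y) at_top"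
    by (rule filterlim_compose)
  then show ?thesis
    by (simp add: field_simps)
qed

text \<open>A dominating function uniform in \<open>t \<ge> t1\<close>. It combines the mean value
  type bound by \<open>\<bar>z\<bar> * exp \<bar>z\<bar>\<close> with
  \<open>\<bar>y\<bar> \<le> t1 * exp (\<bar>y\<bar> / t1)\<close>; the two exponentials account for
  the constant \<open>2 / t1\<close>.\<close>

lemma abs_scaled_exp_le:
  fixes y t t1 :: real
  assumes "0 < t1" "t1 \<le> t"
  shows "\<bar>t * (1 - exp (- (y / t)))\<bar> \<le> t1 * exp (2 / t1 * \<bar>y\<bar>)"
proof -
  have t: "0 < t" using assms by simp
  have le: "\<bar>1 - exp (- z)\<bar> \<le> \<bar>z\<bar> * exp \<bar>z\<bar>" for z :: real
  proof (cases "0 \<le> z")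
    case True
    have "1 - exp (- z) \<le> z"
      using exp_ge_add_one_self[of "- z"] by linarith
    also have "\<dots> \<le> z * exp z"
      using mult_left_mono[of 1 "exp z" z] True by simp
    finally show ?thesis using True by simp
  next
    case False
    have "exp (- z) * (1 + z) \<le> exp (- z) * exp z"
      by (intro mult_left_mono exp_ge_add_one_self) simp
    then have "exp (- z) - 1 \<le> (- z) * exp (- z)"
      by (simp add: exp_minus algebra_simps)
    then show ?thesis using False by simp
  qed
  have "\<bar>t * (1 - exp (- (y / t)))\<bar> \<le> t * (\<bar>y / t\<bar> * exp \<bar>y / t\<bar>)"
    unfolding abs_mult abs_of_pos[OF t] using t by (intro mult_left_mono le) simp
  also have "\<dots> = \<bar>y\<bar> * exp (\<bar>y\<bar> / t)"
    using t by simp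
  also have "\<dots> \<le> (t1 * exp (\<bar>y\<bar> / t1)) * exp (\<bar>y\<bar> / t1)"
  proof (intro mult_mono)
    have "\<bar>y\<bar> / t1 \<le> exp (\<bar>y\<bar> / t1)"
      using exp_ge_add_one_self[of "\<bar>y\<bar> / t1"] by linarith
    then show "\<bar>y\<bar> \<le> t1 * exp (\<bar>y\<bar> / t1)"
      using assms by (simp add: field_simps)
    show "exp (\<bar>y\<bar> / t) \<le> exp (\<bar>y\<bar> / t1)"
      using assms t by (simp add: frac_le)
  qed (use assms in auto)
  also have "\<dots> = t1 * exp (2 / t1 * \<bar>y\<bar>)"
    by (simp add: exp_add[symmetric] mult.assoc)
  finally show ?thesis .
qed

lemma tendsto_scaled_exp_integral:
  fixes f :: "'a \<Rightarrow> real"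
  assumes [measurable]: "f \<in> borel_measurable M" and c: "0 < c" and int: "integrable M (\<lambda>x. exp (c * \<bar>f x\<bar>))"
  shows "((\<lambda>t. t * (LINT x|M. 1 - exp (- (f x / t)))) \<longlongrightarrow> (LINT x|M. f x)) at_top"
proof -
  \<comment> \<open>This choice makes the exponent \<open>2 / t1\<close> of the dominating function
    equal to the integrable \<open>c\<close>.\<close>
  define t1 where "t1 = 2 / c"
  have t1: "0 < t1" "2 / t1 = c"
    using c by (simp_all add: t1_def)
  have "((\<lambda>t. LINT x|M. t * (1 - exp (- (f x / t)))) \<longlongrightarrow> (LINT x|M. f x)) at_top"
  proof (rule integral_dominated_convergence_at_top)
    show "integrable M (\<lambda>x. t1 * exp (c * \<bar>f x\<bar>))"
      by (intro integrable_mult_right int)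
    show "AE x in M. ((\<lambda>t. t * (1 - exp (- (f x / t)))) \<longlongrightarrow> f x) at_top"
      by (intro AE_I2 tendsto_scaled_exp)
    show "\<forall>\<^sub>F t in at_top. AE x in M. norm (t * (1 - exp (- (f x / t)))) \<le> t1 * exp (c * \<bar>f x\<bar>)"
      using eventually_ge_at_top[of t1]
      by eventually_elim (use abs_scaled_exp_le[OF t1(1)] t1(2) in auto)
  qed simp_all
  then show ?thesis by simp
qed

section \<open>Convergence of the Gaussian parameters\<close>

text \<open>The linear part of the optimal map between centred Gaussian measures with covariances
  \<open>S0\<close> and \<open>S1\<close>; it is the limit of \<^const>\<open>L_star\<close>.\<close>

definition optimal_matrix :: "real^'n^'n \<Rightarrow> real^'n^'n \<Rightarrow> real^'n^'n" where
  "optimal_matrix S0 S1 = (let R = mat_sqrt (matrix_inv S1)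
     in matrix_inv R ** mat_sqrt (R ** matrix_inv S0 ** R) ** matrix_inv R)"

lemma optimal_matrix:
  fixes S0 S1 :: "real^'n^'n"
  assumes S0: "sym_pos_def S0" and S1: "sym_pos_def S1"
  shows sym_pos_def_optimal_matrix: "sym_pos_def (optimal_matrix S0 S1)"
    and optimal_matrix_congruence: "optimal_matrix S0 S1 ** S0 ** optimal_matrix S0 S1 = S1"
proof -
  define R where "R = mat_sqrt (matrix_inv S1)"
  define X where "X = mat_sqrt (R ** matrix_inv S0 ** R)"
  define L where "L = optimal_matrix S0 S1"
  have L: "L = matrix_inv R ** X ** matrix_inv R"
    by (simp add: L_def optimal_matrix_def Let_def R_def X_def)
  note A0 = sym_pos_def_matrix_inv[OF S0] and A1 = sym_pos_def_matrix_inv[OF S1]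
  have R: "sym_pos_def R" "R ** R = matrix_inv S1"
    using sym_pos_def_mat_sqrt[OF A1] mat_sqrt_square[OF A1] by (simp_all add: R_def)
  have RAR: "sym_pos_def (R ** matrix_inv S0 ** R)"
    by (rule sym_pos_def_congruence_sym[OF A0 R(1)])
  have X: "sym_pos_def X" "X ** X = R ** matrix_inv S0 ** R"
    using sym_pos_def_mat_sqrt[OF RAR] mat_sqrt_square[OF RAR] by (simp_all add: X_def)
  note invR = sym_pos_def_invertible[OF R(1)]
  note Ri = matrix_inv_left[OF invR] matrix_inv_right[OF invR]
  have "sym_pos_def L"
    unfolding L by (rule sym_pos_def_congruence_sym[OF X(1) sym_pos_def_matrix_inv[OF R(1)]])
  then show "sym_pos_def (optimal_matrix S0 S1)"
    by (simp add: L_def)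
  \<comment> \<open>The computation yields the Riccati equation for the inverse covariances.
    Multiplying by \<open>S0\<close> exhibits a right inverse of \<open>L\<close>; for square
    matrices it is also a left inverse, which moves \<open>L\<close> to the other end and gives the
    congruence for the covariances themselves.\<close>
  have "L ** matrix_inv S1 ** L
      = matrix_inv R ** X ** (matrix_inv R ** R) ** (R ** matrix_inv R) ** X ** matrix_inv R"
    by (simp only: L R(2)[symmetric] matrix_mul_assoc)
  also have "\<dots> = matrix_inv R ** (X ** X) ** matrix_inv R"
    by (simp add: Ri matrix_mul_assoc)
  also have "\<dots> = (matrix_inv R ** R) ** matrix_inv S0 ** (R ** matrix_inv R)"
    by (simp only: X(2) matrix_mul_assoc)
  also have "\<dots> = matrix_inv S0"
    by (simp add: Ri)
  finally have "L ** (matrix_inv S1 ** L ** S0) = mat 1"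
    by (simp add: matrix_mul_assoc matrix_inv_left[OF sym_pos_def_invertible[OF S0]])
  then have "matrix_inv S1 ** L ** S0 ** L = mat 1"
    by (simp add: matrix_left_right_inverse)
  then have "S1 ** (matrix_inv S1 ** L ** S0 ** L) = S1"
    by simp
  then have "L ** S0 ** L = S1"
    by (simp add: matrix_mul_assoc matrix_inv_right[OF sym_pos_def_invertible[OF S1]])
  then show "optimal_matrix S0 S1 ** S0 ** optimal_matrix S0 S1 = S1"
    by (simp add: L_def)
qed

section \<open>Limits of the covariance and mean parameters\<close>

lemma sym_pos_def_C_mat:
  assumes "0 < t" "sym_pos_def S"
  shows "sym_pos_def (C_mat t S)"
  unfolding C_mat_def using assms
  by (intro sym_pos_def_add sym_pos_def_scaleR sym_pos_def_matrix_inv sym_pos_def_mat_1) simp_all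

lemma tendsto_C_mat:
  assumes "((\<lambda>l. 2 / t l) \<longlongrightarrow> 0) F"
  shows "((\<lambda>l. C_mat (t l) S) \<longlongrightarrow> matrix_inv S) F"
proof -
  have "((\<lambda>l. C_mat (t l) S) \<longlongrightarrow> matrix_inv S + 0 *\<^sub>R mat 1) F"
    unfolding C_mat_def by (intro tendsto_intros assms)
  then show ?thesis by simp
qed

lemma sym_pos_def_S_star_radicand:
  fixes S0 S1 :: "real^'n^'n"
  assumes S0: "sym_pos_def S0" and S1: "sym_pos_def S1" and t: "0 < t" "0 < t'"
  shows "sym_pos_def ((k::real)\<^sup>2 *\<^sub>R mat 1 + 4 *\<^sub>R (mat_sqrt (C_mat t' S1) ** C_mat t S0 ** mat_sqrt (C_mat t' S1)))"
  using assms
  by (intro sym_pos_def_add_nonneg sym_pos_def_scaleR sym_pos_def_congruence_sym sym_pos_def_mat_sqrt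
      sym_pos_def_C_mat) simp_all

text \<open>Convergence alone cannot give symmetry, which \<open>eventually_sym_pos_def\<close>
  requires along the filter; it is read off from the palindromic form of
  \<open>L_star\<close>.\<close>

lemma L_star_symmetric:
  fixes S0 S1 :: "real^'n^'n"
  assumes S0: "sym_pos_def S0" and S1: "sym_pos_def S1" and t: "0 < t" "0 < t'"
  shows "transpose (L_star t t' S0 S1) = L_star t t' S0 S1"
proof -
  note C = sym_pos_def_mat_sqrt[OF sym_pos_def_C_mat[OF t(2) S1]]
  have "transpose (matrix_inv (mat_sqrt (C_mat t' S1))) = matrix_inv (mat_sqrt (C_mat t' S1))"
    by (rule sym_pos_def_sym[OF sym_pos_def_matrix_inv[OF C]])
  moreover have "transpose (S_star t t' S0 S1) = S_star t t' S0 S1"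
    unfolding S_star_def Let_def
    by (simp add: transpose_scalar transpose_add
        sym_pos_def_sym[OF sym_pos_def_mat_sqrt[OF sym_pos_def_S_star_radicand[OF assms]]])
  ultimately show ?thesis
    by (simp add: L_star_def Let_def matrix_transpose_mul matrix_mul_assoc)
qed

context
  fixes S0 S1 :: "real^'n^'n" and m0 m1 :: "real^'n" and t0 t1 :: "'a \<Rightarrow> real" and F :: "'a filter"
  assumes S0: "sym_pos_def S0" and S1: "sym_pos_def S1"
    and pos: "\<forall>\<^sub>F l in F. 0 < t0 l" "\<forall>\<^sub>F l in F. 0 < t1 l"
    and r0: "((\<lambda>l. 2 / t0 l) \<longlongrightarrow> 0) F" and r1: "((\<lambda>l. 2 / t1 l) \<longlongrightarrow> 0) F"
begin

text \<open>As \<open>2 / t1 l - 2 / t0 l\<close> vanishes, the radicand tends to four times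
  \<open>R ** matrix_inv S0 ** R\<close>, and its root \<open>2 *\<^sub>R X\<close> meets the factor
  \<open>1 / 2\<close> in \<open>S_star\<close>. The vanishing coefficient is kept as
  \<open>0 - 0\<close> to match the form produced by the limit rules.\<close>

lemma tendsto_L_star: "((\<lambda>l. L_star (t0 l) (t1 l) S0 S1) \<longlongrightarrow> optimal_matrix S0 S1) F"
proof -
  define R where "R = mat_sqrt (matrix_inv S1)"
  define X where "X = mat_sqrt (R ** matrix_inv S0 ** R)"
  note A0 = sym_pos_def_matrix_inv[OF S0] and A1 = sym_pos_def_matrix_inv[OF S1]
  have R: "sym_pos_def R"
    using sym_pos_def_mat_sqrt[OF A1] by (simp_all add: R_def)
  have RAR: "sym_pos_def (R ** matrix_inv S0 ** R)"
    by (rule sym_pos_def_congruence_sym[OF A0 R])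
  have sqrtC: "((\<lambda>l. mat_sqrt (C_mat (t1 l) S1)) \<longlongrightarrow> R) F"
    unfolding R_def using pos(2)
    by (intro tendsto_mat_sqrt tendsto_C_mat r1 A1) (auto elim!: eventually_mono intro: sym_pos_def_C_mat S1)
  have k: "((\<lambda>l. 2 / t1 l - 2 / t0 l) \<longlongrightarrow> 0 - 0) F"
    by (intro tendsto_intros r0 r1)
  have X2: "mat_sqrt ((0 - 0)\<^sup>2 *\<^sub>R mat 1 + 4 *\<^sub>R (R ** matrix_inv S0 ** R)) = 2 *\<^sub>R X"
  proof (rule mat_sqrt_eqI)
    show "sym_pos_def (2 *\<^sub>R X)"
      unfolding X_def by (intro sym_pos_def_scaleR sym_pos_def_mat_sqrt RAR) simp
    have "X ** X = R ** matrix_inv S0 ** R"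
      unfolding X_def by (rule mat_sqrt_square[OF RAR])
    then show "2 *\<^sub>R X ** 2 *\<^sub>R X = (0 - 0)\<^sup>2 *\<^sub>R mat 1 + 4 *\<^sub>R (R ** matrix_inv S0 ** R)"
      by (simp add: matrix_scalar_ac scalar_matrix_assoc[symmetric])
  qed
  have "((\<lambda>l. mat_sqrt ((2 / t1 l - 2 / t0 l)\<^sup>2 *\<^sub>R mat 1
        + 4 *\<^sub>R (mat_sqrt (C_mat (t1 l) S1) ** C_mat (t0 l) S0 ** mat_sqrt (C_mat (t1 l) S1)))) \<longlongrightarrow> 2 *\<^sub>R X) F"
    unfolding X2[symmetric]
  proof (rule tendsto_mat_sqrt)
    show "((\<lambda>l. (2 / t1 l - 2 / t0 l)\<^sup>2 *\<^sub>R mat 1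
        + 4 *\<^sub>R (mat_sqrt (C_mat (t1 l) S1) ** C_mat (t0 l) S0 ** mat_sqrt (C_mat (t1 l) S1)))
      \<longlongrightarrow> (0 - 0)\<^sup>2 *\<^sub>R mat 1 + 4 *\<^sub>R (R ** matrix_inv S0 ** R)) F"
      by (intro tendsto_add tendsto_scaleR tendsto_power tendsto_const tendsto_matrix_matrix_mult sqrtC k tendsto_C_mat r0)
    show "\<forall>\<^sub>F l in F. sym_pos_def ((2 / t1 l - 2 / t0 l)\<^sup>2 *\<^sub>R mat 1
        + 4 *\<^sub>R (mat_sqrt (C_mat (t1 l) S1) ** C_mat (t0 l) S0 ** mat_sqrt (C_mat (t1 l) S1)))"
      using pos by eventually_elim (rule sym_pos_def_S_star_radicand[OF S0 S1])
    show "sym_pos_def ((0 - 0 :: real)\<^sup>2 *\<^sub>R mat 1 + 4 *\<^sub>R (R ** matrix_inv S0 ** R))"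
      using sym_pos_def_scaleR[OF _ RAR, of 4] by simp
  qed
  then have "((\<lambda>l. S_star (t0 l) (t1 l) S0 S1) \<longlongrightarrow> (1/2) *\<^sub>R ((0 - 0) *\<^sub>R mat 1 + 2 *\<^sub>R X)) F"
    unfolding S_star_def Let_def
    by (intro tendsto_add tendsto_scaleR tendsto_const k)
  then have S: "((\<lambda>l. S_star (t0 l) (t1 l) S0 S1) \<longlongrightarrow> X) F"
    by simp
  show ?thesis
    unfolding L_star_def optimal_matrix_def Let_def R_def[symmetric] X_def[symmetric]
    by (intro tendsto_matrix_matrix_mult tendsto_matrix_inv sqrtC S sym_pos_def_invertible R)
qed

lemma tendsto_P_star: "((\<lambda>l. P_star (t0 l) (t1 l) S0 S1) \<longlongrightarrow> S0) F"
  and eventually_sym_pos_def_P_star: "\<forall>\<^sub>F l in F. sym_pos_def (P_star (t0 l) (t1 l) S0 S1)"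
proof -
  note A0 = sym_pos_def_matrix_inv[OF S0]
  let ?M = "\<lambda>l. matrix_inv S0 + (2 / t0 l) *\<^sub>R (mat 1 - L_star (t0 l) (t1 l) S0 S1)"
  have "(?M \<longlongrightarrow> matrix_inv S0 + 0 *\<^sub>R (mat 1 - optimal_matrix S0 S1)) F"
    by (intro tendsto_add tendsto_diff tendsto_scaleR tendsto_const r0 tendsto_L_star)
  then have M: "(?M \<longlongrightarrow> matrix_inv S0) F"
    by simp
  have "((\<lambda>l. P_star (t0 l) (t1 l) S0 S1) \<longlongrightarrow> matrix_inv (matrix_inv S0)) F"
    unfolding P_star_def by (intro tendsto_matrix_inv M sym_pos_def_invertible A0)
  moreover have "matrix_inv (matrix_inv S0) = S0"
    by (rule matrix_inv_eqI) (rule matrix_inv_left[OF sym_pos_def_invertible[OF S0]])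
  ultimately show "((\<lambda>l. P_star (t0 l) (t1 l) S0 S1) \<longlongrightarrow> S0) F"
    by simp
  have "\<forall>\<^sub>F l in F. transpose (?M l) = ?M l"
    using pos by eventually_elim
      (simp add: transpose_add transpose_scalar transpose_diff L_star_symmetric[OF S0 S1] sym_pos_def_sym[OF A0])
  then have "\<forall>\<^sub>F l in F. sym_pos_def (?M l)"
    by (rule eventually_sym_pos_def[OF M _ A0])
  then show "\<forall>\<^sub>F l in F. sym_pos_def (P_star (t0 l) (t1 l) S0 S1)"
    unfolding P_star_def by eventually_elim (rule sym_pos_def_matrix_inv)
qed

text \<open>Termwise the limit is the congruence of \<open>S0\<close> by the optimal matrix, and
  this matrix was built to carry \<open>S0\<close> to \<open>S1\<close>.\<close>

lemma tendsto_Q_star: "((\<lambda>l. Q_star (t0 l) (t1 l) S0 S1) \<longlongrightarrow> S1) F"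
  unfolding Q_star_def
  by (subst optimal_matrix_congruence[OF S0 S1, symmetric])
    (intro tendsto_matrix_matrix_mult tendsto_L_star tendsto_P_star)

lemma eventually_sym_pos_def_Q_star: "\<forall>\<^sub>F l in F. sym_pos_def (Q_star (t0 l) (t1 l) S0 S1)"
proof -
  have "\<forall>\<^sub>F l in F. transpose (L_star (t0 l) (t1 l) S0 S1) = L_star (t0 l) (t1 l) S0 S1"
    using pos by eventually_elim (rule L_star_symmetric[OF S0 S1])
  then have "\<forall>\<^sub>F l in F. sym_pos_def (L_star (t0 l) (t1 l) S0 S1)"
    by (rule eventually_sym_pos_def[OF tendsto_L_star _ sym_pos_def_optimal_matrix[OF S0 S1]])
  with eventually_sym_pos_def_P_star show ?thesis
    unfolding Q_star_def by eventually_elim (rule sym_pos_def_congruence_sym)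
qed

lemma tendsto_h_star: "((\<lambda>l. h_star (t0 l) (t1 l) m0 m1 S0 S1) \<longlongrightarrow> m0 - m1) F"
proof -
  have "((\<lambda>l. mat 1 + (2 / t0 l) *\<^sub>R S0 + (2 / t1 l) *\<^sub>R S1) \<longlongrightarrow> mat 1 + 0 *\<^sub>R S0 + 0 *\<^sub>R S1) F"
    by (intro tendsto_add tendsto_scaleR tendsto_const r0 r1)
  then have "((\<lambda>l. mat 1 + (2 / t0 l) *\<^sub>R S0 + (2 / t1 l) *\<^sub>R S1) \<longlongrightarrow> mat 1) F"
    by simp
  then have "((\<lambda>l. h_star (t0 l) (t1 l) m0 m1 S0 S1) \<longlongrightarrow> matrix_inv (mat 1) *v (m0 - m1)) F"
    unfolding h_star_def
    by (intro tendsto_matrix_vector_mult tendsto_matrix_inv tendsto_const sym_pos_def_invertible sym_pos_def_mat_1)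
  then show ?thesis
    by (simp add: matrix_inv_mat_1)
qed

lemma tendsto_u_star: "((\<lambda>l. u_star (t0 l) (t1 l) m0 m1 S0 S1) \<longlongrightarrow> m0) F"
proof -
  have "((\<lambda>l. u_star (t0 l) (t1 l) m0 m1 S0 S1) \<longlongrightarrow> m0 - 0 *\<^sub>R (S0 *v (m0 - m1))) F"
    unfolding u_star_def
    by (intro tendsto_diff tendsto_scaleR tendsto_matrix_vector_mult tendsto_const r0 tendsto_h_star)
  then show ?thesis by simp
qed

lemma tendsto_v_star: "((\<lambda>l. v_star (t0 l) (t1 l) m0 m1 S0 S1) \<longlongrightarrow> m1) F"
proof -
  have "((\<lambda>l. v_star (t0 l) (t1 l) m0 m1 S0 S1) \<longlongrightarrow> m1 + 0 *\<^sub>R (S1 *v (m0 - m1))) F"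
    unfolding v_star_def
    by (intro tendsto_add tendsto_scaleR tendsto_matrix_vector_mult tendsto_const r1 tendsto_h_star)
  then show ?thesis by simp
qed

lemma gaussian_tendsto_p_star:
  "gaussian_tendsto (\<lambda>l. p_star (t0 l) (t1 l) m0 m1 S0 S1) (gaussian m0 S0) F"
  unfolding p_star_def
  by (intro gaussian_tendstoI tendsto_u_star tendsto_P_star eventually_sym_pos_def_P_star S0)

lemma gaussian_tendsto_q_star:
  "gaussian_tendsto (\<lambda>l. q_star (t0 l) (t1 l) m0 m1 S0 S1) (gaussian m1 S1) F"
  unfolding q_star_def
  by (intro gaussian_tendstoI tendsto_v_star tendsto_Q_star eventually_sym_pos_def_Q_star S1)

lemma tendsto_KL_p_star:
  "((\<lambda>l. enn2real (KL (p_star (t0 l) (t1 l) m0 m1 S0 S1) (gaussian m0 S0))) \<longlongrightarrow> 0) F"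
  unfolding p_star_def
  by (intro tendsto_KL_gaussian tendsto_u_star tendsto_P_star eventually_sym_pos_def_P_star S0)

lemma tendsto_KL_q_star:
  "((\<lambda>l. enn2real (KL (q_star (t0 l) (t1 l) m0 m1 S0 S1) (gaussian m1 S1))) \<longlongrightarrow> 0) F"
  unfolding q_star_def
  by (intro tendsto_KL_gaussian tendsto_v_star tendsto_Q_star eventually_sym_pos_def_Q_star S1)

end

section \<open>A bound on the Wasserstein term and the limit of \<open>M_star\<close>\<close>

lemma integrable_std_gaussian_norm_sq: "integrable (std_gaussian :: (real^'n) measure) (\<lambda>x. (norm x)\<^sup>2)"
  by (rule integrable_gaussian_norm_sq[OF sym_pos_def_mat_1])

text \<open>Both measures are driven by the same standard Gaussian vector. This coupling is in
  general not optimal, but its cost is continuous in the parameters, and boundedness is all that the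
  division by \<lambda> asks for.\<close>

lemma W2_gaussian_le:
  fixes P Q :: "real^'n^'n"
  assumes P: "sym_pos_def P" and Q: "sym_pos_def Q"
  shows "(W2 (gaussian u P) (gaussian v Q))\<^sup>2
    \<le> 2 * (norm (u - v))\<^sup>2 + 2 * (norm (mat_sqrt P - mat_sqrt Q))\<^sup>2 * (LINT x|(std_gaussian :: (real^'n) measure). (norm x)\<^sup>2)"
proof -
  interpret prob_space "std_gaussian :: (real^'n) measure"
    by (rule prob_space_std_gaussian)
  let ?D = "mat_sqrt P - mat_sqrt Q"
  let ?g = "\<lambda>x. 2 * (norm (u - v))\<^sup>2 + 2 * (norm ?D)\<^sup>2 * (norm (x :: real^'n))\<^sup>2"
  have le: "(norm ((u + mat_sqrt P *v x) - (v + mat_sqrt Q *v x)))\<^sup>2 \<le> ?g x" for x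
  proof -
    have eq: "(u + mat_sqrt P *v x) - (v + mat_sqrt Q *v x) = (u - v) + ?D *v x"
      by (simp add: matrix_vector_mult_diff_rdistrib)
    have "(norm (?D *v x))\<^sup>2 \<le> (norm ?D * norm x)\<^sup>2"
      by (intro power_mono norm_matrix_vector_le) simp
    then show ?thesis
      using norm_add_sq_le[of "u - v" "?D *v x"] unfolding eq power_mult_distrib by linarith
  qed
  have ig: "integrable std_gaussian ?g"
    by (intro Bochner_Integration.integrable_add integrable_mult_right integrable_const integrable_std_gaussian_norm_sq)
  have int: "integrable std_gaussian (\<lambda>x. (norm ((u + mat_sqrt P *v x) - (v + mat_sqrt Q *v x)))\<^sup>2)"
  proof (rule Bochner_Integration.integrable_bound[OF ig])
    show "AE x in std_gaussian. norm ((norm ((u + mat_sqrt P *v x) - (v + mat_sqrt Q *v x)))\<^sup>2) \<le> norm (?g x)"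
      by (intro AE_I2, unfold real_norm_def abs_of_nonneg[OF zero_le_power2]) (rule order_trans[OF le abs_ge_self])
  qed simp
  have "(W2 (gaussian u P) (gaussian v Q))\<^sup>2
      \<le> (LINT x|std_gaussian. (norm ((u + mat_sqrt P *v x) - (v + mat_sqrt Q *v x)))\<^sup>2)"
    unfolding gaussian_eq_distr_mat_sqrt[OF P] gaussian_eq_distr_mat_sqrt[OF Q]
    by (rule W2_distr_le(1)) (use int finite_measure_axioms in simp_all)
  also have "\<dots> \<le> (LINT x|std_gaussian. ?g x)"
    by (intro integral_mono int ig le)
  also have "\<dots> = 2 * (norm (u - v))\<^sup>2 + 2 * (norm ?D)\<^sup>2 * (LINT x|(std_gaussian :: (real^'n) measure). (norm x)\<^sup>2)"
    using prob_space by (simp add: integrable_std_gaussian_norm_sq)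
  finally show ?thesis .
qed

lemma tendsto_M_star:
  fixes S0 S1 :: "real^'n^'n" and m0 m1 :: "real^'n"
  assumes S0: "sym_pos_def S0" and S1: "sym_pos_def S1" and tb: "0 < tb0" "0 < tb1"
  shows "((\<lambda>l. M_star (l * tb0) (l * tb1) a b m0 m1 S0 S1)
    \<longlongrightarrow> a powr (tb0 / (tb0 + tb1)) * b powr (tb1 / (tb0 + tb1))) at_top"
proof -
  have pos: "\<forall>\<^sub>F l::real in at_top. 0 < l * tb" if "0 < tb" for tb
    using eventually_gt_at_top[of 0] by eventually_elim (use that in simp)
  have inv: "((\<lambda>l::real. k / (l * tb)) \<longlongrightarrow> 0) at_top" if "0 < tb" for tb k
    by (intro tendsto_divide_0[OF tendsto_const] filterlim_at_top_imp_at_infinity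
        filterlim_at_top_mult_tendsto_pos[OF tendsto_const that] filterlim_ident)
  note star = S0 S1 pos[OF tb(1)] pos[OF tb(2)] inv[OF tb(1), of 2] inv[OF tb(2), of 2]
  define p where "p = (\<lambda>l. p_star (l * tb0) (l * tb1) m0 m1 S0 S1)"
  define q where "q = (\<lambda>l. q_star (l * tb0) (l * tb1) m0 m1 S0 S1)"
  define E where "E = (LINT x|(std_gaussian :: (real^'n) measure). (norm x)\<^sup>2)"
  define B where "B = (\<lambda>l. 2 * (norm (u_star (l * tb0) (l * tb1) m0 m1 S0 S1 - v_star (l * tb0) (l * tb1) m0 m1 S0 S1))\<^sup>2
    + 2 * (norm (mat_sqrt (P_star (l * tb0) (l * tb1) S0 S1) - mat_sqrt (Q_star (l * tb0) (l * tb1) S0 S1)))\<^sup>2 * E)"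
  have "(B \<longlongrightarrow> 2 * (norm (m0 - m1))\<^sup>2 + 2 * (norm (mat_sqrt S0 - mat_sqrt S1))\<^sup>2 * E) at_top"
    unfolding B_def
    by (intro tendsto_add tendsto_mult tendsto_const tendsto_power tendsto_norm tendsto_diff
        tendsto_u_star[OF star] tendsto_v_star[OF star] tendsto_mat_sqrt tendsto_P_star[OF star]
        tendsto_Q_star[OF star] eventually_sym_pos_def_P_star[OF star] eventually_sym_pos_def_Q_star[OF star] S0 S1)
  from tendsto_mult[OF this inv[of "tb0 + tb1" 1]]
  have Blim: "((\<lambda>l. B l * (1 / (l * (tb0 + tb1)))) \<longlongrightarrow> 0) at_top"
    using tb by simp
  have W: "((\<lambda>l. (W2 (p l) (q l))\<^sup>2 * (1 / (l * (tb0 + tb1)))) \<longlongrightarrow> 0) at_top"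
  proof (rule tendsto_sandwich[OF _ _ tendsto_const Blim])
    show "\<forall>\<^sub>F l in at_top. 0 \<le> (W2 (p l) (q l))\<^sup>2 * (1 / (l * (tb0 + tb1)))"
      using eventually_gt_at_top[of 0] by eventually_elim (use tb in simp)
    show "\<forall>\<^sub>F l in at_top. (W2 (p l) (q l))\<^sup>2 * (1 / (l * (tb0 + tb1))) \<le> B l * (1 / (l * (tb0 + tb1)))"
      using eventually_gt_at_top[of 0] eventually_sym_pos_def_P_star[OF star] eventually_sym_pos_def_Q_star[OF star]
    proof eventually_elim
      case (elim l)
      have "(W2 (p l) (q l))\<^sup>2 \<le> B l"
        unfolding p_def q_def B_def p_star_def q_star_def E_def by (rule W2_gaussian_le) (use elim in auto)
      then show ?case
        using elim tb by (intro mult_right_mono) auto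
    qed
  qed
  let ?K0 = "\<lambda>l. enn2real (KL (p l) (gaussian m0 S0))" and ?K1 = "\<lambda>l. enn2real (KL (q l) (gaussian m1 S1))"
  have K: "(?K0 \<longlongrightarrow> 0) at_top" "(?K1 \<longlongrightarrow> 0) at_top"
    unfolding p_def q_def by (rule tendsto_KL_p_star[OF star] tendsto_KL_q_star[OF star])+
  \<comment> \<open>In the exponent each penalty weight \<open>l * tb0\<close>,
    \<open>l * tb1\<close> is divided by \<open>l * (tb0 + tb1)\<close>. The divergences therefore
    carry constant coefficients, and their convergence to 0 suffices without a rate.\<close>
  have "((\<lambda>l. - ((W2 (p l) (q l))\<^sup>2 * (1 / (l * (tb0 + tb1))) + tb0 / (tb0 + tb1) * ?K0 l + tb1 / (tb0 + tb1) * ?K1 l))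
      \<longlongrightarrow> - (0 + tb0 / (tb0 + tb1) * 0 + tb1 / (tb0 + tb1) * 0)) at_top"
    by (intro tendsto_minus tendsto_add tendsto_mult tendsto_const W K)
  then have "((\<lambda>l. - ((W2 (p l) (q l))\<^sup>2 * (1 / (l * (tb0 + tb1))) + tb0 / (tb0 + tb1) * ?K0 l + tb1 / (tb0 + tb1) * ?K1 l))
      \<longlongrightarrow> 0) at_top"
    by simp
  moreover have "\<forall>\<^sub>F l in at_top. - ((W2 (p l) (q l))\<^sup>2 * (1 / (l * (tb0 + tb1))) + tb0 / (tb0 + tb1) * ?K0 l + tb1 / (tb0 + tb1) * ?K1 l)
      = - A_star (l * tb0) (l * tb1) m0 m1 S0 S1 / (l * tb0 + l * tb1)"
    using eventually_gt_at_top[of 0]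
  proof eventually_elim
    case (elim l)
    define T where "T = tb0 + tb1"
    have T: "T \<noteq> 0" "l * tb0 + l * tb1 = l * T"
      using tb by (simp_all add: T_def distrib_left)
    have "- (w * (1 / (l * T)) + tb0 / T * k0 + tb1 / T * k1) = - (w + l * tb0 * k0 + l * tb1 * k1) / (l * T)"
      for w k0 k1
      using elim T(1) by (simp add: field_simps)
    then show ?case
      unfolding T(2) unfolding T_def[symmetric] by (simp add: A_star_def Let_def p_def q_def)
  qed
  ultimately have "((\<lambda>l. - A_star (l * tb0) (l * tb1) m0 m1 S0 S1 / (l * tb0 + l * tb1)) \<longlongrightarrow> 0) at_top"
    by (rule Lim_transform_eventually)
  then have "((\<lambda>l. a powr (tb0 / (tb0 + tb1)) * b powr (tb1 / (tb0 + tb1))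
        * exp (- A_star (l * tb0) (l * tb1) m0 m1 S0 S1 / (l * tb0 + l * tb1)))
      \<longlongrightarrow> a powr (tb0 / (tb0 + tb1)) * b powr (tb1 / (tb0 + tb1)) * exp 0) at_top"
    by (intro tendsto_mult tendsto_const tendsto_exp)
  moreover have "\<forall>\<^sub>F l in at_top. a powr (tb0 / (tb0 + tb1)) * b powr (tb1 / (tb0 + tb1))
        * exp (- A_star (l * tb0) (l * tb1) m0 m1 S0 S1 / (l * tb0 + l * tb1))
      = M_star (l * tb0) (l * tb1) a b m0 m1 S0 S1"
    using eventually_gt_at_top[of 0]
    by eventually_elim (simp add: M_star_def distrib_left[symmetric])
  ultimately show ?thesis
    by (simp add: Lim_transform_eventually)
qed

section \<open>Potentials and the expansion\<close>

text \<open>The expression is a common template for both Kantorovich potentials; quadratic growth is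
  what makes them exponentially integrable with a small constant.\<close>

lemma abs_quadratic_le:
  fixes M :: "real^'n^'n"
  obtains K where "0 < K"
    "\<And>x. \<bar>(norm x)\<^sup>2 - (x - v) \<bullet> (M *v (x - v)) - 2 * (w \<bullet> x) + k\<bar> \<le> K * (1 + (norm x)\<^sup>2)"
proof
  let ?K = "2 + 2 * norm M + 2 * (norm M * (norm v)\<^sup>2) + (norm w)\<^sup>2 + \<bar>k\<bar>"
  show "0 < ?K"
    by (simp add: add_pos_nonneg)
  fix x
  have "\<bar>(x - v) \<bullet> (M *v (x - v))\<bar> \<le> norm M * (norm (x - v))\<^sup>2"
    by (rule abs_quadratic_form_le)
  also have "\<dots> \<le> norm M * (2 * (norm x)\<^sup>2 + 2 * (norm v)\<^sup>2)"
    using norm_add_sq_le[of x "- v"] by (intro mult_left_mono) auto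
  finally have 1: "\<bar>(x - v) \<bullet> (M *v (x - v))\<bar> \<le> 2 * (norm M * (norm x)\<^sup>2) + 2 * (norm M * (norm v)\<^sup>2)"
    by (simp add: algebra_simps)
  have "2 * \<bar>w \<bullet> x\<bar> \<le> 2 * (norm w * norm x)"
    using Cauchy_Schwarz_ineq2[of w x] by simp
  also have "\<dots> \<le> (norm w)\<^sup>2 + (norm x)\<^sup>2"
    using zero_le_power2[of "norm w - norm x"] by (simp add: power2_diff)
  finally have 2: "2 * \<bar>w \<bullet> x\<bar> \<le> (norm w)\<^sup>2 + (norm x)\<^sup>2" .
  have "0 \<le> (norm M * (norm v)\<^sup>2) * (norm x)\<^sup>2" "0 \<le> (norm w)\<^sup>2 * (norm x)\<^sup>2" "0 \<le> \<bar>k\<bar> * (norm x)\<^sup>2"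
      "0 \<le> norm M" "0 \<le> (norm x)\<^sup>2"
    by simp_all
  moreover have "?K * (1 + (norm x)\<^sup>2) = ?K + 2 * (norm x)\<^sup>2 + 2 * (norm M * (norm x)\<^sup>2)
      + 2 * ((norm M * (norm v)\<^sup>2) * (norm x)\<^sup>2) + (norm w)\<^sup>2 * (norm x)\<^sup>2 + \<bar>k\<bar> * (norm x)\<^sup>2"
    by (simp add: algebra_simps)
  ultimately show "\<bar>(norm x)\<^sup>2 - (x - v) \<bullet> (M *v (x - v)) - 2 * (w \<bullet> x) + k\<bar> \<le> ?K * (1 + (norm x)\<^sup>2)"
    using 1 2 by linarith
qed

lemma integrable_gaussian_exp_abs:
  fixes S :: "real^'n^'n"
  assumes S: "sym_pos_def S" and [measurable]: "f \<in> borel_measurable borel"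
    and K: "0 < K" "\<And>x. \<bar>f x\<bar> \<le> K * (1 + (norm x)\<^sup>2)"
  obtains c where "0 < c" "integrable (gaussian m S) (\<lambda>x. exp (c * \<bar>f x\<bar>))"
proof -
  obtain e where e: "0 < e" "integrable (gaussian m S) (\<lambda>x. exp (e * (norm x)\<^sup>2))"
    using integrable_gaussian_exp_norm_sq[OF S] by blast
  have "integrable (gaussian m S) (\<lambda>x. exp (e / K * \<bar>f x\<bar>))"
  proof (rule Bochner_Integration.integrable_bound)
    show "integrable (gaussian m S) (\<lambda>x. exp e * exp (e * (norm x)\<^sup>2))"
      by (intro integrable_mult_right e)
    have "e / K * \<bar>f x\<bar> \<le> e + e * (norm x)\<^sup>2" for x
    proof -
      have "e / K * \<bar>f x\<bar> \<le> e / K * (K * (1 + (norm x)\<^sup>2))"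
        using K e by (intro mult_left_mono) auto
      also have "\<dots> = e + e * (norm x)\<^sup>2"
        using K by (simp add: field_simps)
      finally show ?thesis .
    qed
    then show "AE x in gaussian m S. norm (exp (e / K * \<bar>f x\<bar>)) \<le> norm (exp e * exp (e * (norm x)\<^sup>2))"
      by (intro AE_I2) (simp add: exp_add[symmetric])
  qed simp
  then show ?thesis
    using that[of "e / K"] e K by simp
qed

lemma integrable_of_integrable_exp_abs:
  fixes f :: "'a \<Rightarrow> real"
  assumes [measurable]: "f \<in> borel_measurable M" and c: "0 < c" "integrable M (\<lambda>x. exp (c * \<bar>f x\<bar>))"
  shows "integrable M f"
proof (rule Bochner_Integration.integrable_bound)
  show "integrable M (\<lambda>x. 1 / c * exp (c * \<bar>f x\<bar>))"
    by (intro integrable_mult_right c)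
  have "\<bar>y\<bar> \<le> 1 / c * exp (c * \<bar>y\<bar>)" for y
  proof -
    have "c * \<bar>y\<bar> \<le> exp (c * \<bar>y\<bar>)"
      using exp_ge_add_one_self[of "c * \<bar>y\<bar>"] by linarith
    then show ?thesis using c by (simp add: field_simps)
  qed
  then show "AE x in M. norm (f x) \<le> norm (1 / c * exp (c * \<bar>f x\<bar>))"
    using c by (intro AE_I2) simp
qed simp

text \<open>For the quadratic function \<open>f\<close> with gradient \<open>T x = m1 + L (x - m0)\<close>, the Kantorovich
  potentials are \<open>\<bar>x\<bar>\<^sup>2 - 2 f x\<close> and \<open>\<bar>y\<bar>\<^sup>2 - 2 f\<^sup>* y\<close>; the gap in the Kantorovich inequality
  is a square that vanishes on the graph of \<open>T\<close>.\<close>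

lemma gaussian_potentials:
  fixes S0 S1 :: "real^'n^'n" and m0 m1 :: "real^'n"
  assumes S0: "sym_pos_def S0" and S1: "sym_pos_def S1"
  obtains \<phi> \<psi> c where "\<phi> \<in> borel_measurable borel" "\<psi> \<in> borel_measurable borel"
    "\<And>x y. \<phi> x + \<psi> y \<le> (norm (x - y))\<^sup>2" "0 < c"
    "integrable (gaussian m0 S0) (\<lambda>x. exp (c * \<bar>\<phi> x\<bar>))" "integrable (gaussian m1 S1) (\<lambda>x. exp (c * \<bar>\<psi> x\<bar>))"
    "(W2 (gaussian m0 S0) (gaussian m1 S1))\<^sup>2 \<le> (LINT x|gaussian m0 S0. \<phi> x) + (LINT x|gaussian m1 S1. \<psi> x)"
    "(INF h \<in> couplings (gaussian m0 S0) (gaussian m1 S1). transport_cost h) < \<infinity>"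
proof -
  define L where "L = optimal_matrix S0 S1"
  have L: "sym_pos_def L" "L ** S0 ** L = S1"
    using sym_pos_def_optimal_matrix[OF S0 S1] optimal_matrix_congruence[OF S0 S1] by (simp_all add: L_def)
  define Li where "Li = matrix_inv L"
  have Li: "Li ** L = mat 1" "L ** Li = mat 1" "transpose Li = Li"
    using matrix_inv_left[OF sym_pos_def_invertible[OF L(1)]] matrix_inv_right[OF sym_pos_def_invertible[OF L(1)]]
      sym_pos_def_sym[OF sym_pos_def_matrix_inv[OF L(1)]] by (simp_all add: Li_def)
  \<comment> \<open>The trailing \<open>+ 0\<close> fits the template of
    \<open>abs_quadratic_le\<close>.\<close>
  define \<phi> where "\<phi> = (\<lambda>x. (norm x)\<^sup>2 - (x - m0) \<bullet> (L *v (x - m0)) - 2 * (m1 \<bullet> x) + 0)"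
  \<comment> \<open>The conjugate of the quadratic function contributes
    \<open>m0 \<bullet> (y - m1)\<close>, whence the constant
    \<open>2 * (m0 \<bullet> m1)\<close>.\<close>
  define \<psi> where "\<psi> = (\<lambda>y. (norm y)\<^sup>2 - (y - m1) \<bullet> (Li *v (y - m1)) - 2 * (m0 \<bullet> y) + 2 * (m0 \<bullet> m1))"
  define T where "T = (\<lambda>x. m1 + L *v (x - m0))"
  have [measurable]: "\<phi> \<in> borel_measurable borel" "\<psi> \<in> borel_measurable borel" "T \<in> borel_measurable borel"
    unfolding \<phi>_def \<psi>_def T_def by measurable
  \<comment> \<open>In coordinates centred at \<open>m0\<close> and \<open>m1\<close> this is
    completing the square: the mixed term reduces to \<open>p \<bullet> q\<close> because
    \<open>L\<close> and \<open>Li\<close> are inverse to each other.\<close>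
  have gap: "(norm (x - y))\<^sup>2 - (\<phi> x + \<psi> y) = (x - m0 - Li *v (y - m1)) \<bullet> (L *v (x - m0 - Li *v (y - m1)))" for x y
  proof -
    define p where "p = x - m0"
    define q where "q = y - m1"
    have xy: "x = p + m0" "y = q + m1"
      by (simp_all add: p_def q_def)
    have LLi: "L *v (Li *v q) = q"
      by (simp add: matrix_vector_mul_assoc Li)
    have "(Li *v q) \<bullet> (L *v p) = p \<bullet> q"
      using inner_matrix_vector_sym[OF sym_pos_def_sym[OF L(1)], of "Li *v q" p] LLi
      by (simp add: inner_commute)
    then have "(p - Li *v q) \<bullet> (L *v (p - Li *v q)) = p \<bullet> (L *v p) - 2 * (p \<bullet> q) + q \<bullet> (Li *v q)"
      by (simp add: matrix_vector_mult_diff_distrib LLi inner_diff_left inner_diff_right inner_commute)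
    then show ?thesis
      unfolding p_def[symmetric] q_def[symmetric] \<phi>_def \<psi>_def
      by (simp add: xy power2_norm_eq_inner inner_simps inner_commute algebra_simps)
  qed
  have le: "\<phi> x + \<psi> y \<le> (norm (x - y))\<^sup>2" for x y
  proof -
    obtain c where "0 < c" "\<And>x. c * (norm x)\<^sup>2 \<le> x \<bullet> (L *v x)"
      using sym_pos_def_coercive[OF L(1)] by blast
    then have "0 \<le> z \<bullet> (L *v z)" for z
      by (meson less_imp_le mult_nonneg_nonneg order_trans zero_le_power2)
    then show ?thesis
      using gap[of x y] by (metis diff_ge_0_iff_ge)
  qed
  have eq: "\<phi> x + \<psi> (T x) = (norm (x - T x))\<^sup>2" for x
    using gap[of x "T x"] by (simp add: T_def matrix_vector_mul_assoc Li)
  obtain K0 where K0: "0 < K0" "\<And>x. \<bar>\<phi> x\<bar> \<le> K0 * (1 + (norm x)\<^sup>2)"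
    unfolding \<phi>_def by (rule abs_quadratic_le) blast
  obtain K1 where K1: "0 < K1" "\<And>x. \<bar>\<psi> x\<bar> \<le> K1 * (1 + (norm x)\<^sup>2)"
    unfolding \<psi>_def by (rule abs_quadratic_le) blast
  obtain c0 where c0: "0 < c0" "integrable (gaussian m0 S0) (\<lambda>x. exp (c0 * \<bar>\<phi> x\<bar>))"
    by (rule integrable_gaussian_exp_abs[OF S0 _ K0]) simp_all
  obtain c1 where c1: "0 < c1" "integrable (gaussian m1 S1) (\<lambda>x. exp (c1 * \<bar>\<psi> x\<bar>))"
    by (rule integrable_gaussian_exp_abs[OF S1 _ K1]) simp_all
  define c where "c = min c0 c1"
  have e0: "integrable (gaussian m0 S0) (\<lambda>x. exp (c * \<bar>\<phi> x\<bar>))"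
    by (rule Bochner_Integration.integrable_bound[OF c0(2)]) (auto intro!: AE_I2 mult_right_mono simp: c_def)
  have e1: "integrable (gaussian m1 S1) (\<lambda>x. exp (c * \<bar>\<psi> x\<bar>))"
    by (rule Bochner_Integration.integrable_bound[OF c1(2)]) (auto intro!: AE_I2 mult_right_mono simp: c_def)
  \<comment> \<open>The factor \<open>L ** mat_sqrt S0\<close> of \<open>S1\<close> is in general
    not its principal root, but pushing the standard Gaussian through it factors through
    \<open>T\<close>.\<close>
  have g1: "gaussian m1 S1 = distr (gaussian m0 S0) borel T"
  proof -
    let ?B = "mat_sqrt S0"
    note B = sym_pos_def_mat_sqrt[OF S0]
    have "(L ** ?B) ** transpose (L ** ?B) = L ** (?B ** ?B) ** L"
      by (simp add: matrix_transpose_mul sym_pos_def_sym[OF L(1)] sym_pos_def_sym[OF B] matrix_mul_assoc)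
    then have S1_eq: "(L ** ?B) ** transpose (L ** ?B) = S1"
      by (simp add: mat_sqrt_square[OF S0] L(2))
    have "invertible (L ** ?B)"
      by (intro invertible_mult sym_pos_def_invertible L B)
    from gaussian_eq_distr_std_gaussian[OF this, of m1]
    have "gaussian m1 S1 = distr std_gaussian borel (\<lambda>x. m1 + (L ** ?B) *v x)"
      unfolding S1_eq .
    also have "\<dots> = distr (gaussian m0 S0) borel T"
      unfolding gaussian_eq_distr_mat_sqrt[OF S0]
      by (subst distr_distr) (simp_all add: comp_def T_def matrix_vector_mul_assoc)
    finally show ?thesis .
  qed
  interpret g0: prob_space "gaussian m0 S0"
    by (rule prob_space_gaussian[OF S0])
  have g0: "distr (gaussian m0 S0) borel (\<lambda>x. x) = gaussian m0 S0"
    by (rule measure_eqI) (simp_all add: emeasure_distr)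
  have i0: "integrable (gaussian m0 S0) \<phi>"
    by (rule integrable_of_integrable_exp_abs[OF _ c0]) simp
  have "integrable (gaussian m1 S1) \<psi>"
    by (rule integrable_of_integrable_exp_abs[OF _ c1]) simp
  then have i1: "integrable (gaussian m0 S0) (\<lambda>x. \<psi> (T x))"
    unfolding g1 by (simp add: integrable_distr_eq)
  have int: "integrable (gaussian m0 S0) (\<lambda>x. (norm (x - T x))\<^sup>2)"
    unfolding eq[symmetric] by (intro Bochner_Integration.integrable_add i0 i1)
  \<comment> \<open>Since the gap vanishes on the graph of \<open>T\<close>, the cost of this
    transport equals the dual value, which therefore bounds the squared Wasserstein distance from
    above.\<close>
  have "(LINT x|gaussian m0 S0. (norm (x - T x))\<^sup>2) = (LINT x|gaussian m0 S0. \<phi> x) + (LINT x|gaussian m0 S0. \<psi> (T x))"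
    unfolding eq[symmetric] by (rule Bochner_Integration.integral_add[OF i0 i1])
  also have "(LINT x|gaussian m0 S0. \<psi> (T x)) = (LINT x|gaussian m1 S1. \<psi> x)"
    unfolding g1 by (simp add: integral_distr)
  finally have cost: "(LINT x|gaussian m0 S0. (norm (x - T x))\<^sup>2)
      = (LINT x|gaussian m0 S0. \<phi> x) + (LINT x|gaussian m1 S1. \<psi> x)" .
  have "(\<lambda>x. x) \<in> borel_measurable (gaussian m0 S0)" "T \<in> borel_measurable (gaussian m0 S0)"
    by simp_all
  note W = W2_distr_le[OF g0.finite_measure_axioms this int, folded g1, unfolded g0]
  show ?thesis
    by (rule that[of \<phi> \<psi> c]) (use le c0 c1 e0 e1 W cost in \<open>auto simp: c_def\<close>)
qed

text \<open>The shift replaces \<open>exp (- (f x / t))\<close> by \<open>G / a\<close> times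
  itself, so integration against mass \<open>a\<close> leaves \<open>G\<close> in front of the
  unshifted integral and \<open>t * (a - G)\<close> from the constants. The condition
  \<open>1 / t \<le> c\<close> is where largeness of \<lambda> enters.\<close>

lemma shifted_potential:
  fixes f :: "'a \<Rightarrow> real"
  assumes M: "prob_space M" and [measurable]: "f \<in> borel_measurable M"
    and int: "integrable M (\<lambda>x. exp (c * \<bar>f x\<bar>))" and t: "0 < t" "1 / t \<le> c" and a: "0 < a" and G: "0 < G"
  shows "integrable (scale_measure (ennreal a) M) (\<lambda>x. exp \<bar>(f x - t * ln (G / a)) / t\<bar>)"
    and "t * (LINT x|scale_measure (ennreal a) M. 1 - exp (- ((f x - t * ln (G / a)) / t)))
      = t * (a - G) + G * (t * (LINT x|M. 1 - exp (- (f x / t))))"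
proof -
  interpret prob_space M by fact
  have bound: "\<bar>f x\<bar> / t \<le> c * \<bar>f x\<bar>" for x
    using mult_right_mono[OF t(2), of "\<bar>f x\<bar>"] by simp
  have "integrable M (\<lambda>x. exp \<bar>(f x - t * ln (G / a)) / t\<bar>)"
  proof (rule Bochner_Integration.integrable_bound)
    show "integrable M (\<lambda>x. exp \<bar>ln (G / a)\<bar> * exp (c * \<bar>f x\<bar>))"
      by (intro integrable_mult_right int)
    have "\<bar>(f x - t * ln (G / a)) / t\<bar> \<le> \<bar>ln (G / a)\<bar> + c * \<bar>f x\<bar>" for x
    proof -
      have "(f x - t * ln (G / a)) / t = f x / t - ln (G / a)"
        using t by (simp add: field_simps)
      then have "\<bar>(f x - t * ln (G / a)) / t\<bar> \<le> \<bar>f x / t\<bar> + \<bar>ln (G / a)\<bar>"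
        using abs_triangle_ineq4 by metis
      then show ?thesis
        using bound[of x] t by simp
    qed
    then show "AE x in M. norm (exp \<bar>(f x - t * ln (G / a)) / t\<bar>) \<le> norm (exp \<bar>ln (G / a)\<bar> * exp (c * \<bar>f x\<bar>))"
      by (intro AE_I2) (simp add: exp_add[symmetric])
  qed simp
  then show "integrable (scale_measure (ennreal a) M) (\<lambda>x. exp \<bar>(f x - t * ln (G / a)) / t\<bar>)"
    using a by (intro integrable_scale_measure) simp_all
  have ie: "integrable M (\<lambda>x. exp (- (f x / t)))"
  proof (rule Bochner_Integration.integrable_bound[OF int])
    have "- (f x / t) \<le> c * \<bar>f x\<bar>" for x
    proof -
      have "- (f x / t) \<le> \<bar>f x / t\<bar>"
        by (rule abs_ge_minus_self)
      also have "\<dots> = \<bar>f x\<bar> / t"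
        using t(1) by simp
      finally show ?thesis using bound[of x] by linarith
    qed
    then show "AE x in M. norm (exp (- (f x / t))) \<le> norm (exp (c * \<bar>f x\<bar>))"
      by (intro AE_I2) simp
  qed simp
  have shift: "exp (- ((f x - t * ln (G / a)) / t)) = G / a * exp (- (f x / t))" for x
  proof -
    have "- ((f x - t * ln (G / a)) / t) = ln (G / a) + - (f x / t)"
      using t by (simp add: field_simps)
    then have "exp (- ((f x - t * ln (G / a)) / t)) = exp (ln (G / a)) * exp (- (f x / t))"
      by (simp only: exp_add)
    then show ?thesis
      using a G by simp
  qed
  have "(LINT x|scale_measure (ennreal a) M. 1 - exp (- ((f x - t * ln (G / a)) / t)))
      = a * (LINT x|M. 1 - G / a * exp (- (f x / t)))"
    unfolding shift using a by (intro integral_scale_measure) simp_all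
  also have "\<dots> = a - G * (LINT x|M. exp (- (f x / t)))"
    using a ie prob_space by (simp add: right_diff_distrib)
  also have "\<dots> = a - G + G * (LINT x|M. 1 - exp (- (f x / t)))"
    using ie prob_space by (simp add: right_diff_distrib)
  finally have eq: "(LINT x|scale_measure (ennreal a) M. 1 - exp (- ((f x - t * ln (G / a)) / t)))
      = a - G + G * (LINT x|M. 1 - exp (- (f x / t)))" .
  show "t * (LINT x|scale_measure (ennreal a) M. 1 - exp (- ((f x - t * ln (G / a)) / t)))
      = t * (a - G) + G * (t * (LINT x|M. 1 - exp (- (f x / t))))"
    unfolding eq by (simp add: algebra_simps)
qed

section \<open>The weighted geometric mean and the asymptotic expansion\<close>

context
  fixes a b tb0 tb1 G c :: real
  assumes pos: "0 < a" "0 < b" "0 < tb0" "0 < tb1"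
  defines "G \<equiv> a powr (tb0 / (tb0 + tb1)) * b powr (tb1 / (tb0 + tb1))"
  defines "c \<equiv> tb0 * a + tb1 * b - (tb0 + tb1) * G"
begin

lemma G_pos: "0 < G"
  using pos by (simp add: G_def)

text \<open>\<open>ln G\<close> is the weighted mean of \<open>ln a\<close> and \<open>ln b\<close>.
  The identity is used twice: it cancels the shifts in the dual constraint, and it removes the
  logarithms from the primal bound so that its linear coefficient is exactly
  \<open>c\<close>.\<close>

lemma weighted_ln_ratio_eq_0: "tb0 * ln (G / a) + tb1 * ln (G / b) = 0"
proof -
  have "ln G = (tb0 * ln a + tb1 * ln b) / (tb0 + tb1)"
    unfolding G_def using pos by (simp add: ln_mult ln_powr add_divide_distrib)
  moreover have "tb0 + tb1 \<noteq> 0"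
    using pos by simp
  ultimately have "(tb0 + tb1) * ln G = tb0 * ln a + tb1 * ln b"
    by simp
  then show ?thesis
    using pos G_pos by (simp add: ln_div algebra_simps)
qed

text \<open>A form of the arithmetic-geometric gap in which sign and equality case are visible
  termwise, since \<open>x - 1 - ln x\<close> is nonnegative and vanishes only at 1.\<close>

lemma weighted_mean_gap:
  "c = tb0 * G * (a / G - 1 - ln (a / G)) + tb1 * G * (b / G - 1 - ln (b / G))"
proof -
  have "ln (a / G) = - ln (G / a)" "ln (b / G) = - ln (G / b)"
    using pos G_pos by (simp_all add: ln_div)
  then have "tb0 * G * (a / G - 1 - ln (a / G)) + tb1 * G * (b / G - 1 - ln (b / G))
      = c + G * (tb0 * ln (G / a) + tb1 * ln (G / b))"
    using G_pos by (simp add: c_def field_simps)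
  then show ?thesis
    by (simp add: weighted_ln_ratio_eq_0)
qed

lemma weighted_mean_gap_nonneg: "0 \<le> c"
  unfolding weighted_mean_gap using pos G_pos ln_le_minus_one[of "a / G"] ln_le_minus_one[of "b / G"]
  by (intro add_nonneg_nonneg mult_nonneg_nonneg) simp_all

lemma weighted_mean_gap_eq_0_iff: "c = 0 \<longleftrightarrow> a = b"
proof
  assume "c = 0"
  moreover have "0 \<le> tb0 * G * (a / G - 1 - ln (a / G))" "0 \<le> tb1 * G * (b / G - 1 - ln (b / G))"
    using pos G_pos ln_le_minus_one[of "a / G"] ln_le_minus_one[of "b / G"]
    by (intro mult_nonneg_nonneg; simp)+
  ultimately have "tb0 * G * (a / G - 1 - ln (a / G)) = 0" "tb1 * G * (b / G - 1 - ln (b / G)) = 0"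
    unfolding weighted_mean_gap by linarith+
  then have "ln (a / G) = a / G - 1" "ln (b / G) = b / G - 1"
    using pos G_pos by simp_all
  then have "a / G = 1" "b / G = 1"
    using pos G_pos by (metis divide_pos_pos ln_eq_minus_one)+
  then show "a = b"
    using G_pos by simp
next
  assume "a = b"
  moreover have "a powr (tb0 / (tb0 + tb1)) * a powr (tb1 / (tb0 + tb1)) = a"
    using pos by (simp add: powr_add[symmetric] add_divide_distrib[symmetric])
  ultimately show "c = 0"
    by (simp add: c_def G_def algebra_simps)
qed

text \<open>The last clause guards against the truncation of negative reals by
  \<open>ennreal\<close>; with it the expansion transfers to extended reals as a genuine
  equality.\<close>

lemma UOT_gaussian_expansion:
  fixes S0 S1 :: "real^'n^'n" and m0 m1 :: "real^'n"
  assumes S0: "sym_pos_def S0" and S1: "sym_pos_def S1"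
  defines "w \<equiv> (W2 (gaussian m0 S0) (gaussian m1 S1))\<^sup>2"
  obtains R where "(R \<longlongrightarrow> 0) at_top"
    "\<And>l. 0 < l \<Longrightarrow> UOT (l * tb0) (l * tb1) (scale_measure (ennreal a) (gaussian m0 S0)) (scale_measure (ennreal b) (gaussian m1 S1))
      = ennreal (l * c + G * w + R l)"
    "\<And>l. 0 < l \<Longrightarrow> 0 \<le> l * c + G * w + R l"
proof -
  let ?M = "gaussian m0 S0" and ?N = "gaussian m1 S1"
  note M = prob_space_gaussian[OF S0, of m0] and N = prob_space_gaussian[OF S1, of m1]
  define U where "U = (\<lambda>l. UOT (l * tb0) (l * tb1) (scale_measure (ennreal a) ?M) (scale_measure (ennreal b) ?N))"
  obtain \<phi> \<psi> k where
    meas [measurable]: "\<phi> \<in> borel_measurable borel" "\<psi> \<in> borel_measurable borel"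
    and le: "\<And>x y. \<phi> x + \<psi> y \<le> (norm (x - y))\<^sup>2" and k: "0 < k"
    and int: "integrable ?M (\<lambda>x. exp (k * \<bar>\<phi> x\<bar>))" "integrable ?N (\<lambda>x. exp (k * \<bar>\<psi> x\<bar>))"
    and w: "w \<le> (LINT x|?M. \<phi> x) + (LINT x|?N. \<psi> x)"
    and fin: "(INF h \<in> couplings ?M ?N. transport_cost h) < \<infinity>"
    unfolding w_def by (rule gaussian_potentials[OF S0 S1, of m0 m1]) blast
  have mM: "\<phi> \<in> borel_measurable ?M" and mN: "\<psi> \<in> borel_measurable ?N"
    by simp_all
  define J where "J = (\<lambda>l. l * tb0 * (LINT x|?M. 1 - exp (- (\<phi> x / (l * tb0))))
    + l * tb1 * (LINT x|?N. 1 - exp (- (\<psi> x / (l * tb1)))))"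
  have upper: "U l \<le> ennreal (l * c + G * w)" if "0 < l" for l
  proof -
    have "U l \<le> ennreal (G * w + l * tb0 * (G * ln (G / a) - G + a) + l * tb1 * (G * ln (G / b) - G + b))"
      unfolding U_def w_def using pos that G_pos by (intro UOT_le M N fin) simp_all
    also have "G * w + l * tb0 * (G * ln (G / a) - G + a) + l * tb1 * (G * ln (G / b) - G + b)
        = l * c + G * w + l * G * (tb0 * ln (G / a) + tb1 * ln (G / b))"
      by (simp add: c_def algebra_simps)
    finally show ?thesis
      by (simp add: weighted_ln_ratio_eq_0)
  qed
  have lower: "ennreal (l * c + G * J l) \<le> U l" if l: "0 < l" "1 / (l * tb0) \<le> k" "1 / (l * tb1) \<le> k" for l
  proof -
    have t: "0 < l * tb0" "0 < l * tb1"
      using l pos by simp_all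
    define \<phi>' where "\<phi>' = (\<lambda>x. \<phi> x - l * tb0 * ln (G / a))"
    define \<psi>' where "\<psi>' = (\<lambda>x. \<psi> x - l * tb1 * ln (G / b))"
    note sh0 = shifted_potential[OF M mM int(1) t(1) l(2) pos(1) G_pos]
    note sh1 = shifted_potential[OF N mN int(2) t(2) l(3) pos(2) G_pos]
    have "ennreal (l * tb0 * (LINT x|scale_measure (ennreal a) ?M. 1 - exp (- (\<phi>' x / (l * tb0))))
        + l * tb1 * (LINT x|scale_measure (ennreal b) ?N. 1 - exp (- (\<psi>' x / (l * tb1))))) \<le> U l"
      unfolding U_def
    proof (rule UOT_ge)
      have "l * (tb0 * ln (G / a) + tb1 * ln (G / b)) = 0"
        by (simp add: weighted_ln_ratio_eq_0)
      then show "\<phi>' x + \<psi>' y \<le> (norm (x - y))\<^sup>2" for x y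
        using le[of x y] by (simp add: \<phi>'_def \<psi>'_def algebra_simps)
    qed (use sh0(1) sh1(1) t in \<open>simp_all add: finite_measure_scale_measure M N \<phi>'_def \<psi>'_def\<close>)
    moreover have "(l * tb0 * (a - G) + G * X) + (l * tb1 * (b - G) + G * Y) = l * c + G * (X + Y)" for X Y
      by (simp add: c_def algebra_simps)
    ultimately show ?thesis
      unfolding \<phi>'_def \<psi>'_def sh0(2) sh1(2) J_def by simp
  qed
  \<comment> \<open>The remainder is simply the difference. The upper bound makes \<open>U l\<close>
    finite for every positive \<open>l\<close>, so nothing is lost by \<open>enn2real\<close>, and
    the expansion holds for all such \<open>l\<close> rather than eventually.\<close>
  define R where "R = (\<lambda>l. enn2real (U l) - (l * c + G * w))"
  have U: "U l = ennreal (enn2real (U l))" if "0 < l" for l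
    using le_less_trans[OF upper[OF that] ennreal_less_top] by simp
  have w0: "0 \<le> w" by (simp add: w_def)
  have "((\<lambda>l. l * tb * (LINT x|M. 1 - exp (- (f x / (l * tb))))) \<longlongrightarrow> (LINT x|M. f x)) at_top"
    if "0 < tb" "f \<in> borel_measurable M" "integrable M (\<lambda>x. exp (k * \<bar>f x\<bar>))"
    for tb and M :: "(real^'n) measure" and f
    by (rule filterlim_compose[OF tendsto_scaled_exp_integral[OF that(2) k that(3)]])
      (rule filterlim_at_top_mult_tendsto_pos[OF tendsto_const that(1) filterlim_ident])
  then have J: "(J \<longlongrightarrow> (LINT x|?M. \<phi> x) + (LINT x|?N. \<psi> x)) at_top"
    unfolding J_def using pos int by (intro tendsto_add) simp_all
  define I where "I = (LINT x|?M. \<phi> x) + (LINT x|?N. \<psi> x)"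
  have "((\<lambda>l. G * (J l - I)) \<longlongrightarrow> G * (I - I)) at_top"
    unfolding I_def by (intro tendsto_mult tendsto_diff tendsto_const J)
  then have GJ: "((\<lambda>l. G * (J l - I)) \<longlongrightarrow> 0) at_top"
    by simp
  \<comment> \<open>The remainder lies between \<open>G * (J l - I)\<close> and 0. For the lower
    side the inequality \<open>w \<le> I\<close> is enough; the two thresholds on \<open>l\<close>
    are those at which both exponentials become integrable.\<close>
  have "(R \<longlongrightarrow> 0) at_top"
  proof (rule tendsto_sandwich[OF _ _ GJ tendsto_const])
    show "\<forall>\<^sub>F l in at_top. R l \<le> 0"
      using eventually_gt_at_top[of 0]
    proof eventually_elim
      case (elim l)
      have "0 \<le> l * c + G * w"
        using elim weighted_mean_gap_nonneg G_pos w0 by simp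
      then show ?case
        using enn2real_mono[OF upper[OF elim]] by (simp add: R_def)
    qed
    show "\<forall>\<^sub>F l in at_top. G * (J l - I) \<le> R l"
      using eventually_gt_at_top[of 0] eventually_ge_at_top[of "1 / (k * tb0)"] eventually_ge_at_top[of "1 / (k * tb1)"]
    proof eventually_elim
      case (elim l)
      have "1 / (l * tb0) \<le> k" "1 / (l * tb1) \<le> k"
        using elim pos k by (simp_all add: field_simps)
      then have "ennreal (l * c + G * J l) \<le> ennreal (enn2real (U l))"
        using lower[of l] U[of l] elim by simp
      then have "l * c + G * J l \<le> enn2real (U l)"
        by (simp add: ennreal_le_iff)
      moreover have "G * w \<le> G * I"
        using w G_pos by (intro mult_left_mono) (auto simp: I_def)
      ultimately show ?case
        by (simp add: R_def algebra_simps)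
    qed
  qed
  moreover have "UOT (l * tb0) (l * tb1) (scale_measure (ennreal a) ?M) (scale_measure (ennreal b) ?N)
      = ennreal (l * c + G * w + R l)" if "0 < l" for l
  proof -
    have "UOT (l * tb0) (l * tb1) (scale_measure (ennreal a) ?M) (scale_measure (ennreal b) ?N) = U l"
      by (simp add: U_def)
    also have "\<dots> = ennreal (enn2real (U l))"
      by (rule U[OF that])
    also have "enn2real (U l) = l * c + G * w + R l"
      by (simp add: R_def)
    finally show ?thesis .
  qed
  moreover have "0 \<le> l * c + G * w + R l" for l
    by (simp add: R_def)
  ultimately show ?thesis
    by (rule that)
qed

end

theorem corollary4p3:
  fixes m0 m1 :: "real ^ 'n" and S0 S1 :: "real ^ 'n ^ 'n" and a b tb0 tb1 :: real
  assumes "sym_pos_def S0" and "sym_pos_def S1"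
    and "0 < a" and "0 < b" and "0 < tb0" and "0 < tb1"
  shows
    "let \<mu>0 = gaussian m0 S0; \<mu>1 = gaussian m1 S1;
         \<theta>0 = tb0 / (tb0 + tb1); \<theta>1 = tb1 / (tb0 + tb1);
         G = a powr \<theta>0 * b powr \<theta>1;
         c = tb0 * a + tb1 * b - (tb0 + tb1) * G
     in gaussian_tendsto (\<lambda>l. p_star (l * tb0) (l * tb1) m0 m1 S0 S1) \<mu>0 at_top
      \<and> gaussian_tendsto (\<lambda>l. q_star (l * tb0) (l * tb1) m0 m1 S0 S1) \<mu>1 at_top
      \<and> ((\<lambda>l. M_star (l * tb0) (l * tb1) a b m0 m1 S0 S1) \<longlongrightarrow> G) at_top
      \<and> (\<exists>R. R \<in> o[at_top](\<lambda>_. 1) \<and>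
           (\<forall>l>0. enn2ereal (UOT (l * tb0) (l * tb1)
                     (scale_measure (ennreal a) \<mu>0) (scale_measure (ennreal b) \<mu>1))
                  = ereal (l * c + G * (W2 \<mu>0 \<mu>1)\<^sup>2 + R l)))
      \<and> 0 \<le> c \<and> (c = 0 \<longleftrightarrow> a = b)
      \<and> (\<forall>m>0. ((\<lambda>l. UOT (l * tb0) (l * tb1)
                     (scale_measure (ennreal m) \<mu>0) (scale_measure (ennreal m) \<mu>1))
                  \<longlongrightarrow> ennreal (m * (W2 \<mu>0 \<mu>1)\<^sup>2)) at_top)"
  unfolding Let_def
proof (intro conjI allI impI)
  have pos: "\<forall>\<^sub>F l::real in at_top. 0 < l * tb" if "0 < tb" for tb
    using eventually_gt_at_top[of 0] by eventually_elim (use that in simp)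
  have inv: "((\<lambda>l::real. 2 / (l * tb)) \<longlongrightarrow> 0) at_top" if "0 < tb" for tb
    by (intro tendsto_divide_0[OF tendsto_const] filterlim_at_top_imp_at_infinity
        filterlim_at_top_mult_tendsto_pos[OF tendsto_const that] filterlim_ident)
  note star = assms(1,2) pos[OF assms(5)] pos[OF assms(6)] inv[OF assms(5)] inv[OF assms(6)]
  show "gaussian_tendsto (\<lambda>l. p_star (l * tb0) (l * tb1) m0 m1 S0 S1) (gaussian m0 S0) at_top"
    by (rule gaussian_tendsto_p_star[OF star])
  show "gaussian_tendsto (\<lambda>l. q_star (l * tb0) (l * tb1) m0 m1 S0 S1) (gaussian m1 S1) at_top"
    by (rule gaussian_tendsto_q_star[OF star])
  show "((\<lambda>l. M_star (l * tb0) (l * tb1) a b m0 m1 S0 S1)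
      \<longlongrightarrow> a powr (tb0 / (tb0 + tb1)) * b powr (tb1 / (tb0 + tb1))) at_top"
    by (rule tendsto_M_star[OF assms(1,2,5,6)])
  show "0 \<le> tb0 * a + tb1 * b - (tb0 + tb1) * (a powr (tb0 / (tb0 + tb1)) * b powr (tb1 / (tb0 + tb1)))"
    by (rule weighted_mean_gap_nonneg[OF assms(3-6)])
  show "tb0 * a + tb1 * b - (tb0 + tb1) * (a powr (tb0 / (tb0 + tb1)) * b powr (tb1 / (tb0 + tb1))) = 0 \<longleftrightarrow> a = b"
    by (rule weighted_mean_gap_eq_0_iff[OF assms(3-6)])
  obtain R where R: "(R \<longlongrightarrow> 0) at_top"
    "\<And>l. 0 < l \<Longrightarrow> UOT (l * tb0) (l * tb1) (scale_measure (ennreal a) (gaussian m0 S0)) (scale_measure (ennreal b) (gaussian m1 S1))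
      = ennreal (l * (tb0 * a + tb1 * b - (tb0 + tb1) * (a powr (tb0 / (tb0 + tb1)) * b powr (tb1 / (tb0 + tb1))))
        + a powr (tb0 / (tb0 + tb1)) * b powr (tb1 / (tb0 + tb1)) * (W2 (gaussian m0 S0) (gaussian m1 S1))\<^sup>2 + R l)"
    "\<And>l. 0 < l \<Longrightarrow> 0 \<le> l * (tb0 * a + tb1 * b - (tb0 + tb1) * (a powr (tb0 / (tb0 + tb1)) * b powr (tb1 / (tb0 + tb1))))
        + a powr (tb0 / (tb0 + tb1)) * b powr (tb1 / (tb0 + tb1)) * (W2 (gaussian m0 S0) (gaussian m1 S1))\<^sup>2 + R l"
    by (rule UOT_gaussian_expansion[OF assms(3-6) assms(1,2), of m0 m1]) blast
  have "R \<in> o[at_top](\<lambda>_. 1)"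
    using R(1) by (intro smalloI_tendsto) simp_all
  moreover have "\<forall>l>0. enn2ereal (UOT (l * tb0) (l * tb1) (scale_measure (ennreal a) (gaussian m0 S0)) (scale_measure (ennreal b) (gaussian m1 S1)))
      = ereal (l * (tb0 * a + tb1 * b - (tb0 + tb1) * (a powr (tb0 / (tb0 + tb1)) * b powr (tb1 / (tb0 + tb1))))
        + a powr (tb0 / (tb0 + tb1)) * b powr (tb1 / (tb0 + tb1)) * (W2 (gaussian m0 S0) (gaussian m1 S1))\<^sup>2 + R l)"
    using R(2,3) by (auto simp: enn2ereal_ennreal)
  ultimately show "\<exists>R. R \<in> o[at_top](\<lambda>_. 1) \<and>
      (\<forall>l>0. enn2ereal (UOT (l * tb0) (l * tb1) (scale_measure (ennreal a) (gaussian m0 S0)) (scale_measure (ennreal b) (gaussian m1 S1)))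
      = ereal (l * (tb0 * a + tb1 * b - (tb0 + tb1) * (a powr (tb0 / (tb0 + tb1)) * b powr (tb1 / (tb0 + tb1))))
        + a powr (tb0 / (tb0 + tb1)) * b powr (tb1 / (tb0 + tb1)) * (W2 (gaussian m0 S0) (gaussian m1 S1))\<^sup>2 + R l))"
    by blast
  fix m :: real assume m: "0 < m"
  have Gm: "m powr (tb0 / (tb0 + tb1)) * m powr (tb1 / (tb0 + tb1)) = m"
    using assms m by (simp add: powr_add[symmetric] add_divide_distrib[symmetric])
  have cm: "tb0 * m + tb1 * m - (tb0 + tb1) * m = 0"
    by (simp add: algebra_simps)
  \<comment> \<open>The same expansion with both masses equal to \<open>m\<close>: then
    \<open>G\<close> is \<open>m\<close> and the linear coefficient is 0, so only the transport term
    and the remainder are left.\<close>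
  obtain R' where R': "(R' \<longlongrightarrow> 0) at_top"
    "\<And>l. 0 < l \<Longrightarrow> UOT (l * tb0) (l * tb1) (scale_measure (ennreal m) (gaussian m0 S0)) (scale_measure (ennreal m) (gaussian m1 S1))
      = ennreal (m * (W2 (gaussian m0 S0) (gaussian m1 S1))\<^sup>2 + R' l)"
    by (rule UOT_gaussian_expansion[OF m m assms(5,6) assms(1,2), of m0 m1,
          unfolded Gm cm mult_zero_right add_0_left]) blast
  have "((\<lambda>l. ennreal (m * (W2 (gaussian m0 S0) (gaussian m1 S1))\<^sup>2 + R' l))
      \<longlongrightarrow> ennreal (m * (W2 (gaussian m0 S0) (gaussian m1 S1))\<^sup>2 + 0)) at_top"
    by (intro tendsto_ennrealI tendsto_add tendsto_const R')
  moreover have "\<forall>\<^sub>F l in at_top. ennreal (m * (W2 (gaussian m0 S0) (gaussian m1 S1))\<^sup>2 + R' l)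
      = UOT (l * tb0) (l * tb1) (scale_measure (ennreal m) (gaussian m0 S0)) (scale_measure (ennreal m) (gaussian m1 S1))"
    using eventually_gt_at_top[of 0] by eventually_elim (simp add: R'(2))
  ultimately show "((\<lambda>l. UOT (l * tb0) (l * tb1) (scale_measure (ennreal m) (gaussian m0 S0)) (scale_measure (ennreal m) (gaussian m1 S1)))
      \<longlongrightarrow> ennreal (m * (W2 (gaussian m0 S0) (gaussian m1 S1))\<^sup>2)) at_top"
    by (simp add: Lim_transform_eventually)
qed

end
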